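(* Let $d,m\ge1$ be integers, let $1\le q<\infty$, and let $U\subseteq\mathbb{R}^m$ be open and bounded. Let $A_n\to A$ in $W^{1,q}(U,\mathrm{Norm}(d))$ as $n\to\infty$. Assume that $\lambda,\lambda_n\in W^{1,q}(U,\mathbb{C}^d)$ are parameterizations of the eigenvalues of $A,A_n$, respectively. Assume that $\lambda_n\to\lambda$ in $L^\infty$ on $\mathcal{L}^{m-1}$-almost all line segments in $U$ parallel to the coordinate axes. Then $\partial_j\lambda_n\to\partial_j\lambda$ in $L^q(U,\mathbb{C}^d)$ as $n\to\infty$, for all $1\le j\le m$.
   Context: $M_d(\mathbb{C})$ is the space of complex $d\times d$ matrices with the Frobenius norm $\|\cdot\|_2$, and $\mathrm{Norm}(d)=\{A\in M_d(\mathbb{C}):A^*A=AA^*\}$. $W^{1,q}(U,\mathrm{Norm}(d))$ is the set of $A\in W^{1,q}(U,M_d(\mathbb{C}))$ with values in $\mathrm{Norm}(d)$, with the topology induced by the norm $\|A\|_{L^q}+\sum_i\|\partial_iA\|_{L^q}$, where $\|f\|_{L^q}=\big\|\,\|f\|_2\,\big\|_{L^q(U)}$. A parameterization of the eigenvalues of $A$ is a map $\lambda=(\lambda_1,\dots,\lambda_d):U\to\mathbb{C}^d$ such that $\lambda_1(x),\dots,\lambda_d(x)$ are the eigenvalues of $A(x)$ counted with multiplicity. Sobolev functions are represented by functions that are absolutely continuous on $\mathcal{L}^{m-1}$-almost all line segments in $U$ parallel to the coordinate axes. $\mathcal{L}^{m-1}$ is $(m-1)$-dimensional Lebesgue measure.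 The convergence assumption means: for each coordinate direction $e_j$ and for $\mathcal{L}^{m-1}$-almost every line $\ell$ parallel to $e_j$ (lines parametrized by their intersection with the hyperplane $x_j=0$), $\|\lambda_n-\lambda\|_{L^\infty(S)}\to0$ for every line segment $S\subseteq\ell\cap U$. *)

theory Defs
  imports
    "HOL-Analysis.Analysis"
    "HOL-Probability.Essential_Supremum"
    "HOL-Computational_Algebra.Polynomial"
begin

text \<open>Points of Euclidean $m$-space are of type \<open>real^'m\<close> with \<open>m = CARD('m)\<close>, and
  $d \times d$ matrices are of type \<open>complex^'d^'d\<close> with \<open>d = CARD('d)\<close>. The library norm on
  the latter is the Frobenius norm, and the one on \<open>complex^'d\<close> is the Euclidean norm.\<close>

section \<open>Normal matrices and their eigenvalues\<close>

definition conj_transpose :: "complex^'n^'m \<Rightarrow> complex^'m^'n" where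
  "conj_transpose A = (\<chi> i j. cnj (A $ j $ i))"

definition normal_matrices :: "(complex^'d^'d) set" where
  "normal_matrices = {A. conj_transpose A ** A = A ** conj_transpose A}"

definition charpoly :: "complex^'d^'d \<Rightarrow> complex poly" where
  "charpoly A = det (mat [:0, 1:] - (\<chi> i j. [:A $ i $ j:]))"

text \<open>Every number \<open>z\<close> occurs among the components of \<open>l x\<close> exactly as often as its algebraic
  multiplicity as an eigenvalue of \<open>A x\<close> (which is \<open>0\<close> if \<open>z\<close> is not an eigenvalue).\<close>

definition eigenvalue_parameterization ::
    "'a set \<Rightarrow> ('a \<Rightarrow> complex^'d^'d) \<Rightarrow> ('a \<Rightarrow> complex^'d) \<Rightarrow> bool" where
  "eigenvalue_parameterization U A l \<longleftrightarrow>
     (\<forall>x\<in>U. \<forall>z. card {i. l x $ i = z} = order z (charpoly (A x)))"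

section \<open>Lebesgue spaces\<close>

definition Lq_space :: "real \<Rightarrow> (real^'m) set \<Rightarrow> (real^'m \<Rightarrow> 'b::euclidean_space) set" where
  "Lq_space q U = {f \<in> borel_measurable (lebesgue_on U).
     integrable (lebesgue_on U) (\<lambda>x. norm (f x) powr q)}"

text \<open>Only meaningful for members of \<open>Lq_space q U\<close>; the Bochner integral of a
  non-integrable function is \<open>0\<close>.\<close>

definition Lq_norm :: "real \<Rightarrow> (real^'m) set \<Rightarrow> (real^'m \<Rightarrow> 'b::euclidean_space) \<Rightarrow> real" where
  "Lq_norm q U f = (LINT x|lebesgue_on U. norm (f x) powr q) powr (1 / q)"

section \<open>Weak partial derivatives\<close>

definition partial_deriv :: "'m \<Rightarrow> (real^'m \<Rightarrow> real) \<Rightarrow> real^'m \<Rightarrow> real" where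
  "partial_deriv j f x = frechet_derivative f (at x) (axis j 1)"

primrec Ck :: "nat \<Rightarrow> (real^'m \<Rightarrow> real) \<Rightarrow> bool" where
  "Ck 0 f \<longleftrightarrow> continuous_on UNIV f"
| "Ck (Suc k) f \<longleftrightarrow> (\<forall>x. f differentiable (at x)) \<and> (\<forall>j. Ck k (partial_deriv j f))"

definition test_functions :: "(real^'m) set \<Rightarrow> (real^'m \<Rightarrow> real) set" where
  "test_functions U =
     {\<phi>. (\<forall>k. Ck k \<phi>) \<and> compact (closure {x. \<phi> x \<noteq> 0}) \<and> closure {x. \<phi> x \<noteq> 0} \<subseteq> U}"

definition locally_integrable_on ::
    "(real^'m \<Rightarrow> 'b::euclidean_space) \<Rightarrow> (real^'m) set \<Rightarrow> bool" where
  "locally_integrable_on f U \<longleftrightarrow> (\<forall>K. compact K \<and> K \<subseteq> U \<longrightarrow> set_integrable lebesgue K f)"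

definition has_weak_pderiv ::
    "(real^'m) set \<Rightarrow> 'm \<Rightarrow> (real^'m \<Rightarrow> 'b::euclidean_space) \<Rightarrow> (real^'m \<Rightarrow> 'b) \<Rightarrow> bool" where
  "has_weak_pderiv U j f g \<longleftrightarrow>
     locally_integrable_on f U \<and> locally_integrable_on g U \<and>
     (\<forall>\<phi>\<in>test_functions U.
        (LINT x|lebesgue_on U. partial_deriv j \<phi> x *\<^sub>R f x) =
        - (LINT x|lebesgue_on U. \<phi> x *\<^sub>R g x))"

text \<open>On an open set a weak derivative is unique up to a null set; an arbitrary
  representative is chosen. The value is unspecified if no weak derivative exists.\<close>

definition weak_pderiv ::
    "(real^'m) set \<Rightarrow> 'm \<Rightarrow> (real^'m \<Rightarrow> 'b::euclidean_space) \<Rightarrow> real^'m \<Rightarrow> 'b" where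
  "weak_pderiv U j f = (SOME g. has_weak_pderiv U j f g)"

section \<open>Absolute continuity on line segments\<close>

definition abs_continuous_on :: "real set \<Rightarrow> (real \<Rightarrow> 'b::real_normed_vector) \<Rightarrow> bool" where
  "abs_continuous_on S f \<longleftrightarrow>
     (\<forall>\<epsilon>>0. \<exists>\<delta>>0. \<forall>D. D division_of \<Union>D \<and> \<Union>D \<subseteq> S \<and> (\<Sum>K\<in>D. Sup K - Inf K) < \<delta> \<longrightarrow>
        (\<Sum>K\<in>D. norm (f (Sup K) - f (Inf K))) < \<epsilon>)"

text \<open>The line parallel to the \<open>j\<close>-th coordinate axis which meets the hyperplane $x_j = 0$
  in the point with the remaining coordinates \<open>y i\<close>, \<open>i \<noteq> j\<close>.\<close>

definition coord_line :: "'m \<Rightarrow> ('m \<Rightarrow> real) \<Rightarrow> real \<Rightarrow> real^'m" where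
  "coord_line j y t = (\<chi> i. if i = j then t else y i)"

text \<open>The property \<open>P j y a b\<close> holds for almost every line \<open>coord_line j y\<close> parallel to a
  coordinate axis and every compact segment \<open>coord_line j y ` {a..b}\<close> of that line contained
  in \<open>U\<close>. The product measure is Lebesgue measure of dimension $m - 1$ on the coordinates
  other than \<open>j\<close>; for $m = 1$ it is the unit mass at a single point.\<close>

definition almost_all_segments ::
    "(real^'m) set \<Rightarrow> ('m \<Rightarrow> ('m \<Rightarrow> real) \<Rightarrow> real \<Rightarrow> real \<Rightarrow> bool) \<Rightarrow> bool" where
  "almost_all_segments U P \<longleftrightarrow>
     (\<forall>j. AE y in Pi\<^sub>M (UNIV - {j}) (\<lambda>_. lborel).
        \<forall>a b. a < b \<and> coord_line j y ` {a..b} \<subseteq> U \<longrightarrow> P j y a b)"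

definition ACL :: "(real^'m) set \<Rightarrow> (real^'m \<Rightarrow> 'b::real_normed_vector) \<Rightarrow> bool" where
  "ACL U f \<longleftrightarrow>
     almost_all_segments U (\<lambda>j y a b. abs_continuous_on {a..b} (\<lambda>t. f (coord_line j y t)))"

definition Linf_converges_on_segments ::
    "(real^'m) set \<Rightarrow> (nat \<Rightarrow> real^'m \<Rightarrow> 'b::real_normed_vector) \<Rightarrow> (real^'m \<Rightarrow> 'b) \<Rightarrow> bool" where
  "Linf_converges_on_segments U fs f \<longleftrightarrow>
     almost_all_segments U (\<lambda>j y a b.
       (\<lambda>n. esssup (lebesgue_on {a..b})
              (\<lambda>t. ennreal (norm (fs n (coord_line j y t) - f (coord_line j y t)))))
         \<longlonglongrightarrow> 0)"

section \<open>Sobolev spaces\<close>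

text \<open>Elements are actual functions, namely the representatives of the Sobolev classes that
  are absolutely continuous on almost all segments parallel to the axes.\<close>

definition sobolev_space :: "real \<Rightarrow> (real^'m) set \<Rightarrow> (real^'m \<Rightarrow> 'b::euclidean_space) set" where
  "sobolev_space q U =
     {f \<in> Lq_space q U. (\<forall>j. \<exists>g\<in>Lq_space q U. has_weak_pderiv U j f g) \<and> ACL U f}"

definition sobolev_norm :: "real \<Rightarrow> (real^'m) set \<Rightarrow> (real^'m \<Rightarrow> 'b::euclidean_space) \<Rightarrow> real" where
  "sobolev_norm q U f = Lq_norm q U f + (\<Sum>i\<in>UNIV. Lq_norm q U (weak_pderiv U i f))"

definition sobolev_normal :: "real \<Rightarrow> (real^'m) set \<Rightarrow> (real^'m \<Rightarrow> complex^'d^'d) set" where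
  "sobolev_normal q U = {A \<in> sobolev_space q U. A ` U \<subseteq> normal_matrices}"

end

theory Submission
  imports Defs "HOL-Computational_Algebra.Fundamental_Theorem_Algebra"
begin

text \<open>Absolute continuity on lines is replaced by difference quotients: for a weakly differentiable
  \<open>f\<close> one has $f(x + h e_j) - f(x) = h \int_0^1 \partial_j f(x + t h e_j)\,dt$ for almost every
  \<open>x\<close>, so by continuity of translations in $L^1$ the quotients converge to $\partial_j f$ almost
  everywhere along a suitable sequence $h_k \to 0$. The same continuity, applied to the indicator
  of $\{\lambda_i = \lambda_{i'}\}$, shows that for almost every \<open>x\<close> the coincidences among the
  eigenvalues at $x + h_k e_j$ are eventually those at \<open>x\<close>. Hence every eigenvector \<open>v\<close> of the
  normal matrix $A(x)$ for $\lambda_i(x)$ is a limit of eigenvectors of $A(x + h_k e_j)$ for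
  $\lambda_i(x + h_k e_j)$, which gives
  $\langle \partial_j A(x) v, v\rangle = \partial_j\lambda_i(x) \langle v, v\rangle$.

  This identity bounds $\partial_j\lambda$ by a multiple of $\|\partial_j A\|_2$, and by compactness
  of the unit sphere it passes to limits: if $A_n$, $\partial_j A_n$ and $\lambda_n$ converge at a
  point, so does $\partial_j\lambda_n$. Along subsequences these three convergences hold almost
  everywhere, and a dominated convergence argument concludes.\<close>

section \<open>Eigenvectors of normal matrices\<close>

text \<open>The obstacle is multiplicity. An eigenvector for a multiple eigenvalue of A(x) may
  split, at nearby points, into components belonging to distinct eigenvalues with distinct
  derivatives. Preservation of coincidences excludes this along the chosen steps: the spectral
  projection of A(x + h_k e_j), written as a Lagrange polynomial in the matrix, then carries v to an
  eigenvector tending to v. Normality enters twice. It makes one linear factor per distinct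
  eigenvalue enough to annihilate the matrix, so that these polynomials are projections; and it
  makes v an eigenvector of the adjoint, so that <A(x) v_k, v> is known exactly and no bound on (v_k
  - v) / h_k is required. As n tends to infinity, no matching of multiplicities between A_n and A is
  available. The identity is therefore kept for every eigenvector of A(x) for lambda_i(x), not for a
  selected one: whichever unit eigenvector arises as a limit, the identity applies to it. No
  measurable selection of eigenvectors occurs.\<close>

definition hip :: "complex^'n \<Rightarrow> complex^'n \<Rightarrow> complex" where
  "hip u v = (\<Sum>i\<in>UNIV. u $ i * cnj (v $ i))"

lemma hip_diff_left: "hip (u - v) w = hip u w - hip v w"
  by (simp add: hip_def algebra_simps sum_subtractf)

lemma hip_scale_left: "hip (c *s u) w = c * hip u w"
  by (simp add: hip_def algebra_simps sum_distrib_left)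

lemma hip_scale_right: "hip u (c *s w) = cnj c * hip u w"
  by (simp add: hip_def algebra_simps sum_distrib_left)

lemma hip_self: "hip u u = complex_of_real ((norm u)\<^sup>2)"
proof -
  have "hip u u = (\<Sum>i\<in>UNIV. complex_of_real ((norm (u $ i))\<^sup>2))"
    by (simp only: hip_def complex_norm_square)
  also have "\<dots> = complex_of_real ((norm u)\<^sup>2)"
    by (simp add: norm_vec_def L2_set_def sum_nonneg)
  finally show ?thesis .
qed

lemma hip_self_eq_0_iff: "hip u u = 0 \<longleftrightarrow> u = 0"
  by (simp add: hip_self)

lemma hip_matrix_left: "hip (A *v u) w = hip u (conj_transpose A *v w)"
proof -
  have "hip (A *v u) w = (\<Sum>i\<in>UNIV. \<Sum>j\<in>UNIV. A $ i $ j * u $ j * cnj (w $ i))"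
    by (simp add: hip_def matrix_vector_mult_def sum_distrib_right)
  also have "\<dots> = (\<Sum>j\<in>UNIV. \<Sum>i\<in>UNIV. A $ i $ j * u $ j * cnj (w $ i))"
    by (rule sum.swap)
  also have "\<dots> = hip u (conj_transpose A *v w)"
    by (simp add: hip_def matrix_vector_mult_def conj_transpose_def sum_distrib_left algebra_simps)
  finally show ?thesis .
qed

lemma conj_transpose_conj_transpose: "conj_transpose (conj_transpose A) = A"
  by (simp add: conj_transpose_def vec_eq_iff)

lemma hip_tendsto [tendsto_intros]:
  "(u \<longlongrightarrow> a) F \<Longrightarrow> (v \<longlongrightarrow> b) F \<Longrightarrow> ((\<lambda>x. hip (u x) (v x)) \<longlongrightarrow> hip a b) F"
  unfolding hip_def by (intro tendsto_intros tendsto_cnj)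

lemma matrix_vector_mult_tendsto [tendsto_intros]:
  fixes A :: "'a \<Rightarrow> complex^'n^'m"
  shows "(A \<longlongrightarrow> B) F \<Longrightarrow> (v \<longlongrightarrow> w) F \<Longrightarrow> ((\<lambda>x. A x *v v x) \<longlongrightarrow> B *v w) F"
  unfolding matrix_vector_mult_def by (intro tendsto_intros tendsto_vec_lambda)

lemma vector_scalar_mult_tendsto [tendsto_intros]:
  fixes v :: "'a \<Rightarrow> complex^'n"
  shows "(c \<longlongrightarrow> d) F \<Longrightarrow> (v \<longlongrightarrow> w) F \<Longrightarrow> ((\<lambda>x. c x *s v x) \<longlongrightarrow> d *s w) F"
  unfolding vector_scalar_mult_def by (intro tendsto_intros tendsto_vec_lambda)

text \<open>Entries of \<open>B\<close> and \<open>v\<close> are bounded by the norms, and there are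
  \<open>CARD('n)\<close> squared summands. The constant is crude; it only enters a
  majorant.\<close>

lemma norm_hip_matrix_le:
  fixes B :: "complex^'n^'n"
  shows "norm (hip (B *v v) v) \<le> real (CARD('n))^2 * norm B * (norm v)\<^sup>2"
proof -
  have *: "norm (B $ i $ j * v $ j * cnj (v $ i)) \<le> norm B * (norm v)\<^sup>2" for i j
  proof -
    have "norm (B $ i $ j) \<le> norm B"
      by (meson Finite_Cartesian_Product.norm_nth_le order_trans)
    moreover have "norm (v $ k) \<le> norm v" for k
      by (rule Finite_Cartesian_Product.norm_nth_le)
    ultimately have "norm (B $ i $ j) * norm (v $ j) * norm (v $ i) \<le> norm B * norm v * norm v"
      by (intro mult_mono) auto
    then show ?thesis
      by (simp add: norm_mult power2_eq_square)
  qed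
  have "hip (B *v v) v = (\<Sum>i\<in>UNIV. \<Sum>j\<in>UNIV. B $ i $ j * v $ j * cnj (v $ i))"
    by (simp add: hip_def matrix_vector_mult_def sum_distrib_right)
  also have "norm \<dots> \<le> (\<Sum>i\<in>(UNIV::'n set). \<Sum>j\<in>(UNIV::'n set). norm B * (norm v)\<^sup>2)"
    by (intro sum_norm_le *)
  also have "\<dots> = real (CARD('n))^2 * norm B * (norm v)\<^sup>2"
    by (simp add: power2_eq_square algebra_simps)
  finally show ?thesis .
qed

subsection \<open>Polynomials in a matrix\<close>

text \<open>This is p(B) v by Horner's scheme; acting on a vector, it gets by with matrix-vector
  products.\<close>

definition poly_apply :: "complex^'n^'n \<Rightarrow> complex poly \<Rightarrow> complex^'n \<Rightarrow> complex^'n" where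
  "poly_apply B p v = fold_coeffs (\<lambda>c w. c *s v + B *v w) p 0"

lemma poly_apply_0 [simp]: "poly_apply B 0 v = 0"
  by (simp add: poly_apply_def)

lemma poly_apply_pCons [simp]: "poly_apply B (pCons c p) v = c *s v + B *v poly_apply B p v"
  by (cases "c = 0 \<and> p = 0")
    (auto simp: poly_apply_def fold_coeffs_pCons_not_0_0_eq fold_coeffs_pCons_coeff_not_0_eq)

lemma poly_apply_1 [simp]: "poly_apply B 1 v = v"
  by (simp add: one_pCons)

lemma poly_apply_add: "poly_apply B (p + q) v = poly_apply B p v + poly_apply B q v"
  by (induction p q rule: poly_induct2)
    (auto simp: vec.scale_left_distrib matrix_vector_right_distrib algebra_simps)

lemma poly_apply_smult: "poly_apply B (smult c p) v = c *s poly_apply B p v"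
  by (induction p) (auto simp: vec.scale_right_distrib vec.scale)

lemma poly_apply_mult: "poly_apply B (p * q) v = poly_apply B p (poly_apply B q v)"
  by (induction p) (auto simp: poly_apply_add poly_apply_smult)

lemma poly_apply_sum: "poly_apply B (sum p I) v = (\<Sum>i\<in>I. poly_apply B (p i) v)"
  by (induction I rule: infinite_finite_induct) (auto simp: poly_apply_add)

lemma poly_apply_monom: "poly_apply B (monom c n) v = c *s ((*v) B ^^ n) v"
  by (induction n) (auto simp: monom_0 monom_Suc vec.scale)

text \<open>The N + 1 vectors u, B u, ..., B^N u in dimension N are linearly dependent, and the
  coefficients of a dependency form \<open>p\<close>.\<close>

lemma annihilating_poly_exists:
  fixes B :: "complex^'n^'n"
  obtains p where "p \<noteq> 0" "poly_apply B p u = 0"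
proof -
  define N where "N = CARD('n)"
  define f where "f i = ((*v) B ^^ i) u" for i
  show thesis
  proof (cases "inj_on f {..N}")
    \<comment> \<open>Linear dependence is a property of sets, which do not see repetitions in the
      list; a repetition directly gives the polynomial x^i - x^k.\<close>
    case False
    then obtain i k where ik: "i \<noteq> k" "f i = f k" by (auto simp: inj_on_def)
    show thesis
    proof (rule that)
      have "coeff (monom 1 i + monom (-1) k :: complex poly) i = 1"
        using ik by simp
      then show "(monom 1 i + monom (-1) k :: complex poly) \<noteq> 0" by (metis coeff_0 zero_neq_one)
      show "poly_apply B (monom 1 i + monom (-1) k) u = 0"
        using ik by (simp add: poly_apply_add poly_apply_monom f_def)
    qed
  next
    case True
    then have "card (f ` {..N}) = Suc N" by (simp add: card_image)
    then have "\<not> vec.independent (f ` {..N})"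
      using vec.independent_card_le_dim[of "f ` {..N}" UNIV] vec_dim_card[where 'a=complex and 'n='n]
      by (auto simp: N_def)
    then obtain c w where c: "w \<in> f ` {..N}" "c w \<noteq> 0" "(\<Sum>w\<in>f ` {..N}. c w *s w) = 0"
      using vec.dependent_finite[of "f ` {..N}"] by auto
    then obtain i0 where i0: "i0 \<le> N" "w = f i0" by auto
    define p where "p = (\<Sum>i\<le>N. monom (c (f i)) i)"
    show thesis
    proof (rule that)
      have "coeff p i0 = c (f i0)"
        using i0 by (simp add: p_def coeff_sum sum.delta)
      then show "p \<noteq> 0" using c i0 by auto
      have "poly_apply B p u = (\<Sum>i\<le>N. c (f i) *s f i)"
        by (simp add: p_def poly_apply_sum poly_apply_monom f_def)
      also have "\<dots> = (\<Sum>w\<in>f ` {..N}. c w *s w)"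
        by (simp add: sum.reindex[OF True])
      finally show "poly_apply B p u = 0" using c by simp
    qed
  qed
qed

text \<open>Linear factors are split off an annihilating polynomial of \<open>u\<close> one at a
  time. As \<open>u\<close> is nonzero, at some stage the remaining factor \<open>q\<close> no
  longer annihilates \<open>u\<close>, and then q(B) u is an eigenvector for the root just
  removed.\<close>

lemma eigenvector_in_cyclic_subspace:
  fixes B :: "complex^'n^'n"
  assumes "u \<noteq> 0"
  obtains r z where "poly_apply B r u \<noteq> 0" "B *v poly_apply B r u = z *s poly_apply B r u"
proof -
  have "\<exists>r z. poly_apply B r u \<noteq> 0 \<and> B *v poly_apply B r u = z *s poly_apply B r u"
    if "p \<noteq> 0" "poly_apply B p u = 0" for p
    using that
  proof (induction "degree p" arbitrary: p)
    case 0
    then obtain c where "p = [:c:]" using degree_eq_zeroE by metis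
    with 0 assms show ?case by auto
  next
    case (Suc n)
    then have "\<not> constant (poly p)"
      by (simp add: constant_degree)
    then obtain z where "poly p z = 0"
      using fundamental_theorem_of_algebra by blast
    then obtain q where q: "p = [:-z, 1:] * q" by (metis dvdE poly_eq_0_iff_dvd)
    with Suc.prems have "q \<noteq> 0" by auto
    have "degree p = Suc (degree q)" using \<open>q \<noteq> 0\<close> unfolding q by (subst degree_mult_eq) auto
    show ?case
    proof (cases "poly_apply B q u = 0")
      case True
      with Suc.hyps \<open>q \<noteq> 0\<close> \<open>degree p = Suc (degree q)\<close> show ?thesis by auto
    next
      case False
      have "poly_apply B [:-z, 1:] (poly_apply B q u) = 0"
        using Suc.prems unfolding q poly_apply_mult by simp
      then have "B *v poly_apply B q u = z *s poly_apply B q u"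
        by (simp add: vec.scale_minus_left)
      with False show ?thesis by blast
    qed
  qed
  with annihilating_poly_exists[of B u] that show thesis by metis
qed

subsection \<open>Normal matrices\<close>

lemma poly_apply_linear_factor: "poly_apply B [:- z, 1:] v = B *v v - z *s v"
  by (simp add: vec.scale_minus_left)

lemma normal_shift:
  assumes "B \<in> normal_matrices"
  shows "B - mat z \<in> normal_matrices"
proof -
  have m: "conj_transpose (B - mat z) = conj_transpose B - mat (cnj z)"
    by (auto simp: conj_transpose_def mat_def vec_eq_iff)
  have c: "mat z ** M = M ** mat z" for M :: "complex^'n^'n" and z
    by (simp add: matrix_matrix_mult_def mat_def vec_eq_iff if_distrib if_distribR sum.delta
        cong: if_cong)
  have d: "(M - N) ** P = M ** P - N ** P" "P ** (M - N) = P ** M - P ** N"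
    for M N P :: "complex^'n^'n"
    by (simp_all add: matrix_matrix_mult_def vec_eq_iff algebra_simps sum_subtractf)
  show ?thesis
    using assms unfolding normal_matrices_def mem_Collect_eq m d
    by (simp add: c[of z "conj_transpose B"] c[of "cnj z" B] c[of z "mat (cnj z)"])
qed

lemma normal_norm_eq:
  assumes "B \<in> normal_matrices"
  shows "hip (conj_transpose B *v v) (conj_transpose B *v v) = hip (B *v v) (B *v v)"
  using assms
  by (simp add: normal_matrices_def hip_matrix_left conj_transpose_conj_transpose
      matrix_vector_mul_assoc)

lemma normal_kernel_adjoint:
  assumes "B \<in> normal_matrices" "B *v v = 0"
  shows "conj_transpose B *v v = 0"
  using normal_norm_eq[OF assms(1), of v] assms(2) by (metis hip_self_eq_0_iff)

lemma mat_mult_vec: "mat z *v v = z *s v" for z :: complex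
  by (simp add: matrix_vector_mult_def mat_def vec_eq_iff if_distrib if_distribR sum.delta' cong: if_cong)

text \<open>B v lies in the kernel of \<open>B\<close>, hence in that of the adjoint, and moving
  \<open>B\<close> to the other side of <B v, B v> gives 0.\<close>

lemma normal_square_kernel:
  assumes "B \<in> normal_matrices" "B *v (B *v v) = 0"
  shows "B *v v = 0"
proof -
  have "hip (B *v v) (B *v v) = hip v 0"
    using normal_kernel_adjoint[OF assms] by (simp add: hip_matrix_left)
  then show ?thesis by (simp add: hip_self_eq_0_iff[symmetric]) (simp add: hip_def)
qed

lemma normal_adjoint_eigenvector:
  assumes "B \<in> normal_matrices" "B *v v = z *s v"
  shows "conj_transpose B *v v = cnj z *s v"
proof -
  have "conj_transpose (B - mat z) *v v = 0"
    using assms by (intro normal_kernel_adjoint normal_shift)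
      (simp_all add: matrix_vector_mult_diff_rdistrib mat_mult_vec)
  moreover have "conj_transpose (B - mat z) = conj_transpose B - mat (cnj z)"
    by (auto simp: conj_transpose_def mat_def vec_eq_iff)
  ultimately show ?thesis
    by (simp add: matrix_vector_mult_diff_rdistrib mat_mult_vec)
qed

text \<open>A nonzero vector in the range of the product generates a cyclic subspace containing an
  eigenvector, which lies in the range of \<open>B - z\<close> for the eigenvalue \<open>z\<close>; for normal \<open>B\<close> this
  range meets the kernel of \<open>B - z\<close> trivially.\<close>

lemma normal_annihilated_by_spectrum:
  fixes B :: "complex^'n^'n" and z :: "'i \<Rightarrow> complex"
  assumes "B \<in> normal_matrices" "finite J"
    and spec: "\<And>c v. v \<noteq> 0 \<Longrightarrow> B *v v = c *s v \<Longrightarrow> c \<in> z ` J"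
  shows "poly_apply B (\<Prod>j\<in>J. [:- z j, 1:]) w = 0"
proof (rule ccontr)
  define P where "P = (\<Prod>j\<in>J. [:- z j, 1:])"
  assume "poly_apply B (\<Prod>j\<in>J. [:- z j, 1:]) w \<noteq> 0"
  then obtain r c where r: "poly_apply B r (poly_apply B P w) \<noteq> 0"
    "B *v poly_apply B r (poly_apply B P w) = c *s poly_apply B r (poly_apply B P w)"
    using eigenvector_in_cyclic_subspace unfolding P_def by metis
  then obtain j where j: "j \<in> J" "c = z j" using spec by auto
  \<comment> \<open>Polynomials in \<open>B\<close> commute, so the factor of \<open>c\<close> can
    be applied last; this puts the eigenvector into the range of B - c.\<close>
  have "P = [:- c, 1:] * (\<Prod>j\<in>J - {j}. [:- z j, 1:])"
    unfolding P_def using j assms(2) by (subst prod.remove[of _ j]) auto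
  then have "r * P = [:- c, 1:] * ((\<Prod>j\<in>J - {j}. [:- z j, 1:]) * r)"
    by (simp only: ac_simps)
  then obtain y where "poly_apply B r (poly_apply B P w) = poly_apply B [:- c, 1:] y"
    by (metis poly_apply_mult)
  then have y: "poly_apply B r (poly_apply B P w) = (B - mat c) *v y"
    by (simp add: poly_apply_linear_factor matrix_vector_mult_diff_rdistrib mat_mult_vec vec.scale_minus_left
        del: poly_apply_pCons)
  have "(B - mat c) *v ((B - mat c) *v y) = 0"
    using r(2) unfolding y by (metis eq_iff_diff_eq_0 mat_mult_vec matrix_vector_mult_diff_rdistrib)
  then have "(B - mat c) *v y = 0"
    by (rule normal_square_kernel[OF normal_shift[OF assms(1)]])
  with r(1) y show False by simp
qed

text \<open>For large \<open>k\<close>, \<open>vk k\<close> is the spectral projection of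
  \<open>v\<close> belonging to \<open>lk k $ i\<close>, given by the Lagrange polynomial: the
  product over \<open>J\<close> of (B - z_j) / (z_i - z_j). In the limit each factor fixes
  \<open>v\<close>, because (A - l_j) v = (l_i - l_j) v with l_i and l_j distinct.\<close>

lemma eigenvector_perturbation:
  fixes Ak :: "nat \<Rightarrow> complex^'n^'n" and lk :: "nat \<Rightarrow> complex^'m"
  assumes normal: "\<And>k. Ak k \<in> normal_matrices"
    and spec: "\<And>k c v. v \<noteq> 0 \<Longrightarrow> Ak k *v v = c *s v \<Longrightarrow> \<exists>j. c = lk k $ j"
    and A: "Ak \<longlonglongrightarrow> A" and l: "lk \<longlonglongrightarrow> l"
    and mult: "\<forall>\<^sub>F k in sequentially. \<forall>i j. lk k $ i = lk k $ j \<longleftrightarrow> l $ i = l $ j"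
    and v: "A *v v = l $ i *s v"
  obtains vk where "vk \<longlonglongrightarrow> v" "\<forall>\<^sub>F k in sequentially. Ak k *v vk k = lk k $ i *s vk k"
proof -
  define J where "J = {j. l $ j \<noteq> l $ i}"
  \<comment> \<open>The denominator may vanish for small \<open>k\<close>, where 1 / 0 = 0; only
    large \<open>k\<close> matter for the two conclusions.\<close>
  define c where "c k j = 1 / (lk k $ i - lk k $ j)" for k j
  define w where "w k K = poly_apply (Ak k) (\<Prod>j\<in>K. smult (c k j) [:- lk k $ j, 1:]) v" for k K
  have lim: "(\<lambda>k. w k K) \<longlonglongrightarrow> v" if "finite K" "K \<subseteq> J" for K
    using that
  proof (induction K rule: finite_induct)
    case empty
    then show ?case by (simp add: w_def)
  next
    case (insert j K)
    have ij: "l $ i - l $ j \<noteq> 0" using insert.prems by (auto simp: J_def)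
    have "w k (insert j K) = c k j *s (Ak k *v w k K - lk k $ j *s w k K)" for k
      using insert.hyps unfolding w_def
      by (simp add: poly_apply_mult poly_apply_linear_factor poly_apply_smult del: poly_apply_pCons mult_smult_left smult_pCons)
    moreover have "(\<lambda>k. c k j *s (Ak k *v w k K - lk k $ j *s w k K))
        \<longlonglongrightarrow> (1 / (l $ i - l $ j)) *s (A *v v - l $ j *s v)"
      unfolding c_def using insert ij by (intro tendsto_intros A l tendsto_vec_nth) auto
    moreover have "(1 / (l $ i - l $ j)) *s (A *v v - l $ j *s v) = v"
      unfolding v vec.scale_left_diff_distrib[symmetric] vec.scale_scale using ij by simp
    ultimately show ?case by simp
  qed
  show thesis
  proof (rule that)
    show "(\<lambda>k. w k J) \<longlonglongrightarrow> v" by (rule lim) auto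
    show "\<forall>\<^sub>F k in sequentially. Ak k *v w k J = lk k $ i *s w k J"
      using mult
    proof (rule eventually_mono)
      fix k assume k: "\<forall>i j. lk k $ i = lk k $ j \<longleftrightarrow> l $ i = l $ j"
      \<comment> \<open>Where the coincidences agree, indices outside \<open>J\<close> carry the
        value \<open>lk k $ i\<close>, so the factors for \<open>i\<close> and for \<open>J\<close>
        exhaust the spectrum.\<close>
      have 0: "poly_apply (Ak k) (\<Prod>j\<in>insert i J. [:- lk k $ j, 1:]) v = 0"
      proof (rule normal_annihilated_by_spectrum[OF normal])
        fix c v assume "v \<noteq> 0" "Ak k *v v = c *s v"
        then obtain j where j: "c = lk k $ j" using spec by blast
        then show "c \<in> ($) (lk k) ` insert i J"
          using k unfolding J_def by (cases "l $ j = l $ i") auto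
      qed auto
      have "(\<Prod>j\<in>J. smult (c k j) [:- lk k $ j, 1:]) = smult (\<Prod>j\<in>J. c k j) (\<Prod>j\<in>J. [:- lk k $ j, 1:])"
        by (simp only: prod_smult)
      then have "poly_apply (Ak k) [:- lk k $ i, 1:] (w k J)
          = poly_apply (Ak k) ([:- lk k $ i, 1:] * smult (\<Prod>j\<in>J. c k j) (\<Prod>j\<in>J. [:- lk k $ j, 1:])) v"
        unfolding w_def poly_apply_mult by (simp only:)
      also have "\<dots> = (\<Prod>j\<in>J. c k j) *s poly_apply (Ak k) (\<Prod>j\<in>insert i J. [:- lk k $ j, 1:]) v"
        unfolding mult_smult_right poly_apply_smult by (simp add: J_def del: poly_apply_pCons mult_pCons_left)
      finally show "Ak k *v w k J = lk k $ i *s w k J"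
        using 0 by (simp add: poly_apply_linear_factor vec.scale_minus_left)
    qed
  qed
qed

text \<open>Pairing with \<open>v\<close> itself is the point: \<open>v\<close> is an eigenvector of
  the adjoint of \<open>A\<close>, so \<open>hip (A *v vk k) v\<close> equals
  \<open>l $ i * hip (vk k) v\<close> exactly. Subtracting this from the equation for
  \<open>Ak k\<close> and dividing by \<open>h k\<close> leaves quotients of \<open>Ak\<close> and
  \<open>lk\<close> only, and convergence of \<open>vk\<close> without any rate suffices.\<close>

lemma eigenvalue_derivative:
  fixes Ak :: "nat \<Rightarrow> complex^'n^'n" and lk :: "nat \<Rightarrow> complex^'m"
  assumes normal: "\<And>k. Ak k \<in> normal_matrices" "A \<in> normal_matrices"
    and spec: "\<And>k c v. v \<noteq> 0 \<Longrightarrow> Ak k *v v = c *s v \<Longrightarrow> \<exists>j. c = lk k $ j"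
    and h: "h \<longlonglongrightarrow> 0" "\<And>k. h k \<noteq> (0::real)"
    and A: "(\<lambda>k. (Ak k - A) /\<^sub>R h k) \<longlonglongrightarrow> A'" and l: "(\<lambda>k. (lk k - l) /\<^sub>R h k) \<longlonglongrightarrow> l'"
    and mult: "\<forall>\<^sub>F k in sequentially. \<forall>i j. lk k $ i = lk k $ j \<longleftrightarrow> l $ i = l $ j"
    and v: "A *v v = l $ i *s v"
  shows "hip (A' *v v) v = l' $ i * hip v v"
proof -
  have "(\<lambda>k. A + h k *\<^sub>R ((Ak k - A) /\<^sub>R h k)) \<longlonglongrightarrow> A + 0 *\<^sub>R A'"
    by (intro tendsto_intros A h)
  then have A0: "Ak \<longlonglongrightarrow> A" using h by simp
  have "(\<lambda>k. l + h k *\<^sub>R ((lk k - l) /\<^sub>R h k)) \<longlonglongrightarrow> l + 0 *\<^sub>R l'"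
    by (intro tendsto_intros l h)
  then have l0: "lk \<longlonglongrightarrow> l" using h by simp
  obtain vk where vk: "vk \<longlonglongrightarrow> v" "\<forall>\<^sub>F k in sequentially. Ak k *v vk k = lk k $ i *s vk k"
    by (rule eigenvector_perturbation[OF normal(1) spec A0 l0 mult v])
  have ev: "\<forall>\<^sub>F k in sequentially.
      hip (((Ak k - A) /\<^sub>R h k) *v vk k) v = ((lk k - l) /\<^sub>R h k) $ i * hip (vk k) v"
    using vk(2)
  proof (rule eventually_mono)
    fix k assume k: "Ak k *v vk k = lk k $ i *s vk k"
    have "hip (A *v vk k) v = l $ i * hip (vk k) v"
      unfolding hip_matrix_left normal_adjoint_eigenvector[OF normal(2) v] by (simp add: hip_scale_right)
    then have *: "hip ((Ak k - A) *v vk k) v = (lk k $ i - l $ i) * hip (vk k) v"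
      by (simp add: matrix_vector_mult_diff_rdistrib k hip_diff_left hip_scale_left algebra_simps)
    have "((Ak k - A) /\<^sub>R h k) *v vk k = complex_of_real (inverse (h k)) *s ((Ak k - A) *v vk k)"
      unfolding vec_eq_iff vector_smult_component
      by (simp add: matrix_vector_mult_def sum_distrib_left)
       (simp add: scaleR_conv_of_real algebra_simps)
    moreover have "((lk k - l) /\<^sub>R h k) $ i = complex_of_real (inverse (h k)) * (lk k $ i - l $ i)"
      unfolding vector_scaleR_component vector_minus_component by (rule scaleR_conv_of_real)
    ultimately show "hip (((Ak k - A) /\<^sub>R h k) *v vk k) v = ((lk k - l) /\<^sub>R h k) $ i * hip (vk k) v"
      using * by (simp add: hip_scale_left)
  qed
  have lim: "(\<lambda>k. hip (((Ak k - A) /\<^sub>R h k) *v vk k) v) \<longlonglongrightarrow> hip (A' *v v) v"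
    by (intro tendsto_intros A vk)
  have "(\<lambda>k. ((lk k - l) /\<^sub>R h k) $ i * hip (vk k) v) \<longlonglongrightarrow> l' $ i * hip v v"
    by (intro tendsto_intros tendsto_vec_nth l vk)
  with Lim_transform_eventually[OF lim ev] show ?thesis
    by (rule LIMSEQ_unique)
qed

subsection \<open>First-order eigenvalue perturbation as a closed relation\<close>

text \<open>The second clause ranges over all eigenvectors because multiplicities may jump in a
  limit, and a limit of eigenvectors can be any eigenvector of the limit matrix. The first clause
  keeps the second from being vacuous, so that \<open>l'\<close> is determined by the other
  arguments.\<close>

definition eigen_derivative ::
    "complex^'n^'n \<Rightarrow> complex^'n^'n \<Rightarrow> complex^'m \<Rightarrow> complex^'m \<Rightarrow> bool" where
  "eigen_derivative A A' l l' \<longleftrightarrow>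
     (\<forall>i. (\<exists>v. v \<noteq> 0 \<and> A *v v = l $ i *s v) \<and>
          (\<forall>v. A *v v = l $ i *s v \<longrightarrow> hip (A' *v v) v = l' $ i * hip v v))"

lemma eigen_derivative_unit_vector:
  assumes "eigen_derivative A A' l l'"
  obtains v where "norm v = 1" "A *v v = l $ i *s v" "hip (A' *v v) v = l' $ i"
proof -
  obtain v where v: "v \<noteq> 0" "A *v v = l $ i *s v" using assms unfolding eigen_derivative_def by blast
  define w where "w = complex_of_real (1 / norm v) *s v"
  have "w = (1 / norm v) *\<^sub>R v"
    unfolding w_def vec_eq_iff vector_smult_component vector_scaleR_component
    by (simp add: scaleR_conv_of_real)
  then have n: "norm w = 1" using v by simp
  have e: "A *v w = l $ i *s w"
    unfolding w_def vec.scale v by (simp add: vec_eq_iff)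
  then have "hip (A' *v w) w = l' $ i * hip w w"
    using assms unfolding eigen_derivative_def by blast
  with n e show thesis by (intro that[of w]) (simp_all add: hip_self)
qed

text \<open>Each component of \<open>l'\<close> is a value of the quadratic form of
  \<open>A'\<close> at a unit vector; the factor \<open>CARD('m)\<close> comes from summing the
  components.\<close>

lemma eigen_derivative_norm_le:
  fixes A A' :: "complex^'n^'n" and l l' :: "complex^'m"
  assumes "eigen_derivative A A' l l'"
  shows "norm l' \<le> real CARD('m) * real (CARD('n))^2 * norm A'"
proof -
  have "norm (l' $ i) \<le> real (CARD('n))^2 * norm A'" for i
    by (rule eigen_derivative_unit_vector[OF assms, of i]) (metis norm_hip_matrix_le mult_1_right one_power2)
  then have "(\<Sum>i\<in>UNIV. norm (l' $ i)) \<le> (\<Sum>i\<in>(UNIV::'m set). real (CARD('n))^2 * norm A')"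
    by (intro sum_mono)
  moreover have "norm l' \<le> (\<Sum>i\<in>UNIV. norm (l' $ i))"
    unfolding norm_vec_def by (rule L2_set_le_sum) simp
  ultimately show ?thesis by simp
qed

text \<open>Otherwise some neighbourhood of \<open>L\<close> is missed infinitely often, and the
  terms outside it form a subsequence none of whose subsequences tends to \<open>L\<close>.\<close>

lemma tendsto_sequentially_subseq:
  fixes X :: "nat \<Rightarrow> 'a :: topological_space"
  assumes "\<And>r. strict_mono (r :: nat \<Rightarrow> nat) \<Longrightarrow> \<exists>s. strict_mono (s :: nat \<Rightarrow> nat) \<and> (\<lambda>n. X (r (s n))) \<longlonglongrightarrow> L"
  shows "X \<longlonglongrightarrow> L"
proof (rule ccontr)
  assume "\<not> X \<longlonglongrightarrow> L"
  then obtain S where S: "open S" "L \<in> S" "\<not> (\<forall>\<^sub>F n in sequentially. X n \<in> S)"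
    unfolding tendsto_def by blast
  then have "infinite {n. X n \<notin> S}"
    by (simp flip: cofinite_eq_sequentially add: eventually_cofinite)
  then obtain r :: "nat \<Rightarrow> nat" where r: "strict_mono r" "\<And>n. X (r n) \<notin> S"
    using infinite_enumerate[of "{n. X n \<notin> S}"] by auto
  obtain s :: "nat \<Rightarrow> nat" where "(\<lambda>n. X (r (s n))) \<longlonglongrightarrow> L" using assms[OF r(1)] by blast
  then have "\<forall>\<^sub>F n in sequentially. X (r (s n)) \<in> S" using S by (auto simp: tendsto_def)
  then show False using r(2) by simp
qed

text \<open>Unit eigenvectors of \<open>Bn n\<close> for \<open>mn n $ i\<close> have a cluster
  point \<open>w\<close> on the sphere, and \<open>w\<close> is an eigenvector of \<open>A\<close>
  for \<open>l $ i\<close>. The identity at \<open>w\<close> identifies the limit, whatever the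
  choice of \<open>w\<close> and whatever the multiplicities.\<close>

lemma eigen_derivative_tendsto:
  assumes e: "\<And>n. eigen_derivative (Bn n) (Bn' n) (mn n) (mn' n)" "eigen_derivative A A' l l'"
    and lim: "Bn \<longlonglongrightarrow> A" "Bn' \<longlonglongrightarrow> A'" "mn \<longlonglongrightarrow> l"
  shows "mn' \<longlonglongrightarrow> l'"
proof (rule vec_tendstoI)
  fix i
  have "\<exists>v. norm v = 1 \<and> Bn n *v v = mn n $ i *s v \<and> hip (Bn' n *v v) v = mn' n $ i" for n
    by (rule eigen_derivative_unit_vector[OF e(1)[of n], of i]) blast
  then obtain v where v: "norm (v n) = 1" "Bn n *v v n = mn n $ i *s v n"
      "hip (Bn' n *v v n) (v n) = mn' n $ i" for n
    by metis
  show "(\<lambda>n. mn' n $ i) \<longlonglongrightarrow> l' $ i"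
  proof (rule tendsto_sequentially_subseq)
    fix r :: "nat \<Rightarrow> nat" assume r: "strict_mono r"
    have "seq_compact (sphere 0 1 :: (complex^'a) set)"
      using compact_eq_seq_compact_metric compact_sphere by blast
    then obtain w s where s: "strict_mono s" "(\<lambda>n. v (r (s n))) \<longlonglongrightarrow> w" "norm w = 1"
      unfolding seq_compact_def using v(1)
      by (auto simp: o_def dest!: spec[of _ "\<lambda>n. v (r n)"])
    define t where "t = r \<circ> s"
    have t: "strict_mono t" using r s by (simp add: t_def strict_mono_o)
    have lt: "(\<lambda>n. Bn (t n)) \<longlonglongrightarrow> A" "(\<lambda>n. Bn' (t n)) \<longlonglongrightarrow> A'" "(\<lambda>n. mn (t n)) \<longlonglongrightarrow> l"
      using lim LIMSEQ_subseq_LIMSEQ[OF _ t] by (auto simp: o_def)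
    have vt: "(\<lambda>n. v (t n)) \<longlonglongrightarrow> w" using s by (simp add: t_def)
    have "(\<lambda>n. Bn (t n) *v v (t n)) \<longlonglongrightarrow> A *v w" by (intro tendsto_intros lt vt)
    moreover have "(\<lambda>n. Bn (t n) *v v (t n)) \<longlonglongrightarrow> l $ i *s w"
      unfolding v by (intro tendsto_intros tendsto_vec_nth lt vt)
    ultimately have "A *v w = l $ i *s w" using LIMSEQ_unique by blast
    then have "hip (A' *v w) w = l' $ i * hip w w"
      using e(2) unfolding eigen_derivative_def by blast
    then have "hip (A' *v w) w = l' $ i"
      using s(3) by (simp add: hip_self)
    moreover have "(\<lambda>n. hip (Bn' (t n) *v v (t n)) (v (t n))) \<longlonglongrightarrow> hip (A' *v w) w"
      by (intro tendsto_intros lt vt)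
    ultimately have "(\<lambda>n. mn' (r (s n)) $ i) \<longlonglongrightarrow> l' $ i" unfolding v by (simp add: t_def)
    then show "\<exists>s. strict_mono s \<and> (\<lambda>n. mn' (r (s n)) $ i) \<longlonglongrightarrow> l' $ i" using s(1) by blast
  qed
qed

subsection \<open>Eigenvalue parameterizations\<close>

lemma poly_charpoly: "poly (charpoly A) z = det (mat z - A)"
  unfolding charpoly_def det_def
  by (simp add: poly_sum poly_prod mat_def) (auto intro!: sum.cong prod.cong)

lemma eigenvector_iff_charpoly:
  fixes A :: "complex^'n^'n"
  shows "(\<exists>v. v \<noteq> 0 \<and> A *v v = z *s v) \<longleftrightarrow> poly (charpoly A) z = 0"
proof -
  have "poly (charpoly A) z = 0 \<longleftrightarrow> \<not> (\<forall>v. (mat z - A) *v v = 0 \<longrightarrow> v = 0)"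
    unfolding poly_charpoly using invertible_det_nz[of "mat z - A"] invertible_left_inverse
      matrix_left_invertible_ker[of "mat z - A"] by blast
  then show ?thesis
    by (auto simp: matrix_vector_mult_diff_rdistrib mat_mult_vec)
qed

lemma eigenvalue_parameterization_iff:
  fixes l :: "'a \<Rightarrow> complex^'d"
  assumes "eigenvalue_parameterization U A l" "x \<in> U"
  shows "(\<exists>v. v \<noteq> 0 \<and> A x *v v = z *s v) \<longleftrightarrow> (\<exists>i. z = l x $ i)"
proof -
  have ord: "card {i. l x $ i = z} = order z (charpoly (A x))" for z
    using assms by (auto simp: eigenvalue_parameterization_def)
  have "charpoly (A x) \<noteq> 0"
  proof
    assume 0: "charpoly (A x) = 0"
    obtain z where z: "z \<notin> range (($) (l x))"
      using ex_new_if_finite[of "range (($) (l x))"] infinite_UNIV_char_0 by auto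
    \<comment> \<open>\<open>order z 0\<close> is a least element of an empty set, hence a default
      value independent of \<open>z\<close>. The counts would then agree at a component of
      \<open>l x\<close>, where the count is positive, and at a number that is no component.\<close>
    have "order z (0 :: complex poly) = order (l x $ undefined) 0"
      by (simp add: order_def)
    then have "card {i. l x $ i = l x $ undefined} = card {i. l x $ i = z}"
      using ord 0 by metis
    moreover have "{i. l x $ i = z} = {}" using z by auto
    ultimately show False by auto
  qed
  then have "poly (charpoly (A x)) z = 0 \<longleftrightarrow> card {i. l x $ i = z} \<noteq> 0"
    unfolding ord by (simp add: order_root)
  then show ?thesis unfolding eigenvector_iff_charpoly by auto
qed

section \<open>Smooth bumps and test functions\<close>

subsection \<open>Smooth functions of one variable\<close>

text \<open>The derivative is an existential witness, so closure properties follow by induction on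
  \<open>k\<close>, each rule of differentiation supplying the next witness.\<close>

primrec C_real :: "nat \<Rightarrow> (real \<Rightarrow> real) \<Rightarrow> bool" where
  "C_real 0 f \<longleftrightarrow> continuous_on UNIV f"
| "C_real (Suc k) f \<longleftrightarrow> (\<exists>f'. (\<forall>t. (f has_real_derivative f' t) (at t)) \<and> C_real k f')"

definition smooth_real :: "(real \<Rightarrow> real) \<Rightarrow> bool" where
  "smooth_real f \<longleftrightarrow> (\<forall>k. C_real k f)"

lemma has_real_derivative_imp_continuous_on:
  "(\<And>t. (f has_real_derivative f' t) (at t)) \<Longrightarrow> continuous_on UNIV f"
  by (meson DERIV_isCont continuous_at_imp_continuous_on)

lemma C_real_Suc_imp: "C_real (Suc k) f \<Longrightarrow> C_real k f"
proof (induction k arbitrary: f)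
  case 0
  then show ?case by (auto intro: has_real_derivative_imp_continuous_on)
next
  case (Suc k)
  then show ?case by (metis C_real.simps(2))
qed

lemma C_real_const: "C_real k (\<lambda>t. c)"
proof (induction k arbitrary: c)
  case (Suc k)
  then show ?case by (auto intro!: exI[of _ "\<lambda>_. 0"] derivative_eq_intros)
qed auto

lemma C_real_add: "C_real k f \<Longrightarrow> C_real k g \<Longrightarrow> C_real k (\<lambda>t. f t + g t)"
proof (induction k arbitrary: f g)
  case (Suc k)
  then obtain f' g' where "\<forall>t. (f has_real_derivative f' t) (at t)" "C_real k f'"
    "\<forall>t. (g has_real_derivative g' t) (at t)" "C_real k g'" by auto
  with Suc.IH[of f' g'] show ?case
    by (auto intro!: exI[of _ "\<lambda>t. f' t + g' t"] DERIV_add)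
qed (auto intro: continuous_intros)

lemma C_real_mult: "C_real k f \<Longrightarrow> C_real k g \<Longrightarrow> C_real k (\<lambda>t. f t * g t)"
proof (induction k arbitrary: f g)
  case (Suc k)
  then obtain f' g' where *: "\<forall>t. (f has_real_derivative f' t) (at t)" "C_real k f'"
    "\<forall>t. (g has_real_derivative g' t) (at t)" "C_real k g'" by auto
  have "C_real k f" "C_real k g" using Suc.prems C_real_Suc_imp by blast+
  with * Suc.IH[of f' g] Suc.IH[of g' f] show ?case
    by (auto intro!: exI[of _ "\<lambda>t. f' t * g t + g' t * f t"] DERIV_mult' C_real_add derivative_eq_intros)
qed (auto intro: continuous_intros)

lemma C_real_affine: "C_real k f \<Longrightarrow> C_real k (\<lambda>t. f (c * t + d))"
proof (induction k arbitrary: f)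
  case 0
  then show ?case by (auto intro!: continuous_on_compose2[of UNIV f] continuous_intros)
next
  case (Suc k)
  then obtain f' where f: "\<forall>t. (f has_real_derivative f' t) (at t)" "C_real k f'" by auto
  have "((\<lambda>t. f (c * t + d)) has_real_derivative c * f' (c * t + d)) (at t)" for t
  proof -
    have "((\<lambda>t. c * t + d) has_real_derivative c) (at t)" by (auto intro!: derivative_eq_intros)
    from DERIV_chain2[of f "f' (c * t + d)" "\<lambda>t. c * t + d" t c UNIV, OF f(1)[rule_format] this]
    show ?thesis by (simp only: mult.commute)
  qed
  moreover have "C_real k (\<lambda>t. c * f' (c * t + d))"
    by (intro C_real_mult C_real_const Suc.IH f)
  ultimately show ?case by (auto intro!: exI[of _ "\<lambda>t. c * f' (c * t + d)"])
qed

lemma smooth_real_mult: "smooth_real f \<Longrightarrow> smooth_real g \<Longrightarrow> smooth_real (\<lambda>t. f t * g t)"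
  by (simp add: smooth_real_def C_real_mult)

lemma smooth_real_diff: "smooth_real f \<Longrightarrow> smooth_real g \<Longrightarrow> smooth_real (\<lambda>t. f t - g t)"
  using C_real_add[of _ f "\<lambda>t. - 1 * g t"] C_real_mult[OF C_real_const, of _ g "-1"]
  by (simp add: smooth_real_def)

lemma smooth_real_affine: "smooth_real f \<Longrightarrow> smooth_real (\<lambda>t. f (c * t + d))"
  by (simp add: smooth_real_def C_real_affine)

lemma smooth_real_antideriv:
  assumes "\<And>t. (f has_real_derivative f' t) (at t)" "smooth_real f'"
  shows "smooth_real f"
  unfolding smooth_real_def
proof
  fix k show "C_real k f"
    using assms by (cases k) (auto simp: smooth_real_def intro: has_real_derivative_imp_continuous_on)
qed

lemma smooth_real_deriv:
  assumes "smooth_real f"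
  shows "(f has_real_derivative deriv f t) (at t)" "smooth_real (deriv f)"
proof -
  have *: "\<exists>f'. (\<forall>t. (f has_real_derivative f' t) (at t)) \<and> C_real k f'" for k
    using assms C_real.simps(2)[of k f] by (simp add: smooth_real_def)
  have d: "deriv f = f'" if "\<forall>t. (f has_real_derivative f' t) (at t)" for f'
    using that DERIV_imp_deriv by blast
  show "(f has_real_derivative deriv f t) (at t)" using *[of 0] d by metis
  show "smooth_real (deriv f)" unfolding smooth_real_def using * d by metis
qed

lemma smooth_real_continuous: "smooth_real f \<Longrightarrow> continuous_on UNIV f"
  unfolding smooth_real_def using C_real.simps(1) by blast

text \<open>The classical flat function exp(-1/t), extended by 0. The polynomial factor makes the
  family closed under differentiation.\<close>

definition flat_exp :: "real poly \<Rightarrow> real \<Rightarrow> real" where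
  "flat_exp p t = (if t > 0 then poly p (1 / t) * exp (- (1 / t)) else 0)"

lemma poly_times_exp_minus_tendsto_0: "((\<lambda>s. poly p s * exp (- s)) \<longlongrightarrow> (0::real)) at_top"
proof -
  have "((\<lambda>s. \<Sum>i\<le>degree p. coeff p i * (s ^ i / exp s)) \<longlongrightarrow> (\<Sum>i\<le>degree p. coeff p i * 0)) at_top"
    by (intro tendsto_intros tendsto_power_div_exp_0)
  then show ?thesis
    by (simp add: poly_altdef sum_distrib_right exp_minus field_simps sum_divide_distrib)
qed

text \<open>With s = 1/t the chain rule turns p(s) exp(-s) into s^2 (p(s) - p'(s)) exp(-s). At 0 the
  right difference quotient is s p(s) exp(-s), which tends to 0 as s grows.\<close>

lemma flat_exp_deriv: "(flat_exp p has_real_derivative flat_exp ([:0, 0, 1:] * (p - pderiv p)) t) (at t)"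
proof -
  consider "t > 0" | "t < 0" | "t = 0" by linarith
  then show ?thesis
  proof cases
    case 1
    have ev: "\<forall>\<^sub>F x in nhds t. poly p (1 / x) * exp (- (1 / x)) = flat_exp p x"
      using 1 eventually_nhds_in_open[of "{0<..}" t] by (auto elim!: eventually_mono simp: flat_exp_def)
    have "((\<lambda>x. poly p (1 / x) * exp (- (1 / x))) has_real_derivative
        flat_exp ([:0, 0, 1:] * (p - pderiv p)) t) (at t)"
      using 1 by (auto intro!: derivative_eq_intros DERIV_chain2[OF poly_DERIV] simp: flat_exp_def field_simps power2_eq_square)
    then show ?thesis using DERIV_cong_ev[OF refl ev refl] by simp
  next
    case 2
    have ev: "\<forall>\<^sub>F x in nhds t. 0 = flat_exp p x"
      using 2 eventually_nhds_in_open[of "{..<0}" t] by (auto elim!: eventually_mono simp: flat_exp_def)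
    have "((\<lambda>x. 0) has_real_derivative flat_exp ([:0, 0, 1:] * (p - pderiv p)) t) (at t)"
      using 2 by (auto simp: flat_exp_def)
    then show ?thesis using DERIV_cong_ev[OF refl ev refl] by simp
  next
    case 3
    have "((\<lambda>h. poly (pCons 0 p) (inverse h) * exp (- inverse h)) \<longlongrightarrow> 0) (at_right 0)"
      using filterlim_compose[OF poly_times_exp_minus_tendsto_0 filterlim_inverse_at_top_right] .
    moreover have "\<forall>\<^sub>F h in at_right 0. poly (pCons 0 p) (inverse h) * exp (- inverse h) = flat_exp p h / h"
      using eventually_at_right_less[of 0]
      by eventually_elim (auto simp: flat_exp_def field_simps)
    ultimately have R: "((\<lambda>h. flat_exp p h / h) \<longlongrightarrow> 0) (at_right 0)"
      by (rule Lim_transform_eventually)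
    have "\<forall>\<^sub>F h in at_left 0. flat_exp p h / h = 0"
      by (auto simp: flat_exp_def eventually_at_filter)
    then have L: "((\<lambda>h. flat_exp p h / h) \<longlongrightarrow> 0) (at_left 0)"
      by (rule tendsto_eventually)
    have "((\<lambda>h. flat_exp p h / h) \<longlongrightarrow> 0) (at 0)"
      using L R by (simp add: filterlim_split_at)
    then show ?thesis using 3 by (simp add: DERIV_def flat_exp_def)
  qed
qed

lemma smooth_flat_exp: "smooth_real (flat_exp p)"
  unfolding smooth_real_def
proof
  fix k show "C_real k (flat_exp p)"
  proof (induction k arbitrary: p)
    case 0
    then show ?case using has_real_derivative_imp_continuous_on[OF flat_exp_deriv] by simp
  next
    case (Suc k)
    then show ?case using flat_exp_deriv by (metis C_real.simps(2))
  qed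
qed

text \<open>Increasing \<open>n\<close> leaves the support inside the interval and drives the values
  there to 1: smooth approximants of the indicator, bounded by 1 and hence fit for dominated
  convergence.\<close>

definition bump :: "nat \<Rightarrow> real \<Rightarrow> real \<Rightarrow> real \<Rightarrow> real" where
  "bump n a b t = flat_exp 1 (real n * (t - a)) * flat_exp 1 (real n * (b - t))"

lemma smooth_bump: "smooth_real (bump n a b)"
proof -
  have "smooth_real (\<lambda>t. flat_exp 1 (real n * t + (- real n * a)) * flat_exp 1 (- real n * t + real n * b))"
    by (intro smooth_real_mult smooth_real_affine smooth_flat_exp)
  moreover have "bump n a b = (\<lambda>t. flat_exp 1 (real n * t + (- real n * a)) * flat_exp 1 (- real n * t + real n * b))"
    by (auto simp: bump_def algebra_simps)
  ultimately show ?thesis by simp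
qed

lemma bump_nonneg: "0 \<le> bump n a b t"
  and bump_le_1: "bump n a b t \<le> 1"
proof -
  have f: "0 \<le> flat_exp 1 s" "flat_exp 1 s \<le> 1" for s
    by (auto simp: flat_exp_def)
  then show "0 \<le> bump n a b t" "bump n a b t \<le> 1"
    unfolding bump_def by (auto intro!: mult_le_one)
qed

lemma bump_eq_0: "t \<notin> {a<..<b} \<Longrightarrow> bump n a b t = 0"
  by (auto simp: bump_def flat_exp_def not_less zero_less_mult_iff)

lemma bump_tendsto: "(\<lambda>n. bump n a b t) \<longlonglongrightarrow> indicator {a<..<b} t"
proof (cases "t \<in> {a<..<b}")
  case True
  have lim: "(\<lambda>n. flat_exp 1 (real n * c)) \<longlonglongrightarrow> 1" if "c > 0" for c
  proof -
    have "(\<lambda>n. exp (- (1 / c) * (1 / real n))) \<longlonglongrightarrow> exp (- (1 / c) * 0)"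
      by (intro tendsto_intros lim_1_over_n)
    moreover have "\<forall>\<^sub>F n in sequentially. exp (- (1 / c) * (1 / real n)) = flat_exp 1 (real n * c)"
      using eventually_gt_at_top[of 0] by eventually_elim (use that in \<open>auto simp: flat_exp_def field_simps\<close>)
    ultimately show ?thesis using Lim_transform_eventually by fastforce
  qed
  have "(\<lambda>n. bump n a b t) \<longlonglongrightarrow> 1 * 1"
    unfolding bump_def using True by (intro tendsto_mult lim) auto
  with True show ?thesis by simp
qed (simp add: bump_eq_0)

subsection \<open>Test functions with separated variables\<close>

text \<open>Products suffice as test functions, since boxes generate the Borel sets. A partial
  derivative replaces a single factor, so smoothness reduces to one variable.\<close>

definition tensor :: "('m \<Rightarrow> real \<Rightarrow> real) \<Rightarrow> real^'m \<Rightarrow> real" where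
  "tensor f x = (\<Prod>i\<in>UNIV. f i (x $ i))"

lemma tensor_derivative:
  assumes "\<forall>i. smooth_real (f i)"
  shows "(tensor f has_derivative
     (\<lambda>v. \<Sum>i\<in>UNIV. v $ i * tensor (f(i := deriv (f i))) x)) (at x)"
proof -
  have 1: "((\<lambda>x. f i (x $ i)) has_derivative (\<lambda>v. v $ i * deriv (f i) (x $ i))) (at x)" for i
  proof -
    have "((\<lambda>x. x $ i) has_derivative (\<lambda>v. v $ i)) (at x)"
      by (intro bounded_linear_imp_has_derivative bounded_linear_vec_nth)
    from DERIV_compose_FDERIV[OF smooth_real_deriv(1)[OF assms[rule_format]] this]
    show ?thesis by simp
  qed
  have "(\<Prod>k\<in>UNIV - {i}. f k (x $ k)) * deriv (f i) (x $ i) = tensor (f(i := deriv (f i))) x" for i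
    unfolding tensor_def by (subst (2) prod.remove[of _ i]) (auto simp: mult.commute intro!: prod.cong)
  then have eq: "v $ i * deriv (f i) (x $ i) * (\<Prod>k\<in>UNIV - {i}. f k (x $ k)) = v $ i * tensor (f(i := deriv (f i))) x" for i v
    by (metis mult.assoc mult.commute)
  have "((\<lambda>x. \<Prod>i\<in>UNIV. f i (x $ i)) has_derivative
      (\<lambda>v. \<Sum>i\<in>UNIV. v $ i * deriv (f i) (x $ i) * (\<Prod>k\<in>UNIV - {i}. f k (x $ k)))) (at x)"
    by (rule has_derivative_prod[OF 1])
  then show ?thesis unfolding eq tensor_def[of f, abs_def] .
qed

lemma partial_deriv_tensor:
  assumes "\<forall>i. smooth_real (f i)"
  shows "partial_deriv j (tensor f) x = tensor (f(j := deriv (f j))) x"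
proof -
  have "frechet_derivative (tensor f) (at x) = (\<lambda>v. \<Sum>i\<in>UNIV. v $ i * tensor (f(i := deriv (f i))) x)"
    using frechet_derivative_at[OF tensor_derivative[OF assms]] by simp
  then show ?thesis by (simp add: partial_deriv_def axis_def if_distrib if_distribR cong: if_cong)
qed

lemma Ck_tensor: "\<forall>i. smooth_real (f i) \<Longrightarrow> Ck k (tensor f)"
proof (induction k arbitrary: f)
  case 0
  have "continuous_on UNIV (\<lambda>x. \<Prod>i\<in>UNIV. f i (x $ i))"
    by (intro continuous_intros continuous_on_compose2[OF smooth_real_continuous[OF 0[rule_format]]]) auto
  then show ?case by (simp add: tensor_def[abs_def])
next
  case (Suc k)
  have "partial_deriv j (tensor f) = tensor (f(j := deriv (f j)))" for j
    using partial_deriv_tensor[OF Suc.prems] by auto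
  moreover have "\<forall>i. smooth_real ((f(j := deriv (f j))) i)" for j
    using Suc.prems smooth_real_deriv by auto
  moreover have "\<forall>x. tensor f differentiable (at x)"
    unfolding differentiable_def using tensor_derivative[OF Suc.prems] by blast
  ultimately show ?case using Suc.IH by simp
qed

lemma tensor_test_function:
  assumes "\<forall>i. smooth_real (f i)" "\<And>i t. t \<notin> {a $ i..b $ i} \<Longrightarrow> f i t = 0" "cbox a b \<subseteq> U"
  shows "tensor f \<in> test_functions U"
proof -
  have sub: "{x. tensor f x \<noteq> 0} \<subseteq> cbox a b"
  proof
    fix x assume "x \<in> {x. tensor f x \<noteq> 0}"
    then have "f i (x $ i) \<noteq> 0" for i by (auto simp: tensor_def)
    then have "x $ i \<in> {a $ i..b $ i}" for i using assms(2) by metis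
    then show "x \<in> cbox a b" by (auto simp: mem_box_cart)
  qed
  then have cl: "closure {x. tensor f x \<noteq> 0} \<subseteq> cbox a b" by (intro closure_minimal closed_cbox)
  have "compact (closure {x. tensor f x \<noteq> 0})"
    using bounded_subset[OF bounded_cbox sub] by simp
  with cl show ?thesis using Ck_tensor[OF assms(1)] assms(3) by (auto simp: test_functions_def)
qed

section \<open>Translations in $L^1$\<close>

lemma integrable_lborel_translate:
  fixes G :: "'a::euclidean_space \<Rightarrow> 'b::{banach,second_countable_topology}"
  assumes "integrable lborel G"
  shows "integrable lborel (\<lambda>x. G (x + s))"
proof -
  have "integrable (distr lborel borel ((+) s)) G" using assms by (simp add: lborel_distr_plus)
  then have "integrable lborel (\<lambda>x. G (s + x))"
    using assms by (subst (asm) integrable_distr_eq) auto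
  then show ?thesis by (simp add: add.commute)
qed

lemma integral_lborel_translate:
  fixes G :: "'a::euclidean_space \<Rightarrow> 'b::{banach,second_countable_topology}"
  assumes "G \<in> borel_measurable borel"
  shows "(\<integral>x. G (x + s) \<partial>lborel) = (\<integral>x. G x \<partial>lborel)"
proof -
  have "(\<integral>x. G x \<partial>distr lborel borel ((+) s)) = (\<integral>x. G (s + x) \<partial>lborel)"
    using assms by (subst integral_distr) auto
  then show ?thesis by (simp add: lborel_distr_plus add.commute)
qed

lemma AE_lborel_translate:
  assumes "AE x in lborel. P (x :: 'a::euclidean_space)"
  shows "AE x in lborel. P (x + s)"
proof -
  obtain N where N: "N \<in> null_sets lborel" "{x. \<not> P x} \<subseteq> N"
    by (rule AE_E[OF assms]) (auto simp: null_sets_def)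
  have "AE x in distr lborel borel ((+) s). x \<notin> N"
    using N by (simp add: lborel_distr_plus AE_not_in)
  then have "AE x in lborel. s + x \<notin> N"
    using N by (subst (asm) AE_distr_iff) (auto simp: null_sets_def)
  then show ?thesis by eventually_elim (use N in \<open>auto simp: add.commute\<close>)
qed

text \<open>A point of the open set \<open>V\<close> stays in \<open>V\<close> under small shifts,
  so the measure of the points that leave tends to 0 by dominated convergence. As many points enter
  as leave, by translation invariance; hence the factor 2.\<close>

lemma translation_L1_continuous_open:
  fixes V :: "'a::euclidean_space set"
  assumes V: "open V" "emeasure lborel V < \<infinity>" and s: "s \<longlonglongrightarrow> 0"
  shows "(\<lambda>k. \<integral>x. \<bar>indicator V (x + s k) - indicator V x :: real\<bar> \<partial>lborel) \<longlonglongrightarrow> 0"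
proof -
  have [measurable]: "V \<in> sets borel" using V by simp
  have int: "integrable lborel (indicator V :: 'a \<Rightarrow> real)" using V by simp
  note int' = integrable_lborel_translate[OF int]
  define w where "w k x = (indicator V x * (1 - indicator V (x + s k)) :: real)" for k x
  have intw: "integrable lborel (w k)" for k
    unfolding w_def by (rule Bochner_Integration.integrable_bound[OF int]) (auto simp: indicator_def)
  then have [measurable]: "w k \<in> borel_measurable borel" for k
    using borel_measurable_integrable by fastforce
  have "(\<lambda>k. \<integral>x. w k x \<partial>lborel) \<longlonglongrightarrow> (\<integral>x. 0 \<partial>(lborel :: 'a measure))"
  proof (rule integral_dominated_convergence[where w = "indicator V"])
    show "AE x in lborel. (\<lambda>k. w k x) \<longlonglongrightarrow> 0"
    proof (intro AE_I2)
      fix x show "(\<lambda>k. w k x) \<longlonglongrightarrow> 0"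
      proof (cases "x \<in> V")
        case True
        have "(\<lambda>k. x + s k) \<longlonglongrightarrow> x + 0" by (intro tendsto_intros s)
        then have "\<forall>\<^sub>F k in sequentially. x + s k \<in> V"
          using V(1) True by (auto simp: tendsto_def)
        then have "\<forall>\<^sub>F k in sequentially. w k x = 0"
          by eventually_elim (simp add: w_def)
        then show ?thesis by (rule tendsto_eventually)
      qed (simp add: w_def)
    qed
  qed (use intw int in \<open>auto simp: w_def indicator_def\<close>)
  moreover have "(\<integral>x. \<bar>indicator V (x + s k) - indicator V x\<bar> \<partial>lborel) = 2 * (\<integral>x. w k x \<partial>lborel)" for k
  proof -
    have "\<bar>indicator V (x + s k) - indicator V x\<bar> = 2 * w k x + (indicator V (x + s k) - indicator V x)" for x
      by (auto simp: w_def indicator_def)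
    then have "(\<integral>x. \<bar>indicator V (x + s k) - indicator V x\<bar> \<partial>lborel)
        = (\<integral>x. 2 * w k x + (indicator V (x + s k) - indicator V x) \<partial>lborel)" by simp
    also have "\<dots> = 2 * (\<integral>x. w k x \<partial>lborel) + ((\<integral>x. indicator V (x + s k) \<partial>lborel) - (\<integral>x. indicator V x \<partial>lborel))"
      using intw int int' by simp
    also have "(\<integral>x. indicator V (x + s k) \<partial>lborel) = (\<integral>x. indicator V x \<partial>lborel :: real)"
      by (rule integral_lborel_translate) auto
    finally show ?thesis by simp
  qed
  ultimately show ?thesis by (simp add: tendsto_mult_right_zero)
qed

text \<open>The approximation error occurs at \<open>x\<close> and at \<open>x + s\<close>, with the
  same integral by translation invariance.\<close>

lemma translation_L1_approx:
  fixes G G' :: "'a::euclidean_space \<Rightarrow> 'b::{banach,second_countable_topology}"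
  assumes G: "integrable lborel G" "integrable lborel G'"
  shows "(\<integral>x. norm (G (x + s) - G x) \<partial>lborel)
     \<le> (\<integral>x. norm (G' (x + s) - G' x) \<partial>lborel) + 2 * (\<integral>x. norm (G x - G' x) \<partial>lborel)"
proof -
  note t = integrable_lborel_translate
  have D: "integrable lborel (\<lambda>x. norm (G x - G' x))" using G by auto
  have "(\<integral>x. norm (G (x + s) - G x) \<partial>lborel) \<le>
     (\<integral>x. norm (G' (x + s) - G' x) + norm (G (x + s) - G' (x + s)) + norm (G x - G' x) \<partial>lborel)"
  proof (rule integral_mono)
    fix x
    have "G (x + s) - G x = (G' (x + s) - G' x) + (G (x + s) - G' (x + s)) - (G x - G' x)" by simp
    then show "norm (G (x + s) - G x) \<le> norm (G' (x + s) - G' x) + norm (G (x + s) - G' (x + s)) + norm (G x - G' x)"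
      by (smt (verit) norm_triangle_ineq norm_triangle_ineq4)
  qed (use G t[OF G(1)] t[OF G(2)] t[OF D] in auto)
  also have "\<dots> = (\<integral>x. norm (G' (x + s) - G' x) \<partial>lborel)
     + (\<integral>x. norm (G (x + s) - G' (x + s)) \<partial>lborel) + (\<integral>x. norm (G x - G' x) \<partial>lborel)"
    using G t[OF G(1)] t[OF G(2)] t[OF D] by simp
  also have "(\<integral>x. norm (G (x + s) - G' (x + s)) \<partial>lborel) = (\<integral>x. norm (G x - G' x) \<partial>lborel)"
    using D by (intro integral_lborel_translate[of "\<lambda>x. norm (G x - G' x)"]) auto
  finally show ?thesis by simp
qed

text \<open>Density argument: open sets, then Borel sets by outer regularity, then simple functions,
  then limits. \<open>translation_L1_approx\<close> controls the error of each approximation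
  uniformly in the shift.\<close>

lemma translation_L1_continuous:
  fixes G :: "'a::euclidean_space \<Rightarrow> 'b::{banach,second_countable_topology}"
  assumes "integrable lborel G" "s \<longlonglongrightarrow> 0"
  shows "(\<lambda>k. \<integral>x. norm (G (x + s k) - G x) \<partial>lborel) \<longlonglongrightarrow> 0"
  using assms(1)
proof (induction rule: integrable_induct)
  case (base A c)
  then have [measurable]: "A \<in> sets borel" by simp
  have intA: "integrable lborel (indicator A :: 'a \<Rightarrow> real)" using base by simp
  have "(\<lambda>k. \<integral>x. norm (indicator A (x + s k) - indicator A x :: real) \<partial>lborel) \<longlonglongrightarrow> 0"
  proof (rule LIMSEQ_I)
    fix e :: real assume e: "0 < e"
    \<comment> \<open>The error e/4 is doubled by \<open>translation_L1_approx\<close>, which leaves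
      e/2 for the translation of \<open>V\<close>.\<close>
    obtain V where V: "open V" "A \<subseteq> V" "emeasure lborel (V - A) < ennreal (e / 4)"
      using outer_regular_lborel[of A "e / 4"] base e by auto
    then have [measurable]: "V \<in> sets borel" by simp
    have "emeasure lborel V = emeasure lborel A + emeasure lborel (V - A)"
      using V by (subst plus_emeasure) (auto simp: Un_absorb1)
    also have "\<dots> < \<infinity>" using base V(3) by (metis ennreal_add_eq_top infinity_ennreal_def less_top order_less_imp_not_less top.not_eq_extremum ennreal_less_top)
    finally have fin: "emeasure lborel V < \<infinity>" .
    then have intV: "integrable lborel (indicator V :: 'a \<Rightarrow> real)" by simp
    have "\<forall>\<^sub>F k in sequentially. (\<integral>x. \<bar>indicator V (x + s k) - indicator V x :: real\<bar> \<partial>lborel) < e / 2"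
      using order_tendstoD(2)[OF translation_L1_continuous_open[OF V(1) fin assms(2)], of "e / 2"] e by simp
    then obtain n where n: "\<And>k. k \<ge> n \<Longrightarrow> (\<integral>x. \<bar>indicator V (x + s k) - indicator V x :: real\<bar> \<partial>lborel) < e / 2"
      unfolding eventually_sequentially by blast
    have "(\<integral>x. norm (indicator A x - indicator V x :: real) \<partial>lborel) = (\<integral>x. indicator (V - A) x \<partial>lborel)"
      using V(2) by (intro Bochner_Integration.integral_cong) (auto simp: indicator_def)
    also have "\<dots> < e / 4"
    proof -
      have "emeasure lborel (V - A) = ennreal (measure lborel (V - A))"
        using V(3) by (intro emeasure_eq_ennreal_measure) auto
      then show ?thesis using V(3) e by (simp add: ennreal_less_iff)
    qed
    finally have d: "(\<integral>x. norm (indicator A x - indicator V x :: real) \<partial>lborel) < e / 4" .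
    have "(\<integral>x. norm (indicator A (x + s k) - indicator A x :: real) \<partial>lborel) < e" if "k \<ge> n" for k
      using translation_L1_approx[OF intA intV, of "s k"] n[OF that] d by simp
    moreover have "(\<integral>x. norm (indicator A (x + s k) - indicator A x :: real) \<partial>lborel) \<ge> 0" for k
      by simp
    ultimately show "\<exists>n0. \<forall>k\<ge>n0. norm ((\<integral>x. norm (indicator A (x + s k) - indicator A x :: real) \<partial>lborel) - 0) < e"
      by auto
  qed
  from tendsto_mult_left[OF this, of "norm c"] show ?case
    by (simp add: mult.commute flip: scaleR_left_diff_distrib)
next
  case (add f g)
  note t = integrable_lborel_translate
  have le: "(\<integral>x. norm (f (x + s k) + g (x + s k) - (f x + g x)) \<partial>lborel)
      \<le> (\<integral>x. norm (f (x + s k) - f x) \<partial>lborel) + (\<integral>x. norm (g (x + s k) - g x) \<partial>lborel)" for k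
  proof -
    have "(\<integral>x. norm (f (x + s k) + g (x + s k) - (f x + g x)) \<partial>lborel)
      \<le> (\<integral>x. norm (f (x + s k) - f x) + norm (g (x + s k) - g x) \<partial>lborel)"
      using add.hyps t[OF add.hyps(1)] t[OF add.hyps(2)]
      by (intro integral_mono) (auto intro: norm_diff_triangle_ineq)
    then show ?thesis using add.hyps t[OF add.hyps(1)] t[OF add.hyps(2)] by simp
  qed
  have "(\<lambda>k. (\<integral>x. norm (f (x + s k) - f x) \<partial>lborel) + (\<integral>x. norm (g (x + s k) - g x) \<partial>lborel)) \<longlonglongrightarrow> 0 + 0"
    by (intro tendsto_intros add.IH)
  then have "(\<lambda>k. (\<integral>x. norm (f (x + s k) - f x) \<partial>lborel) + (\<integral>x. norm (g (x + s k) - g x) \<partial>lborel)) \<longlonglongrightarrow> 0"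
    by simp
  then show ?case
    by (rule Lim_null_comparison[rotated]) (use le in simp)
next
  case (lim f u)
  show ?case
  proof (rule LIMSEQ_I)
    fix e :: real assume e: "0 < e"
    have "(\<lambda>i. \<integral>x. norm (f x - u i x) \<partial>lborel) \<longlonglongrightarrow> (\<integral>x. 0 \<partial>(lborel :: 'a measure))"
    \<comment> \<open>The approximants of the induction rule satisfy |u i| <= 2 |f|, which gives the
      majorant 3 |f|.\<close>
    proof (rule integral_dominated_convergence[where w = "\<lambda>x. 3 * norm (f x)"])
      show "AE x in lborel. (\<lambda>i. norm (f x - u i x)) \<longlonglongrightarrow> 0"
      proof (intro AE_I2)
        fix x
        have "(\<lambda>i. norm (f x - u i x)) \<longlonglongrightarrow> norm (f x - f x)"
          using lim by (intro tendsto_intros) auto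
        then show "(\<lambda>i. norm (f x - u i x)) \<longlonglongrightarrow> 0" by simp
      qed
      show "AE x in lborel. norm (norm (f x - u i x)) \<le> 3 * norm (f x)" for i
      proof (intro AE_I2)
        fix x
        have "norm (u i x) \<le> 2 * norm (f x)" using lim.hyps(3) by simp
        then show "norm (norm (f x - u i x)) \<le> 3 * norm (f x)"
          using norm_triangle_ineq4[of "f x" "u i x"] by simp
      qed
    qed (use lim in auto)
    then have "\<forall>\<^sub>F i in sequentially. (\<integral>x. norm (f x - u i x) \<partial>lborel) < e / 4"
      using e by (intro order_tendstoD(2)) auto
    then obtain i where i: "(\<integral>x. norm (f x - u i x) \<partial>lborel) < e / 4"
      unfolding eventually_sequentially by blast
    have "\<forall>\<^sub>F k in sequentially. (\<integral>x. norm (u i (x + s k) - u i x) \<partial>lborel) < e / 2"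
      using lim.IH[of i] e by (intro order_tendstoD(2)) auto
    then obtain n where n: "\<And>k. k \<ge> n \<Longrightarrow> (\<integral>x. norm (u i (x + s k) - u i x) \<partial>lborel) < e / 2"
      unfolding eventually_sequentially by blast
    have "(\<integral>x. norm (f (x + s k) - f x) \<partial>lborel) < e" if "k \<ge> n" for k
      using translation_L1_approx[OF lim.hyps(4) lim.hyps(1)[of i], of "s k"] n[OF that] i by simp
    moreover have "(\<integral>x. norm (f (x + s k) - f x) \<partial>lborel) \<ge> 0" for k by simp
    ultimately show "\<exists>n0. \<forall>k\<ge>n0. norm ((\<integral>x. norm (f (x + s k) - f x) \<partial>lborel) - 0) < e"
      by auto
  qed
qed

lemma translation_AE_subseq:
  fixes G :: "'a::euclidean_space \<Rightarrow> 'b::{banach,second_countable_topology}"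
  assumes "integrable lborel G" "s \<longlonglongrightarrow> 0"
  obtains r where "strict_mono (r :: nat \<Rightarrow> nat)" "AE x in lborel. (\<lambda>k. G (x + s (r k))) \<longlonglongrightarrow> G x"
proof -
  have "\<exists>r::nat\<Rightarrow>nat. strict_mono r \<and> (AE x in lborel. (\<lambda>n. G (x + s (r n)) - G x) \<longlonglongrightarrow> 0)"
    using assms integrable_lborel_translate[OF assms(1)] translation_L1_continuous[OF assms]
    by (intro tendsto_L1_AE_subseq[where u = "\<lambda>n x. G (x + s n) - G x"]) auto
  then show thesis using that by (auto simp: LIM_zero_iff)
qed

text \<open>Averages are taken over \<open>t \<in> {0..1}\<close>, so the step \<open>s k\<close> only enters through the integrand.\<close>

lemma translation_average_L1:
  fixes G :: "'a::euclidean_space \<Rightarrow> 'b::{banach,second_countable_topology}"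
  assumes G: "integrable lborel G" and s: "s \<longlonglongrightarrow> 0"
  defines "u \<equiv> \<lambda>k x. \<integral>t. indicator {0..1::real} t *\<^sub>R (G (x + t *\<^sub>R s k) - G x) \<partial>lborel"
  shows "integrable lborel (u k)" "(\<lambda>k. \<integral>x. norm (u k x) \<partial>lborel) \<longlonglongrightarrow> 0"
    "AE x in lborel. integrable lborel (\<lambda>t. indicator {0..1::real} t *\<^sub>R G (x + t *\<^sub>R s k))"
proof -
  have [measurable]: "G \<in> borel_measurable borel" using G by auto
  define f where "f k p = indicator {0..1::real} (fst p) *\<^sub>R (G (snd p + fst p *\<^sub>R s k) - G (snd p))" for k p
  have [measurable]: "f k \<in> borel_measurable (lborel \<Otimes>\<^sub>M lborel)" for k
    unfolding f_def by measurable
  \<comment> \<open>The L^1 modulus of continuity of \<open>G\<close>. By Fubini the L^1 norm of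
    \<open>u k\<close> is at most the integral over [0,1] of W(t s_k), which tends to 0 by dominated
    convergence, as \<open>W\<close> is bounded by twice the L^1 norm of \<open>G\<close>.\<close>
  define W where "W v = (\<integral>x. norm (G (x + v) - G x) \<partial>lborel)" for v
  have W_bound: "W v \<le> 2 * (\<integral>x. norm (G x) \<partial>lborel)" "W v \<ge> 0" for v
    using translation_L1_approx[OF G, of "\<lambda>x. 0" v] unfolding W_def by auto
  have inner: "(\<integral>x. norm (f k (t, x)) \<partial>lborel) = indicator {0..1} t * W (t *\<^sub>R s k)" for k t
    by (simp add: f_def W_def)
  have Wm [measurable]: "(\<lambda>t. W (t *\<^sub>R s k)) \<in> borel_measurable borel" for k
    unfolding W_def by measurable
  have Wi: "integrable lborel (\<lambda>t. indicator {0..1} t * W (t *\<^sub>R s k))" for k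
  proof (rule Bochner_Integration.integrable_bound[of _ "\<lambda>t. indicator {0..1} t * (2 * (\<integral>x. norm (G x) \<partial>lborel))"])
    show "AE t in lborel. norm (indicator {0..1} t * W (t *\<^sub>R s k))
       \<le> norm (indicator {0..1} t * (2 * (\<integral>x. norm (G x) \<partial>lborel)))"
      using W_bound by (intro AE_I2) (auto simp: indicator_def)
  qed auto
  have fi: "integrable (lborel \<Otimes>\<^sub>M lborel) (f k)" for k
  proof (rule lborel_pair.Fubini_integrable)
    show "integrable lborel (\<lambda>t. \<integral>x. norm (f k (t, x)) \<partial>lborel)" unfolding inner by (rule Wi)
    show "AE t in lborel. integrable lborel (\<lambda>x. f k (t, x))"
      unfolding f_def using G integrable_lborel_translate[OF G] by simp
  qed auto
  have u: "u k x = (\<integral>t. f k (t, x) \<partial>lborel)" for k x by (simp add: u_def f_def)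
  show 1: "integrable lborel (u k)" for k
    unfolding u using fi by (intro lborel_pair.integrable_snd) simp
  have fin: "integrable (lborel \<Otimes>\<^sub>M lborel) (\<lambda>(t, x). norm (f k (t, x)))" for k
    using integrable_norm[OF fi[of k]] by (simp add: case_prod_beta')
  have le: "(\<integral>x. norm (u k x) \<partial>lborel) \<le> (\<integral>t. indicator {0..1} t * W (t *\<^sub>R s k) \<partial>lborel)" for k
  proof -
    have "(\<integral>x. norm (u k x) \<partial>lborel) \<le> (\<integral>x. \<integral>t. norm (f k (t, x)) \<partial>lborel \<partial>lborel)"
      using 1 lborel_pair.integrable_snd[OF fin]
      unfolding u by (intro integral_mono) auto
    also have "\<dots> = (\<integral>t. \<integral>x. norm (f k (t, x)) \<partial>lborel \<partial>lborel)"
      by (rule lborel_pair.Fubini_integral[OF fin])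
    finally show ?thesis unfolding inner .
  qed
  have "(\<lambda>k. \<integral>t. indicator {0..1} t * W (t *\<^sub>R s k) \<partial>lborel) \<longlonglongrightarrow> (\<integral>t. 0 \<partial>(lborel :: real measure))"
  proof (rule integral_dominated_convergence[where w="\<lambda>t. indicator {0..1} t * (2 * (\<integral>x. norm (G x) \<partial>lborel))"])
    show "AE t in lborel. (\<lambda>k. indicator {0..1} t * W (t *\<^sub>R s k)) \<longlonglongrightarrow> 0"
    proof (intro AE_I2)
      fix t :: real
      have "(\<lambda>k. t *\<^sub>R s k) \<longlonglongrightarrow> t *\<^sub>R 0" by (intro tendsto_intros s)
      then have "(\<lambda>k. W (t *\<^sub>R s k)) \<longlonglongrightarrow> 0"
        unfolding W_def by (intro translation_L1_continuous G) simp
      then show "(\<lambda>k. indicator {0..1} t * W (t *\<^sub>R s k)) \<longlonglongrightarrow> 0"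
        by (rule tendsto_mult_right_zero)
    qed
    show "AE t in lborel. norm (indicator {0..1} t * W (t *\<^sub>R s k))
       \<le> indicator {0..1} t * (2 * (\<integral>x. norm (G x) \<partial>lborel))" for k
      using W_bound by (intro AE_I2) (auto simp: indicator_def)
  qed auto
  then have "(\<lambda>k. \<integral>t. indicator {0..1} t * W (t *\<^sub>R s k) \<partial>lborel) \<longlonglongrightarrow> 0" by simp
  then show "(\<lambda>k. \<integral>x. norm (u k x) \<partial>lborel) \<longlonglongrightarrow> 0"
    by (rule Lim_null_comparison[rotated]) (use le in simp)
  have "AE x in lborel. integrable lborel (\<lambda>t. f k (t, x))"
    using fi[of k] by (intro lborel_pair.AE_integrable_snd) simp
  then show "AE x in lborel. integrable lborel (\<lambda>t. indicator {0..1::real} t *\<^sub>R G (x + t *\<^sub>R s k))"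
  proof eventually_elim
    case (elim x)
    have "integrable lborel (\<lambda>t. indicator {0..1::real} t *\<^sub>R G x)" by simp
    from Bochner_Integration.integrable_add[OF elim this] show ?case
      by (simp add: f_def flip: scaleR_right_distrib)
  qed
qed

section \<open>Difference quotients and weak derivatives\<close>

text \<open>Boxes form an intersection-stable generator, so the integral vanishes on every Borel
  set; the vanishing total integral deals with complements.\<close>

lemma AE_zero_of_box_integrals:
  fixes H :: "'a::euclidean_space \<Rightarrow> 'b::{banach,second_countable_topology}"
  assumes H: "integrable lborel H" and zero: "(\<integral>x. H x \<partial>lborel) = 0"
    and box: "\<And>a b. (LINT x:box a b|lborel. H x) = 0"
  shows "AE x in lborel. H x = 0"
proof (rule sigma_finite_measure.density_zero[OF sigma_finite_lborel H])
  let ?G = "range (\<lambda>(a, b). box a b :: 'a set)"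
  have int: "set_integrable lborel A H" if "A \<in> sets borel" for A
    using integrable_mult_indicator[OF _ H] that unfolding set_integrable_def by simp
  have stable: "Int_stable ?G"
    by (force simp: Int_stable_def box_Int_box)
  have gen: "sigma_sets UNIV ?G = sets (borel :: 'a measure)"
    by (simp add: borel_eq_box)
  fix A assume "A \<in> sets (lborel :: 'a measure)"
  then have A: "A \<in> sigma_sets UNIV ?G" using gen by simp
  have sub: "?G \<subseteq> Pow UNIV" by simp
  from stable sub A show "(LINT x:A|lborel. H x) = 0"
  proof (induction rule: sigma_sets_induct_disjoint)
    case (basic A)
    then show ?case using box by auto
  next
    case empty
    show ?case by (simp add: set_lebesgue_integral_def)
  next
    case (compl A)
    then have A: "A \<in> sets borel" using gen by simp
    have "(LINT x:UNIV|lborel. H x) = (LINT x:A \<union> (UNIV - A)|lborel. H x)" by simp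
    also have "\<dots> = (LINT x:A|lborel. H x) + (LINT x:UNIV - A|lborel. H x)"
      using A by (intro set_integral_Un int) auto
    finally show ?case using zero compl by (simp add: set_lebesgue_integral_def)
  next
    case (union A)
    then have A: "A i \<in> sets borel" for i using gen by auto
    have "(LINT x:(\<Union>i. A i)|lborel. H x) = (\<Sum>i. (LINT x:(A i)|lborel. H x))"
      using A union.hyps by (intro lebesgue_integral_countable_add int) (auto simp: disjoint_family_on_def)
    then show ?case using union by simp
  qed
qed

text \<open>With an antiderivative \<open>P\<close> of the bump, take p(t) = P(t - h) - P(t). The
  fundamental theorem along s -> t - s h rewrites it as an average of shifted bumps. Used as the
  \<open>j\<close>-th factor of a test function, \<open>p\<close> turns the weak derivative identity
  into one about shifts.\<close>

lemma bump_average_primitive: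
  assumes "h > 0"
  obtains p where "\<And>t. (p has_real_derivative bump n a b (t - h) - bump n a b t) (at t)"
    "\<And>t. p t = - h * (\<integral>s. indicator {0..1} s * bump n a b (t - s * h) \<partial>lborel)"
proof -
  have cont: "isCont (bump n a b) t" for t
    using smooth_real_continuous[OF smooth_bump] by (simp add: continuous_on_eq_continuous_at)
  obtain P where P: "\<And>t. (P has_real_derivative bump n a b t) (at t)"
    using einterval_antiderivative[of "-\<infinity>" "\<infinity>" "bump n a b"] cont
    by (auto simp: has_real_derivative_iff_has_vector_derivative)
  define p where "p t = P (t - h) - P t" for t
  show thesis
  proof (rule that[of p])
    fix t
    have "((\<lambda>t. P (t - h)) has_real_derivative bump n a b (t - h) * 1) (at t)"
      by (rule DERIV_chain2[OF P]) (auto intro!: derivative_eq_intros)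
    then show "(p has_real_derivative bump n a b (t - h) - bump n a b t) (at t)"
      unfolding p_def using P by (auto intro!: DERIV_diff)
    have "(\<integral>s. bump n a b (t - s * h) * indicator {0..1} s \<partial>lborel) = - P (t - 1 * h) / h - (- P (t - 0 * h) / h)"
    proof (rule integral_FTC_Icc_real)
      fix s
      have "((\<lambda>s. P (t - s * h)) has_real_derivative bump n a b (t - s * h) * (- h)) (at s)"
        by (rule DERIV_chain2[OF P]) (auto intro!: derivative_eq_intros)
      from DERIV_cdivide[OF DERIV_minus[OF this], of h]
      show "((\<lambda>s. - P (t - s * h) / h) has_real_derivative bump n a b (t - s * h)) (at s)"
        using assms by simp
      show "isCont (\<lambda>s. bump n a b (t - s * h)) s"
        by (intro isCont_o2[OF _ cont] continuous_intros)
    qed simp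
    then show "p t = - h * (\<integral>s. indicator {0..1} s * bump n a b (t - s * h) \<partial>lborel)"
      using assms by (simp add: p_def mult.commute field_simps)
  qed
qed

lemma tensor_split: "tensor f x = f j (x $ j) * (\<Prod>i\<in>UNIV - {j}. f i (x $ i))"
  unfolding tensor_def by (rule prod.remove) auto

lemma tensor_borel_measurable [measurable]:
  assumes "\<forall>i. smooth_real (f i)"
  shows "tensor f \<in> borel_measurable borel"
  using Ck_tensor[OF assms, of 0] by (simp add: borel_measurable_continuous_onI)

lemma integrable_translation_average:
  fixes G :: "'a::euclidean_space \<Rightarrow> 'b::{banach,second_countable_topology}"
  assumes G: "integrable lborel G"
  shows "integrable (lborel \<Otimes>\<^sub>M lborel) (\<lambda>(t, x). indicator {0..1::real} t *\<^sub>R G (x + t *\<^sub>R v))"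
    and "integrable lborel (\<lambda>x. \<integral>t. indicator {0..1::real} t *\<^sub>R G (x + t *\<^sub>R v) \<partial>lborel)"
proof -
  have [measurable]: "G \<in> borel_measurable borel" using G by auto
  show 1: "integrable (lborel \<Otimes>\<^sub>M lborel) (\<lambda>(t, x). indicator {0..1::real} t *\<^sub>R G (x + t *\<^sub>R v))"
  proof (rule lborel_pair.Fubini_integrable)
    have "(\<integral>x. norm (G (x + t *\<^sub>R v)) \<partial>lborel) = (\<integral>x. norm (G x) \<partial>lborel)" for t
      by (rule integral_lborel_translate[of "\<lambda>x. norm (G x)"]) auto
    then show "integrable lborel (\<lambda>t. \<integral>x. norm (case (t, x) of (t, x) \<Rightarrow> indicator {0..1} t *\<^sub>R G (x + t *\<^sub>R v)) \<partial>lborel)"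
      by simp
    show "AE t in lborel. integrable lborel (\<lambda>x. case (t, x) of (t, x) \<Rightarrow> indicator {0..1} t *\<^sub>R G (x + t *\<^sub>R v))"
      using integrable_lborel_translate[OF G] by simp
  qed auto
  show "integrable lborel (\<lambda>x. \<integral>t. indicator {0..1::real} t *\<^sub>R G (x + t *\<^sub>R v) \<partial>lborel)"
    using lborel_pair.integrable_snd[OF 1] by simp
qed

text \<open>The test function f has as its \<open>j\<close>-th derivative the difference of \<phi>
  shifted by h and \<phi>, and is itself -h times an average of shifts of \<phi>. Moving all shifts
  from \<phi> to \<open>F\<close> and \<open>G\<close> shows that \<phi> times the integrand has
  integral 0; then \<phi> tends to the indicator of the box.\<close>

lemma weak_deriv_shift_box:
  fixes F G :: "real^'m \<Rightarrow> 'b::euclidean_space" and j :: 'm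
  defines "e \<equiv> axis j 1"
  assumes F: "integrable lborel F" and G: "integrable lborel G"
    and weak: "\<And>f. \<forall>i. smooth_real (f i) \<Longrightarrow> \<forall>i t. t \<notin> {c $ i..d $ i} \<longrightarrow> f i t = 0 \<Longrightarrow>
        (\<integral>x. tensor (f(j := deriv (f j))) x *\<^sub>R F x \<partial>lborel) = - (\<integral>x. tensor f x *\<^sub>R G x \<partial>lborel)"
    and h: "h > 0"
    and ab: "\<And>i. c $ i \<le> a $ i" "\<And>i. b $ i \<le> (d - h *\<^sub>R e) $ i"
  shows "(LINT x:box a b|lborel. F (x + h *\<^sub>R e) - F x
      - h *\<^sub>R (\<integral>t. indicator {0..1::real} t *\<^sub>R G (x + t *\<^sub>R (h *\<^sub>R e)) \<partial>lborel)) = 0"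
proof -
  have [measurable]: "F \<in> borel_measurable borel" "G \<in> borel_measurable borel" using F G by auto
  define \<phi> where "\<phi> n = tensor (\<lambda>i. bump n (a $ i) (b $ i))" for n
  have \<phi>m [measurable]: "\<phi> n \<in> borel_measurable borel" for n
    unfolding \<phi>_def using smooth_bump by (intro tensor_borel_measurable) auto
  have \<phi>01: "0 \<le> \<phi> n x" "\<phi> n x \<le> 1" for n x
    unfolding \<phi>_def tensor_def using bump_nonneg bump_le_1 by (auto intro!: prod_nonneg prod_le_1)
  have ei: "(x - s *\<^sub>R e) $ i = (if i = j then x $ i - s else x $ i)" for x s i
    by (simp add: e_def axis_def)
  define A where "A x = (\<integral>t. indicator {0..1::real} t *\<^sub>R G (x + t *\<^sub>R (h *\<^sub>R e)) \<partial>lborel)" for x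
  define H where "H x = F (x + h *\<^sub>R e) - F x - h *\<^sub>R A x" for x
  note prodint = integrable_translation_average(1)[OF G, of "h *\<^sub>R e"]
  have Aint: "integrable lborel A"
    unfolding A_def by (rule integrable_translation_average[OF G])
  note Fint = integrable_lborel_translate[OF F, of "h *\<^sub>R e"]
  have Hint: "integrable lborel H" unfolding H_def using F Fint Aint by auto
  have \<phi>int: "integrable lborel (\<lambda>x. \<phi> n x *\<^sub>R K x)" if "integrable lborel K" for n and K :: "real^'m \<Rightarrow> 'b"
    using that \<phi>01 by (intro Bochner_Integration.integrable_bound[OF that]) (auto simp: mult_left_le_one_le)
  have zero: "(\<integral>x. \<phi> n x *\<^sub>R H x \<partial>lborel) = 0" for n
  proof -
    obtain p where p: "\<And>t. (p has_real_derivative bump n (a $ j) (b $ j) (t - h) - bump n (a $ j) (b $ j) t) (at t)"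
      "\<And>t. p t = - h * (\<integral>s. indicator {0..1} s * bump n (a $ j) (b $ j) (t - s * h) \<partial>lborel)"
      by (rule bump_average_primitive[OF h, of n "a $ j" "b $ j"]) (rule that)
    define f where "f = (\<lambda>i. bump n (a $ i) (b $ i))(j := p)"
    have dp: "deriv p = (\<lambda>t. bump n (a $ j) (b $ j) (t - h) - bump n (a $ j) (b $ j) t)"
      using DERIV_imp_deriv[OF p(1)] by auto
    have "smooth_real (\<lambda>t. bump n (a $ j) (b $ j) (t - h) - bump n (a $ j) (b $ j) t)"
      using smooth_real_affine[OF smooth_bump, of n _ _ 1 "- h"] by (intro smooth_real_diff smooth_bump) simp
    then have "smooth_real p" using p(1) by (rule smooth_real_antideriv[rotated])
    then have sm: "\<forall>i. smooth_real (f i)" by (auto simp: f_def smooth_bump)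
    have supp: "\<forall>i t. t \<notin> {c $ i..d $ i} \<longrightarrow> f i t = 0"
    proof (intro allI impI)
      fix i t assume t: "t \<notin> {c $ i..d $ i}"
      show "f i t = 0"
      proof (cases "i = j")
        case True
        have "indicator {0..1} s * bump n (a $ j) (b $ j) (t - s * h) = 0" for s
        proof (cases "s \<in> {0..1}")
          case s: True
          \<comment> \<open>The factor \<open>p\<close> lives on [a_j, b_j + h]: this is why the box
            keeps distance \<open>h\<close> from the far face of \<open>cbox c d\<close>.\<close>
          have bj: "b $ j \<le> d $ j - h" using ab(2)[of j] by (simp add: e_def axis_def)
          have "0 \<le> s * h" "s * h \<le> h" using s h by (auto simp: mult_left_le_one_le)
          then have "t - s * h \<notin> {a $ j<..<b $ j}"
            using t True ab(1)[of j] bj unfolding greaterThanLessThan_iff atLeastAtMost_iff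
            by (simp only:) linarith
          then show ?thesis by (simp add: bump_eq_0)
        qed simp
        then have "(\<integral>s. indicator {0..1} s * bump n (a $ j) (b $ j) (t - s * h) \<partial>lborel) = 0"
          by (simp only:) simp
        then show ?thesis using True by (simp add: f_def p(2))
      next
        case False
        then show ?thesis using t ab(1)[of i] ab(2)[of i] by (auto simp: f_def e_def axis_def intro!: bump_eq_0)
      qed
    qed
    \<comment> \<open>The factors in the directions other than \<open>j\<close>, which a shift along
      \<open>e\<close> does not change.\<close>
    define R where "R x = (\<Prod>i\<in>UNIV - {j}. bump n (a $ i) (b $ i) (x $ i))" for x
    have \<phi>R: "\<phi> n (x - s *\<^sub>R e) = bump n (a $ j) (b $ j) (x $ j - s) * R x" for x s
      unfolding \<phi>_def tensor_split[of _ _ j] R_def ei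
      by (intro arg_cong2[where f = "(*)"] prod.cong) auto
    have \<phi>R0: "\<phi> n x = bump n (a $ j) (b $ j) (x $ j) * R x" for x
      unfolding \<phi>_def tensor_split[of _ _ j] R_def by simp
    have Rf: "(\<Prod>i\<in>UNIV - {j}. (f(j := g)) i (x $ i)) = R x" for g x
      unfolding R_def f_def by (intro prod.cong) auto
    have 1: "tensor (f(j := deriv (f j))) x = \<phi> n (x - h *\<^sub>R e) - \<phi> n x" for x
      unfolding tensor_split[of _ _ j] Rf \<phi>R[of x h] \<phi>R0[of x] by (simp add: f_def dp algebra_simps)
    have 2: "tensor f x = - h * (\<integral>s. indicator {0..1} s * \<phi> n (x - s *\<^sub>R (h *\<^sub>R e)) \<partial>lborel)" for x
    proof -
      have "tensor f x = p (x $ j) * R x"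
        unfolding tensor_split[of _ _ j] using Rf[of "f j" x] by (simp add: f_def)
      also have "\<dots> = - h * (\<integral>s. (indicator {0..1} s * bump n (a $ j) (b $ j) (x $ j - s * h)) * R x \<partial>lborel)"
        by (subst integral_mult_left_zero) (simp add: p(2))
      finally show ?thesis unfolding scaleR_scaleR \<phi>R by (simp add: mult.assoc)
    qed
    have w: "(\<integral>x. (\<phi> n (x - h *\<^sub>R e) - \<phi> n x) *\<^sub>R F x \<partial>lborel) = - (\<integral>x. tensor f x *\<^sub>R G x \<partial>lborel)"
      using weak[OF sm supp] by (simp only: 1)
    have Fm: "integrable lborel (\<lambda>x. \<phi> n (x - h *\<^sub>R e) *\<^sub>R F x)"
      using integrable_lborel_translate[OF \<phi>int[OF Fint], of n "- h *\<^sub>R e"] by simp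
    have "(\<integral>x. (\<phi> n (x - h *\<^sub>R e) - \<phi> n x) *\<^sub>R F x \<partial>lborel)
        = (\<integral>x. \<phi> n (x - h *\<^sub>R e) *\<^sub>R F x \<partial>lborel) - (\<integral>x. \<phi> n x *\<^sub>R F x \<partial>lborel)"
      unfolding scaleR_left_diff_distrib using Fm \<phi>int[OF F] by simp
    also have "(\<integral>x. \<phi> n (x - h *\<^sub>R e) *\<^sub>R F x \<partial>lborel) = (\<integral>x. \<phi> n x *\<^sub>R F (x + h *\<^sub>R e) \<partial>lborel)"
      using integral_lborel_translate[of "\<lambda>x. \<phi> n (x - h *\<^sub>R e) *\<^sub>R F x" "h *\<^sub>R e"] by simp
    finally have lhs: "(\<integral>x. (\<phi> n (x - h *\<^sub>R e) - \<phi> n x) *\<^sub>R F x \<partial>lborel)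
        = (\<integral>x. \<phi> n x *\<^sub>R F (x + h *\<^sub>R e) \<partial>lborel) - (\<integral>x. \<phi> n x *\<^sub>R F x \<partial>lborel)" .
    have pi1: "integrable (lborel \<Otimes>\<^sub>M lborel)
        (\<lambda>(s, x). (indicator {0..1::real} s * \<phi> n (x - s *\<^sub>R (h *\<^sub>R e))) *\<^sub>R G x)"
    proof (rule lborel_pair.Fubini_integrable)
      have le: "norm ((indicator {0..1::real} s * \<phi> n (x - s *\<^sub>R (h *\<^sub>R e))) *\<^sub>R G x) \<le> indicator {0..1} s * norm (G x)" for s x
        using \<phi>01 by (auto simp: indicator_def mult_left_le_one_le)
      have 3: "integrable lborel (\<lambda>x. (indicator {0..1::real} s * \<phi> n (x - s *\<^sub>R (h *\<^sub>R e))) *\<^sub>R G x)" for s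
      proof (rule Bochner_Integration.integrable_bound)
        show "integrable lborel (\<lambda>x. indicator {0..1::real} s *\<^sub>R G x)" using G by simp
        show "AE x in lborel. norm ((indicator {0..1::real} s * \<phi> n (x - s *\<^sub>R (h *\<^sub>R e))) *\<^sub>R G x)
            \<le> norm (indicator {0..1::real} s *\<^sub>R G x)"
          using \<phi>01 by (intro AE_I2) (auto simp: indicator_def mult_left_le_one_le)
      qed measurable
      then show "AE s in lborel. integrable lborel (\<lambda>x. case (s, x) of (s, x) \<Rightarrow> (indicator {0..1} s * \<phi> n (x - s *\<^sub>R (h *\<^sub>R e))) *\<^sub>R G x)"
        by simp
      have le2: "(\<integral>x. norm ((indicator {0..1::real} s * \<phi> n (x - s *\<^sub>R (h *\<^sub>R e))) *\<^sub>R G x) \<partial>lborel) \<le> indicator {0..1} s * (\<integral>x. norm (G x) \<partial>lborel)" for s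
      proof -
        have "integrable lborel (\<lambda>x. indicator {0..1} s * norm (G x))" using G by simp
        from integral_mono[OF integrable_norm[OF 3[of s]] this le] show ?thesis
          by (simp only: integral_mult_right_zero)
      qed
      show "integrable lborel (\<lambda>s. \<integral>x. norm (case (s, x) of (s, x) \<Rightarrow> (indicator {0..1} s * \<phi> n (x - s *\<^sub>R (h *\<^sub>R e))) *\<^sub>R G x) \<partial>lborel)"
      proof (rule Bochner_Integration.integrable_bound)
        show "integrable lborel (\<lambda>s. indicator {0..1::real} s * (\<integral>x. norm (G x) \<partial>lborel))" by simp
        show "AE s in lborel. norm (\<integral>x. norm (case (s, x) of (s, x) \<Rightarrow> (indicator {0..1} s * \<phi> n (x - s *\<^sub>R (h *\<^sub>R e))) *\<^sub>R G x) \<partial>lborel)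
            \<le> norm (indicator {0..1::real} s * (\<integral>x. norm (G x) \<partial>lborel))"
        proof (intro AE_I2)
          fix s
          have "0 \<le> (\<integral>x. norm ((indicator {0..1::real} s * \<phi> n (x - s *\<^sub>R (h *\<^sub>R e))) *\<^sub>R G x) \<partial>lborel)"
            by (rule Bochner_Integration.integral_nonneg) simp
          then show "norm (\<integral>x. norm (case (s, x) of (s, x) \<Rightarrow> (indicator {0..1} s * \<phi> n (x - s *\<^sub>R (h *\<^sub>R e))) *\<^sub>R G x) \<partial>lborel)
            \<le> norm (indicator {0..1::real} s * (\<integral>x. norm (G x) \<partial>lborel))"
            using le2[of s] unfolding prod.case real_norm_def by linarith
        qed
      qed measurable
    qed auto
    have pi2: "integrable (lborel \<Otimes>\<^sub>M lborel)
        (\<lambda>(t, x). \<phi> n x *\<^sub>R indicator {0..1::real} t *\<^sub>R G (x + t *\<^sub>R (h *\<^sub>R e)))"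
      using prodint
    proof (rule Bochner_Integration.integrable_bound)
      show "AE p in lborel \<Otimes>\<^sub>M lborel.
          norm (case p of (t, x) \<Rightarrow> \<phi> n x *\<^sub>R indicator {0..1::real} t *\<^sub>R G (x + t *\<^sub>R (h *\<^sub>R e)))
          \<le> norm (case p of (t, x) \<Rightarrow> indicator {0..1::real} t *\<^sub>R G (x + t *\<^sub>R (h *\<^sub>R e)))"
        using \<phi>01 by (intro AE_I2) (auto simp: indicator_def mult_left_le_one_le split: prod.split)
    qed measurable
    have "(\<integral>x. tensor f x *\<^sub>R G x \<partial>lborel)
        = - h *\<^sub>R (\<integral>x. (\<integral>s. (indicator {0..1} s * \<phi> n (x - s *\<^sub>R (h *\<^sub>R e))) *\<^sub>R G x \<partial>lborel) \<partial>lborel)"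
    proof -
      have "integrable lborel (\<lambda>s. indicator {0..1::real} s * \<phi> n (x - s *\<^sub>R (h *\<^sub>R e)))" for x
      proof (rule Bochner_Integration.integrable_bound)
        show "integrable lborel (indicator {0..1::real} :: real \<Rightarrow> real)" by simp
      qed (use \<phi>01 in \<open>auto simp: indicator_def\<close>)
      then have eq: "(\<integral>s. (indicator {0..1} s * \<phi> n (x - s *\<^sub>R (h *\<^sub>R e))) *\<^sub>R G x \<partial>lborel)
          = (\<integral>s. indicator {0..1} s * \<phi> n (x - s *\<^sub>R (h *\<^sub>R e)) \<partial>lborel) *\<^sub>R G x" for x
        by (intro integral_scaleR_left)
      have "tensor f x *\<^sub>R G x = - h *\<^sub>R
          ((\<integral>s. indicator {0..1} s * \<phi> n (x - s *\<^sub>R (h *\<^sub>R e)) \<partial>lborel) *\<^sub>R G x)" for x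
        unfolding 2 by simp
      then show ?thesis unfolding eq by (simp only: integral_scaleR_right)
    qed
    also have "(\<integral>x. (\<integral>s. (indicator {0..1} s * \<phi> n (x - s *\<^sub>R (h *\<^sub>R e))) *\<^sub>R G x \<partial>lborel) \<partial>lborel)
        = (\<integral>s. (\<integral>x. (indicator {0..1} s * \<phi> n (x - s *\<^sub>R (h *\<^sub>R e))) *\<^sub>R G x \<partial>lborel) \<partial>lborel)"
      by (rule lborel_pair.Fubini_integral[OF pi1])
    \<comment> \<open>For fixed \<open>s\<close>, translation invariance moves the shift from \<phi>
      to \<open>G\<close>.\<close>
    also have "\<dots> = (\<integral>s. (\<integral>x. \<phi> n x *\<^sub>R indicator {0..1} s *\<^sub>R G (x + s *\<^sub>R (h *\<^sub>R e)) \<partial>lborel) \<partial>lborel)"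
    proof (rule Bochner_Integration.integral_cong[OF refl])
      fix s :: real
      have "(\<integral>x. (indicator {0..1} s * \<phi> n (x - s *\<^sub>R (h *\<^sub>R e))) *\<^sub>R G x \<partial>lborel)
          = (\<integral>x. (indicator {0..1} s * \<phi> n (x + s *\<^sub>R (h *\<^sub>R e) - s *\<^sub>R (h *\<^sub>R e))) *\<^sub>R G (x + s *\<^sub>R (h *\<^sub>R e)) \<partial>lborel)"
        by (rule integral_lborel_translate[of "\<lambda>x. (indicator {0..1} s * \<phi> n (x - s *\<^sub>R (h *\<^sub>R e))) *\<^sub>R G x", symmetric]) auto
      then show "(\<integral>x. (indicator {0..1} s * \<phi> n (x - s *\<^sub>R (h *\<^sub>R e))) *\<^sub>R G x \<partial>lborel)
          = (\<integral>x. \<phi> n x *\<^sub>R indicator {0..1} s *\<^sub>R G (x + s *\<^sub>R (h *\<^sub>R e)) \<partial>lborel)"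
        by (simp add: mult.commute)
    qed
    also have "\<dots> = (\<integral>x. (\<integral>s. \<phi> n x *\<^sub>R indicator {0..1} s *\<^sub>R G (x + s *\<^sub>R (h *\<^sub>R e)) \<partial>lborel) \<partial>lborel)"
      by (rule lborel_pair.Fubini_integral[OF pi2, symmetric])
    also have "\<dots> = (\<integral>x. \<phi> n x *\<^sub>R A x \<partial>lborel)"
      unfolding A_def by (simp only: integral_scaleR_right)
    finally have rhs: "(\<integral>x. tensor f x *\<^sub>R G x \<partial>lborel) = - h *\<^sub>R (\<integral>x. \<phi> n x *\<^sub>R A x \<partial>lborel)" .
    have "(\<integral>x. \<phi> n x *\<^sub>R H x \<partial>lborel) = (\<integral>x. \<phi> n x *\<^sub>R F (x + h *\<^sub>R e) \<partial>lborel) - (\<integral>x. \<phi> n x *\<^sub>R F x \<partial>lborel)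
        - h *\<^sub>R (\<integral>x. \<phi> n x *\<^sub>R A x \<partial>lborel)"
      unfolding H_def scaleR_right_diff_distrib
      using \<phi>int[OF F] \<phi>int[OF Fint] \<phi>int[OF Aint]
      by (simp add: scaleR_left_commute[of "\<phi> n _" h] del: scaleR_scaleR)
    then show ?thesis using lhs rhs w by simp
  qed
  have "(\<lambda>n. \<integral>x. \<phi> n x *\<^sub>R H x \<partial>lborel) \<longlonglongrightarrow> (\<integral>x. indicator (box a b) x *\<^sub>R H x \<partial>lborel)"
  proof (rule integral_dominated_convergence[where w = "\<lambda>x. norm (H x)"])
    show "AE x in lborel. (\<lambda>n. \<phi> n x *\<^sub>R H x) \<longlonglongrightarrow> indicator (box a b) x *\<^sub>R H x"
    proof (intro AE_I2 tendsto_scaleR tendsto_const)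
      fix x
      have "(\<lambda>n. \<phi> n x) \<longlonglongrightarrow> (\<Prod>i\<in>UNIV. indicator {a $ i<..<b $ i} (x $ i))"
        unfolding \<phi>_def tensor_def by (intro tendsto_prod bump_tendsto)
      moreover have "(\<Prod>i\<in>UNIV. indicator {a $ i<..<b $ i} (x $ i)) = (indicator (box a b) x :: real)"
        by (auto simp: indicator_def mem_box_cart)
      ultimately show "(\<lambda>n. \<phi> n x) \<longlonglongrightarrow> indicator (box a b) x" by simp
    qed
    show "AE x in lborel. norm (\<phi> n x *\<^sub>R H x) \<le> norm (H x)" for n
      using \<phi>01 by (auto simp: mult_left_le_one_le)
  qed (use Hint \<phi>int in auto)
  then have "(\<integral>x. indicator (box a b) x *\<^sub>R H x \<partial>lborel) = 0"
    unfolding zero using LIMSEQ_unique tendsto_const by blast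
  then show ?thesis by (simp add: set_lebesgue_integral_def H_def A_def)
qed

text \<open>Cutting \<open>H\<close> off to the shrunken box \<open>W\<close> reduces its integral
  over any box to one over the intersection with \<open>W\<close>, again a box (possibly empty) to
  which \<open>weak_deriv_shift_box\<close> applies.\<close>

lemma weak_deriv_shift:
  fixes F G :: "real^'m \<Rightarrow> 'b::euclidean_space" and j :: 'm
  defines "e \<equiv> axis j 1"
  assumes F: "integrable lborel F" and G: "integrable lborel G"
    and weak: "\<And>f. \<forall>i. smooth_real (f i) \<Longrightarrow> \<forall>i t. t \<notin> {c $ i..d $ i} \<longrightarrow> f i t = 0 \<Longrightarrow>
        (\<integral>x. tensor (f(j := deriv (f j))) x *\<^sub>R F x \<partial>lborel) = - (\<integral>x. tensor f x *\<^sub>R G x \<partial>lborel)"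
    and h: "h > 0"
  shows "AE x in lborel. x \<in> box c (d - h *\<^sub>R e) \<longrightarrow> F (x + h *\<^sub>R e) - F x
      = h *\<^sub>R (\<integral>t. indicator {0..1::real} t *\<^sub>R G (x + t *\<^sub>R (h *\<^sub>R e)) \<partial>lborel)"
proof -
  define H where "H x = F (x + h *\<^sub>R e) - F x
      - h *\<^sub>R (\<integral>t. indicator {0..1::real} t *\<^sub>R G (x + t *\<^sub>R (h *\<^sub>R e)) \<partial>lborel)" for x
  define W where "W = box c (d - h *\<^sub>R e)"
  have Hint: "integrable lborel H"
    unfolding H_def using F integrable_lborel_translate[OF F, of "h *\<^sub>R e"]
      integrable_translation_average(2)[OF G, of "h *\<^sub>R e"] by auto
  have zero: "(LINT x:box a b|lborel. indicator W x *\<^sub>R H x) = 0" for a b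
  proof -
    define a' b' where "a' = (\<chi> i. max (a $ i) (c $ i))" and "b' = (\<chi> i. min (b $ i) ((d - h *\<^sub>R e) $ i))"
    have "box a b \<inter> W = box a' b'"
      by (auto simp: W_def a'_def b'_def mem_box_cart)
    then have "(LINT x:box a b|lborel. indicator W x *\<^sub>R H x) = (LINT x:box a' b'|lborel. H x)"
      by (simp add: set_lebesgue_integral_def flip: indicator_inter_arith)
    also have "\<dots> = 0"
      unfolding H_def e_def using F G weak h
      by (rule weak_deriv_shift_box) (auto simp: a'_def b'_def e_def)
    finally show ?thesis .
  qed
  have "AE x in lborel. indicator W x *\<^sub>R H x = 0"
  proof (rule AE_zero_of_box_integrals)
    show "integrable lborel (\<lambda>x. indicator W x *\<^sub>R H x)"
      using Hint by (intro integrable_mult_indicator) (auto simp: W_def)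
    \<comment> \<open>The total integral is the integral over \<open>W\<close>, itself one of the
      boxes.\<close>
    have "(LINT x|lborel. indicator W x *\<^sub>R H x) = (LINT x:W|lborel. indicator W x *\<^sub>R H x)"
      by (simp add: set_lebesgue_integral_def flip: indicator_inter_arith)
    then show "(LINT x|lborel. indicator W x *\<^sub>R H x) = 0" using zero by (simp add: W_def)
  qed (rule zero)
  then show ?thesis by eventually_elim (auto simp: W_def H_def)
qed

text \<open>By the shift identity the quotient exceeds \<open>G x\<close> by \<open>u k x\<close>,
  which tends to 0 in L^1 and so almost everywhere along a subsequence.\<close>

theorem weak_deriv_difference_quotient:
  fixes F G :: "real^'m \<Rightarrow> 'b::euclidean_space" and j :: 'm
  assumes F: "integrable lborel F" and G: "integrable lborel G"
    and weak: "\<And>f. \<forall>i. smooth_real (f i) \<Longrightarrow> \<forall>i t. t \<notin> {c $ i..d $ i} \<longrightarrow> f i t = 0 \<Longrightarrow>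
        (\<integral>x. tensor (f(j := deriv (f j))) x *\<^sub>R F x \<partial>lborel) = - (\<integral>x. tensor f x *\<^sub>R G x \<partial>lborel)"
    and h: "h \<longlonglongrightarrow> 0" "\<And>k. h k > 0"
  obtains r where "strict_mono (r :: nat \<Rightarrow> nat)"
    "AE x in lborel. x \<in> box c d \<longrightarrow>
       (\<lambda>k. (F (x + h (r k) *\<^sub>R axis j 1) - F x) /\<^sub>R h (r k)) \<longlonglongrightarrow> G x"
proof -
  define e :: "real^'m" where "e = axis j 1"
  define s where "s k = h k *\<^sub>R e" for k
  have "(\<lambda>k. h k *\<^sub>R e) \<longlonglongrightarrow> 0 *\<^sub>R e" by (intro tendsto_intros h)
  then have s0: "s \<longlonglongrightarrow> 0" by (simp add: s_def[abs_def])
  define u where "u k x = (\<integral>t. indicator {0..1::real} t *\<^sub>R (G (x + t *\<^sub>R s k) - G x) \<partial>lborel)" for k x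
  note avg = translation_average_L1[OF G s0, folded u_def]
  obtain r where r: "strict_mono (r :: nat \<Rightarrow> nat)" "AE x in lborel. (\<lambda>k. u (r k) x) \<longlonglongrightarrow> 0"
    using tendsto_L1_AE_subseq[OF avg(1,2)] by blast
  have 1: "AE x in lborel. \<forall>k. x \<in> box c (d - h k *\<^sub>R e) \<longrightarrow> F (x + h k *\<^sub>R e) - F x
      = h k *\<^sub>R (\<integral>t. indicator {0..1::real} t *\<^sub>R G (x + t *\<^sub>R (h k *\<^sub>R e)) \<partial>lborel)"
    unfolding AE_all_countable e_def using weak_deriv_shift[OF F G weak h(2)] by blast
  have 2: "AE x in lborel. \<forall>k. integrable lborel (\<lambda>t. indicator {0..1::real} t *\<^sub>R G (x + t *\<^sub>R s k))"
    unfolding AE_all_countable using avg(3) by blast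
  have "AE x in lborel. x \<in> box c d \<longrightarrow>
       (\<lambda>k. (F (x + h (r k) *\<^sub>R e) - F x) /\<^sub>R h (r k)) \<longlonglongrightarrow> G x"
    using 1 2 r(2)
  proof (eventually_elim, intro impI)
    fix x assume x: "\<forall>k. x \<in> box c (d - h k *\<^sub>R e) \<longrightarrow> F (x + h k *\<^sub>R e) - F x
      = h k *\<^sub>R (\<integral>t. indicator {0..1::real} t *\<^sub>R G (x + t *\<^sub>R (h k *\<^sub>R e)) \<partial>lborel)"
      "\<forall>k. integrable lborel (\<lambda>t. indicator {0..1::real} t *\<^sub>R G (x + t *\<^sub>R s k))"
      "(\<lambda>k. u (r k) x) \<longlonglongrightarrow> 0" "x \<in> box c d"
    have hr: "(\<lambda>k. h (r k)) \<longlonglongrightarrow> 0" using LIMSEQ_subseq_LIMSEQ[OF h(1) r(1)] by (simp add: o_def)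
    have "\<forall>\<^sub>F k in sequentially. h (r k) < d $ j - x $ j"
      using x(4) by (intro order_tendstoD(2)[OF hr]) (simp add: mem_box_cart)
    then have "\<forall>\<^sub>F k in sequentially. u (r k) x + G x = (F (x + h (r k) *\<^sub>R e) - F x) /\<^sub>R h (r k)"
    proof eventually_elim
      fix k assume k: "h (r k) < d $ j - x $ j"
      \<comment> \<open>The shrunken box recedes by \<open>h (r k)\<close> in direction
        \<open>j\<close> only, so each point of \<open>box c d\<close> eventually lies in
        it.\<close>
      have "x \<in> box c (d - h (r k) *\<^sub>R e)"
        using x(4) k by (auto simp: mem_box_cart e_def axis_def)
      with x(1) have q: "(F (x + h (r k) *\<^sub>R e) - F x) /\<^sub>R h (r k)
         = (\<integral>t. indicator {0..1::real} t *\<^sub>R G (x + t *\<^sub>R s (r k)) \<partial>lborel)"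
        using h(2)[of "r k"] by (simp add: s_def)
      have "u (r k) x = (\<integral>t. indicator {0..1::real} t *\<^sub>R G (x + t *\<^sub>R s (r k)) \<partial>lborel)
          - (\<integral>t. indicator {0..1::real} t *\<^sub>R G x \<partial>lborel)"
        unfolding u_def scaleR_right_diff_distrib using x(2) by (intro Bochner_Integration.integral_diff) auto
      then show "u (r k) x + G x = (F (x + h (r k) *\<^sub>R e) - F x) /\<^sub>R h (r k)"
        unfolding q by simp
    qed
    moreover have "(\<lambda>k. u (r k) x + G x) \<longlonglongrightarrow> 0 + G x" by (intro tendsto_intros x)
    ultimately show "(\<lambda>k. (F (x + h (r k) *\<^sub>R e) - F x) /\<^sub>R h (r k)) \<longlonglongrightarrow> G x"
      using Lim_transform_eventually by fastforce
  qed
  with r(1) show thesis using that unfolding e_def by blast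
qed

section \<open>Transfer to Lebesgue measurable functions on open sets\<close>

lemma integrable_lebesgue_borel_rep:
  fixes f :: "'a::euclidean_space \<Rightarrow> 'b::euclidean_space"
  assumes "integrable lebesgue f"
  obtains F where "integrable lborel F" "AE x in lborel. f x = F x"
proof -
  have "\<exists>g\<in>borel_measurable lborel. (AE x in lborel. f x \<bullet> b = g x)" for b
    using assms by (intro completion_ex_borel_measurable_real) auto
  then obtain g where g: "\<And>b. g b \<in> borel_measurable lborel" "\<And>b. AE x in lborel. f x \<bullet> b = g b x"
    by metis
  define F where "F x = (\<Sum>b\<in>Basis. g b x *\<^sub>R b)" for x
  have Fm: "F \<in> borel_measurable lborel" unfolding F_def using g(1) by measurable
  have "AE x in lborel. \<forall>b\<in>Basis. f x \<bullet> b = g b x"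
    using g(2) by (intro AE_finite_allI) auto
  then have eq: "AE x in lborel. f x = F x"
  proof eventually_elim
    case (elim x)
    have "f x = (\<Sum>b\<in>Basis. (f x \<bullet> b) *\<^sub>R b)" by (simp add: euclidean_representation)
    also have "\<dots> = F x" unfolding F_def using elim by (intro sum.cong) auto
    finally show ?case .
  qed
  have "integrable lebesgue F"
    by (rule integrable_cong_AE_imp[OF assms measurable_completion[OF Fm] AE_completion[OF eq]])
  then have "integrable lborel F" using integrable_completion[OF Fm] by simp
  with eq that show thesis by blast
qed

lemma lebesgue_translation_AE_subseq:
  fixes f :: "'a::euclidean_space \<Rightarrow> 'b::euclidean_space"
  assumes "integrable lebesgue f" "s \<longlonglongrightarrow> 0"
  obtains r where "strict_mono (r :: nat \<Rightarrow> nat)" "AE x in lborel. (\<lambda>k. f (x + s (r k))) \<longlonglongrightarrow> f x"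
proof -
  obtain F where F: "integrable lborel F" "AE x in lborel. f x = F x"
    using integrable_lebesgue_borel_rep[OF assms(1)] .
  obtain r where r: "strict_mono (r :: nat \<Rightarrow> nat)" "AE x in lborel. (\<lambda>k. F (x + s (r k))) \<longlonglongrightarrow> F x"
    using translation_AE_subseq[OF F(1) assms(2)] .
  have "AE x in lborel. \<forall>k. f (x + s (r k)) = F (x + s (r k))"
    unfolding AE_all_countable using AE_lborel_translate[OF F(2)] by blast
  then have "AE x in lborel. (\<lambda>k. f (x + s (r k))) \<longlonglongrightarrow> f x"
    using F(2) r(2) by eventually_elim simp
  with r(1) that show thesis by blast
qed

text \<open>\<open>f\<close> and \<open>g\<close> are cut off to \<open>cbox c d\<close> and
  replaced by Borel representatives on the whole space. Test functions supported in the box do not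
  notice, and at an interior point neither do the quotients with small step.\<close>

lemma has_weak_pderiv_quotient:
  fixes f g :: "real^'m \<Rightarrow> 'b::euclidean_space"
  assumes wk: "has_weak_pderiv U j f g" and U: "open U" "cbox c d \<subseteq> U"
    and h: "h \<longlonglongrightarrow> 0" "\<And>k. h k > 0"
  obtains r where "strict_mono (r :: nat \<Rightarrow> nat)"
    "AE x in lborel. x \<in> box c d \<longrightarrow>
       (\<lambda>k. (f (x + h (r k) *\<^sub>R axis j 1) - f x) /\<^sub>R h (r k)) \<longlonglongrightarrow> g x"
proof -
  have K: "set_integrable lebesgue (cbox c d) f" "set_integrable lebesgue (cbox c d) g"
    using wk U(2) by (auto simp: has_weak_pderiv_def locally_integrable_on_def)
  obtain F where F: "integrable lborel F" "AE x in lborel. indicator (cbox c d) x *\<^sub>R f x = F x"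
    using integrable_lebesgue_borel_rep[OF K(1)[unfolded set_integrable_def]] .
  obtain G where G: "integrable lborel G" "AE x in lborel. indicator (cbox c d) x *\<^sub>R g x = G x"
    using integrable_lebesgue_borel_rep[OF K(2)[unfolded set_integrable_def]] .
  have transfer: "(LINT x|lebesgue_on U. \<psi> x *\<^sub>R f' x) = (\<integral>x. \<psi> x *\<^sub>R F' x \<partial>lborel)"
    if "AE x in lborel. indicator (cbox c d) x *\<^sub>R f' x = F' x" "integrable lborel F'"
      "\<psi> \<in> borel_measurable borel" "\<And>x. x \<notin> cbox c d \<Longrightarrow> \<psi> x = 0"
      "set_integrable lebesgue (cbox c d) f'"
    for \<psi> and f' F' :: "real^'m \<Rightarrow> 'b"
  proof -
    have "(LINT x|lebesgue_on U. \<psi> x *\<^sub>R f' x) = (LINT x|lebesgue. indicator U x *\<^sub>R \<psi> x *\<^sub>R f' x)"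
      using U(1) by (intro integral_restrict_space) auto
    also have "\<dots> = (LINT x|lebesgue. \<psi> x *\<^sub>R (indicator (cbox c d) x *\<^sub>R f' x))"
      using that(4) U(2) by (intro Bochner_Integration.integral_cong) (auto simp: indicator_def)
    also have "\<dots> = (LINT x|lebesgue. \<psi> x *\<^sub>R F' x)"
    proof (rule integral_cong_AE)
      show "(\<lambda>x. \<psi> x *\<^sub>R (indicator (cbox c d) x *\<^sub>R f' x)) \<in> borel_measurable lebesgue"
        using measurable_completion[OF that(3)[folded measurable_lborel2]]
          borel_measurable_integrable[OF that(5)[unfolded set_integrable_def]]
        by (rule borel_measurable_scaleR)
      show "(\<lambda>x. \<psi> x *\<^sub>R F' x) \<in> borel_measurable lebesgue"
        using that(2,3) by (intro measurable_completion) auto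
      show "AE x in lebesgue. \<psi> x *\<^sub>R (indicator (cbox c d) x *\<^sub>R f' x) = \<psi> x *\<^sub>R F' x"
        using AE_completion[OF that(1)] by eventually_elim (simp only:)
    qed
    also have "\<dots> = (LINT x|lborel. \<psi> x *\<^sub>R F' x)"
      using that(2,3) by (intro integral_completion) auto
    finally show ?thesis .
  qed
  have weak: "(\<integral>x. tensor (p(j := deriv (p j))) x *\<^sub>R F x \<partial>lborel) = - (\<integral>x. tensor p x *\<^sub>R G x \<partial>lborel)"
    if p: "\<forall>i. smooth_real (p i)" and supp: "\<forall>i t. t \<notin> {c $ i..d $ i} \<longrightarrow> p i t = 0" for p
  proof -
    have sm: "\<forall>i. smooth_real ((p(j := deriv (p j))) i)" using p smooth_real_deriv by auto
    have z: "tensor q x = 0" if "\<forall>i t. t \<notin> {c $ i..d $ i} \<longrightarrow> q i t = 0" "x \<notin> cbox c d" for q and x :: "real^'m"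
      using that by (auto simp: tensor_def mem_box_cart)
    have supp': "\<forall>i t. t \<notin> {c $ i..d $ i} \<longrightarrow> (p(j := deriv (p j))) i t = 0"
    proof (intro allI impI)
      fix i t assume t: "t \<notin> {c $ i..d $ i}"
      show "(p(j := deriv (p j))) i t = 0"
      proof (cases "i = j")
        case True
        have "\<forall>\<^sub>F s in nhds t. s \<in> - {c $ i..d $ i}"
          using t by (intro eventually_nhds_in_open) auto
        then have "\<forall>\<^sub>F s in nhds t. p i s = 0" by eventually_elim (use supp in auto)
        then have "deriv (p i) t = deriv (\<lambda>_. 0) t" by (intro deriv_cong_ev) auto
        with True show ?thesis by simp
      qed (use t supp in auto)
    qed
    have "tensor p \<in> test_functions U" using p supp U(2) by (intro tensor_test_function) auto
    then have "(LINT x|lebesgue_on U. partial_deriv j (tensor p) x *\<^sub>R f x) = - (LINT x|lebesgue_on U. tensor p x *\<^sub>R g x)"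
      using wk by (auto simp: has_weak_pderiv_def)
    then show ?thesis
      unfolding partial_deriv_tensor[OF p]
      using transfer[OF F(2,1) tensor_borel_measurable[OF sm] z[OF supp'] K(1)]
        transfer[OF G(2,1) tensor_borel_measurable[OF p] z[OF supp] K(2)]
      by (simp del: fun_upd_apply)
  qed
  obtain r where r: "strict_mono (r :: nat \<Rightarrow> nat)"
    "AE x in lborel. x \<in> box c d \<longrightarrow>
       (\<lambda>k. (F (x + h (r k) *\<^sub>R axis j 1) - F x) /\<^sub>R h (r k)) \<longlonglongrightarrow> G x"
    using weak_deriv_difference_quotient[OF F(1) G(1) weak h] by blast
  \<comment> \<open>The representative has to agree with \<open>f\<close> at all shifted points too:
    a countable union of translated null sets.\<close>
  have "AE x in lborel. \<forall>k. indicator (cbox c d) (x + h (r k) *\<^sub>R axis j 1) *\<^sub>R f (x + h (r k) *\<^sub>R axis j 1) = F (x + h (r k) *\<^sub>R axis j 1)"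
    unfolding AE_all_countable using AE_lborel_translate[OF F(2)] by blast
  with r(2) F(2) G(2) have "AE x in lborel. x \<in> box c d \<longrightarrow>
       (\<lambda>k. (f (x + h (r k) *\<^sub>R axis j 1) - f x) /\<^sub>R h (r k)) \<longlonglongrightarrow> g x"
  proof (eventually_elim, intro impI)
    fix x assume x: "x \<in> box c d \<longrightarrow>
       (\<lambda>k. (F (x + h (r k) *\<^sub>R axis j 1) - F x) /\<^sub>R h (r k)) \<longlonglongrightarrow> G x"
      "indicator (cbox c d) x *\<^sub>R f x = F x" "indicator (cbox c d) x *\<^sub>R g x = G x"
      "\<forall>k. indicator (cbox c d) (x + h (r k) *\<^sub>R axis j 1) *\<^sub>R f (x + h (r k) *\<^sub>R axis j 1) = F (x + h (r k) *\<^sub>R axis j 1)"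
      and xc: "x \<in> box c d"
    have xK: "x \<in> cbox c d" using xc box_subset_cbox by blast
    have hr: "(\<lambda>k. h (r k)) \<longlonglongrightarrow> 0" using LIMSEQ_subseq_LIMSEQ[OF h(1) r(1)] by (simp add: o_def)
    have "(\<lambda>k. x + h (r k) *\<^sub>R axis j 1) \<longlonglongrightarrow> x + 0 *\<^sub>R axis j 1" by (intro tendsto_intros hr)
    then have "\<forall>\<^sub>F k in sequentially. x + h (r k) *\<^sub>R axis j 1 \<in> box c d"
      using xc by (auto simp: tendsto_def open_box)
    then have "\<forall>\<^sub>F k in sequentially. (F (x + h (r k) *\<^sub>R axis j 1) - F x) /\<^sub>R h (r k)
        = (f (x + h (r k) *\<^sub>R axis j 1) - f x) /\<^sub>R h (r k)"
    proof eventually_elim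
      fix k assume "x + h (r k) *\<^sub>R axis j 1 \<in> box c d"
      then have "x + h (r k) *\<^sub>R axis j 1 \<in> cbox c d" using box_subset_cbox by blast
      then show "(F (x + h (r k) *\<^sub>R axis j 1) - F x) /\<^sub>R h (r k)
        = (f (x + h (r k) *\<^sub>R axis j 1) - f x) /\<^sub>R h (r k)"
        using x(2)[symmetric] x(4)[rule_format, of k, symmetric] xK by simp
    qed
    moreover have "G x = g x" using x(3) xK by simp
    ultimately show "(\<lambda>k. (f (x + h (r k) *\<^sub>R axis j 1) - f x) /\<^sub>R h (r k)) \<longlonglongrightarrow> g x"
      using x(1) xc Lim_transform_eventually by fastforce
  qed
  with r(1) that show thesis by blast
qed

text \<open>An open set is a countable union of closed boxes, whose boundaries are null.\<close>

lemma AE_open_if_AE_boxes: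
  fixes U :: "'a::euclidean_space set"
  assumes "open U" and box: "\<And>c d. cbox c d \<subseteq> U \<Longrightarrow> AE x in lborel. x \<in> box c d \<longrightarrow> P x"
  shows "AE x in lborel. x \<in> U \<longrightarrow> P x"
proof -
  obtain D where D: "countable D" "D \<subseteq> Pow U" "\<And>X. X \<in> D \<Longrightarrow> \<exists>a b. X = cbox a b" "\<Union>D = U"
    using open_countable_Union_open_cbox[OF assms(1)] by metis
  have "AE x in lborel. x \<in> X \<longrightarrow> P x" if X: "X \<in> D" for X
  proof -
    obtain a b where ab: "X = cbox a b" using D(3) X by blast
    have "AE x in lebesgue. x \<notin> cbox a b - box a b"
      using negligible_frontier_interval negligible_iff_null_sets AE_not_in by blast
    then have "AE x in lborel. x \<notin> cbox a b - box a b" by (simp add: AE_completion_iff)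
    moreover have "AE x in lborel. x \<in> box a b \<longrightarrow> P x" using box D(2) X ab by auto
    ultimately show ?thesis unfolding ab by eventually_elim auto
  qed
  then have "AE x in lborel. \<forall>X\<in>D. x \<in> X \<longrightarrow> P x" using D(1) by (intro AE_ball_countable') auto
  then show ?thesis by eventually_elim (use D(4) in auto)
qed

definition null_seq :: "nat \<Rightarrow> real" where "null_seq k = 1 / real (Suc k)"

lemma null_seq: "null_seq \<longlonglongrightarrow> 0" "null_seq k > 0"
  using LIMSEQ_inverse_real_of_nat by (auto simp: null_seq_def[abs_def] inverse_eq_divide)

text \<open>Both derivatives are limits of the same difference quotients, once the second
  subsequence is extracted from the first.\<close>

lemma has_weak_pderiv_unique:
  assumes U: "open U" and wk: "has_weak_pderiv U j f g" "has_weak_pderiv U j f g'"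
  shows "AE x in lborel. x \<in> U \<longrightarrow> g x = g' x"
proof (rule AE_open_if_AE_boxes[OF U])
  fix c d :: "real^'a" assume cd: "cbox c d \<subseteq> U"
  obtain r where r: "strict_mono (r :: nat \<Rightarrow> nat)" "AE x in lborel. x \<in> box c d \<longrightarrow>
       (\<lambda>k. (f (x + null_seq (r k) *\<^sub>R axis j 1) - f x) /\<^sub>R null_seq (r k)) \<longlonglongrightarrow> g x"
    using has_weak_pderiv_quotient[OF wk(1) U cd null_seq] by blast
  have nr: "(\<lambda>k. null_seq (r k)) \<longlonglongrightarrow> 0"
    using LIMSEQ_subseq_LIMSEQ[OF null_seq(1) r(1)] by (simp add: o_def)
  obtain s where s: "strict_mono (s :: nat \<Rightarrow> nat)" "AE x in lborel. x \<in> box c d \<longrightarrow>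
       (\<lambda>k. (f (x + null_seq (r (s k)) *\<^sub>R axis j 1) - f x) /\<^sub>R null_seq (r (s k))) \<longlonglongrightarrow> g' x"
    using has_weak_pderiv_quotient[OF wk(2) U cd nr null_seq(2)] by blast
  show "AE x in lborel. x \<in> box c d \<longrightarrow> g x = g' x"
    using r(2) s(2)
  proof eventually_elim
    case (elim x)
    show ?case
    proof
      assume "x \<in> box c d"
      with elim LIMSEQ_subseq_LIMSEQ[OF _ s(1)] show "g x = g' x"
        by (intro LIMSEQ_unique[OF _ mp[OF elim(2)]]) (force simp: o_def)
    qed
  qed
qed

section \<open>Derivatives of eigenvalues almost everywhere\<close>

lemma sobolev_has_weak_pderiv:
  assumes "f \<in> sobolev_space q U"
  shows "has_weak_pderiv U j f (weak_pderiv U j f)"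
proof -
  have "\<exists>g. has_weak_pderiv U j f g" using assms by (auto simp: sobolev_space_def)
  then show ?thesis unfolding weak_pderiv_def by (rule someI_ex)
qed

lemma coincidence_AE_preserved:
  fixes l :: "real^'m \<Rightarrow> complex^'d"
  assumes l: "l \<in> borel_measurable (lebesgue_on U)" and U: "open U" "cbox c d \<subseteq> U"
    and s: "s \<longlonglongrightarrow> 0"
  obtains r where "strict_mono (r :: nat \<Rightarrow> nat)"
    "AE x in lborel. x \<in> box c d \<longrightarrow>
      (\<forall>\<^sub>F k in sequentially. \<forall>i j. l (x + s (r k)) $ i = l (x + s (r k)) $ j \<longleftrightarrow> l x $ i = l x $ j)"
proof -
  \<comment> \<open>Restriction to the box makes the measure finite, hence the indicator
    integrable.\<close>
  define E where "E i j = {x \<in> cbox c d. l x $ i = l x $ j}" for i j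
  \<comment> \<open>Collecting the indicators in one matrix-valued function yields a single
    subsequence for all pairs of indices.\<close>
  define X where "X x = (\<Sum>i\<in>UNIV. \<Sum>j\<in>UNIV. indicator (E i j) x *\<^sub>R axis i (axis j (1::real)))" for x
  have X_nth: "X x $ i $ j = indicator (E i j) x" for x i j
  proof -
    have "X x $ i $ j = (\<Sum>i'\<in>UNIV. \<Sum>j'\<in>UNIV. if i' = i then if j' = j then indicator (E i' j') x else 0 else 0)"
      unfolding X_def sum_component by (intro sum.cong refl) (auto simp: axis_def)
    also have "\<dots> = (\<Sum>i'\<in>UNIV. if i' = i then indicator (E i' j) x else 0)"
      by (intro sum.cong refl) auto
    finally show ?thesis by simp
  qed
  have "E i j \<in> lmeasurable" for i j
  proof -
    have nth: "(\<lambda>x. l x $ k) \<in> borel_measurable (lebesgue_on U)" for k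
      by (rule measurable_compose[OF l]) (intro borel_measurable_continuous_onI continuous_intros)
    have "{x \<in> space (lebesgue_on U). l x $ i = l x $ j} \<in> sets (lebesgue_on U)"
      using nth by measurable
    then have "{x \<in> U. l x $ i = l x $ j} \<in> sets lebesgue"
      using U(1) by (auto simp: sets_restrict_space_iff)
    then have "{x \<in> U. l x $ i = l x $ j} \<inter> cbox c d \<in> lmeasurable"
      by (rule fmeasurable_Int_fmeasurable[OF lmeasurable_cbox, simplified Int_commute])
    moreover have "E i j = {x \<in> U. l x $ i = l x $ j} \<inter> cbox c d" using U(2) by (auto simp: E_def)
    ultimately show ?thesis by simp
  qed
  then have "integrable lebesgue (indicator (E i j) :: _ \<Rightarrow> real)" for i j
    by (intro integrable_real_indicator) (auto simp: fmeasurable_def simp del: emeasure_completion)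
  then have int: "integrable lebesgue X"
    unfolding X_def by (intro Bochner_Integration.integrable_sum integrable_scaleR_left)
  obtain r where r: "strict_mono (r :: nat \<Rightarrow> nat)" "AE x in lborel. (\<lambda>k. X (x + s (r k))) \<longlonglongrightarrow> X x"
    using lebesgue_translation_AE_subseq[OF int s] .
  have sr: "(\<lambda>k. s (r k)) \<longlonglongrightarrow> 0" using LIMSEQ_subseq_LIMSEQ[OF s r(1)] by (simp add: o_def)
  from r(2) have "AE x in lborel. x \<in> box c d \<longrightarrow>
      (\<forall>\<^sub>F k in sequentially. \<forall>i j. l (x + s (r k)) $ i = l (x + s (r k)) $ j \<longleftrightarrow> l x $ i = l x $ j)"
  proof (eventually_elim, intro impI)
    fix x assume lim: "(\<lambda>k. X (x + s (r k))) \<longlonglongrightarrow> X x" and x: "x \<in> box c d"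
    have "(\<lambda>k. x + s (r k)) \<longlonglongrightarrow> x + 0" by (intro tendsto_intros sr)
    then have ev: "\<forall>\<^sub>F k in sequentially. x + s (r k) \<in> box c d"
      using x by (auto simp: tendsto_def open_box)
    have "\<forall>\<^sub>F k in sequentially. l (x + s (r k)) $ i = l (x + s (r k)) $ j \<longleftrightarrow> l x $ i = l x $ j" for i j
    proof -
      have "(\<lambda>k. indicator (E i j) (x + s (r k)) :: real) \<longlonglongrightarrow> indicator (E i j) x"
        using tendsto_vec_nth[OF tendsto_vec_nth[OF lim], of i j] unfolding X_nth .
      then have "\<forall>\<^sub>F k in sequentially. dist (indicator (E i j) (x + s (r k)) :: real) (indicator (E i j) x) < 1"
        by (rule tendstoD) simp
      with ev show ?thesis
      proof eventually_elim
        fix k assume k: "x + s (r k) \<in> box c d" "dist (indicator (E i j) (x + s (r k)) :: real) (indicator (E i j) x) < 1"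
        \<comment> \<open>Two values in {0, 1} at distance below 1 are equal.\<close>
        then have "x + s (r k) \<in> E i j \<longleftrightarrow> x \<in> E i j" by (auto simp: indicator_def dist_real_def split: if_splits)
        then show "l (x + s (r k)) $ i = l (x + s (r k)) $ j \<longleftrightarrow> l x $ i = l x $ j"
          using k(1) x box_subset_cbox[of c d] by (auto simp: E_def)
      qed
    qed
    then show "\<forall>\<^sub>F k in sequentially. \<forall>i j. l (x + s (r k)) $ i = l (x + s (r k)) $ j \<longleftrightarrow> l x $ i = l x $ j"
      by (intro eventually_all_finite) auto
  qed
  with r(1) that show thesis by blast
qed

text \<open>Three nested extractions from \<open>null_seq\<close> secure the quotients of
  \<open>A\<close>, those of \<open>l\<close>, and the coincidences; each property survives the
  later extractions, so \<open>eigenvalue_derivative\<close> applies pointwise.\<close>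

theorem AE_eigen_derivative:
  fixes A :: "real^'m \<Rightarrow> complex^'d^'d" and l :: "real^'m \<Rightarrow> complex^'d"
  assumes U: "open U" and A: "A \<in> sobolev_normal q U" and l: "l \<in> sobolev_space q U"
    and param: "eigenvalue_parameterization U A l"
  shows "AE x in lborel. x \<in> U \<longrightarrow> eigen_derivative (A x) (weak_pderiv U j A x) (l x) (weak_pderiv U j l x)"
proof (rule AE_open_if_AE_boxes[OF U])
  fix c d :: "real^'m" assume cd: "cbox c d \<subseteq> U"
  define A' where "A' = weak_pderiv U j A"
  define l' where "l' = weak_pderiv U j l"
  have wA: "has_weak_pderiv U j A A'" and wl: "has_weak_pderiv U j l l'"
    using A l sobolev_has_weak_pderiv unfolding A'_def l'_def sobolev_normal_def by blast+
  have lm: "l \<in> borel_measurable (lebesgue_on U)" using l by (simp add: sobolev_space_def Lq_space_def)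
  obtain r1 where r1: "strict_mono (r1 :: nat \<Rightarrow> nat)" "AE x in lborel. x \<in> box c d \<longrightarrow>
       (\<lambda>k. (A (x + null_seq (r1 k) *\<^sub>R axis j 1) - A x) /\<^sub>R null_seq (r1 k)) \<longlonglongrightarrow> A' x"
    using has_weak_pderiv_quotient[OF wA U cd null_seq] by blast
  have n1: "(\<lambda>k. null_seq (r1 k)) \<longlonglongrightarrow> 0"
    using LIMSEQ_subseq_LIMSEQ[OF null_seq(1) r1(1)] by (simp add: o_def)
  obtain r2 where r2: "strict_mono (r2 :: nat \<Rightarrow> nat)" "AE x in lborel. x \<in> box c d \<longrightarrow>
       (\<lambda>k. (l (x + null_seq (r1 (r2 k)) *\<^sub>R axis j 1) - l x) /\<^sub>R null_seq (r1 (r2 k))) \<longlonglongrightarrow> l' x"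
    using has_weak_pderiv_quotient[OF wl U cd n1 null_seq(2)] by blast
  have n2: "(\<lambda>k. null_seq (r1 (r2 k))) \<longlonglongrightarrow> 0"
    using LIMSEQ_subseq_LIMSEQ[OF n1 r2(1)] by (simp add: o_def)
  have "(\<lambda>k. null_seq (r1 (r2 k)) *\<^sub>R axis j 1 :: real^'m) \<longlonglongrightarrow> 0 *\<^sub>R axis j 1" by (intro tendsto_intros n2)
  then have s2: "(\<lambda>k. null_seq (r1 (r2 k)) *\<^sub>R axis j 1 :: real^'m) \<longlonglongrightarrow> 0" by simp
  obtain r3 where r3: "strict_mono (r3 :: nat \<Rightarrow> nat)"
    "AE x in lborel. x \<in> box c d \<longrightarrow> (\<forall>\<^sub>F k in sequentially. \<forall>i i'.
       l (x + null_seq (r1 (r2 (r3 k))) *\<^sub>R axis j 1) $ i = l (x + null_seq (r1 (r2 (r3 k))) *\<^sub>R axis j 1) $ i' \<longleftrightarrow> l x $ i = l x $ i')"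
    using coincidence_AE_preserved[OF lm U cd s2] by blast
  define h where "h k = null_seq (r1 (r2 (r3 k)))" for k
  have h: "h \<longlonglongrightarrow> 0" "h k > 0" for k
    using LIMSEQ_subseq_LIMSEQ[OF n2 r3(1)] null_seq(2) by (simp_all add: o_def h_def[abs_def])
  have r23: "strict_mono (\<lambda>k. r2 (r3 k))" using r2(1) r3(1) by (simp add: strict_mono_def)
  have "AE x in lborel. x \<in> box c d \<longrightarrow> eigen_derivative (A x) (A' x) (l x) (l' x)"
    using r1(2) r2(2) r3(2)
  proof (eventually_elim, intro impI)
    fix x
    assume 1: "x \<in> box c d \<longrightarrow> (\<lambda>k. (A (x + null_seq (r1 k) *\<^sub>R axis j 1) - A x) /\<^sub>R null_seq (r1 k)) \<longlonglongrightarrow> A' x"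
      and 2: "x \<in> box c d \<longrightarrow> (\<lambda>k. (l (x + null_seq (r1 (r2 k)) *\<^sub>R axis j 1) - l x) /\<^sub>R null_seq (r1 (r2 k))) \<longlonglongrightarrow> l' x"
      and 3: "x \<in> box c d \<longrightarrow> (\<forall>\<^sub>F k in sequentially. \<forall>i i'.
       l (x + null_seq (r1 (r2 (r3 k))) *\<^sub>R axis j 1) $ i = l (x + null_seq (r1 (r2 (r3 k))) *\<^sub>R axis j 1) $ i' \<longleftrightarrow> l x $ i = l x $ i')"
      and x: "x \<in> box c d"
    define y where "y k = x + h k *\<^sub>R axis j 1" for k
    have "y \<longlonglongrightarrow> x + 0 *\<^sub>R axis j 1" unfolding y_def by (intro tendsto_intros h)
    then have "\<forall>\<^sub>F k in sequentially. y k \<in> box c d"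
      using x by (auto simp: tendsto_def open_box)
    \<comment> \<open>The first terms are dropped because \<open>eigenvalue_derivative\<close> asks
      for normality and the spectrum at every index, which is known only inside
      \<open>U\<close>.\<close>
    then obtain N where N: "\<And>k. k \<ge> N \<Longrightarrow> y k \<in> box c d" unfolding eventually_sequentially by blast
    define z where "z k = y (k + N)" for k
    have zU: "z k \<in> U" for k using N[of "k + N"] cd box_subset_cbox[of c d] by (auto simp: z_def)
    have xU: "x \<in> U" using x cd box_subset_cbox[of c d] by auto
    have qA: "(\<lambda>k. (A (z k) - A x) /\<^sub>R h (k + N)) \<longlonglongrightarrow> A' x"
      using LIMSEQ_ignore_initial_segment[OF LIMSEQ_subseq_LIMSEQ[OF mp[OF 1 x] r23], of N]
      by (simp add: z_def y_def h_def o_def)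
    have ql: "(\<lambda>k. (l (z k) - l x) /\<^sub>R h (k + N)) \<longlonglongrightarrow> l' x"
      using LIMSEQ_ignore_initial_segment[OF LIMSEQ_subseq_LIMSEQ[OF mp[OF 2 x] r3(1)], of N]
      by (simp add: z_def y_def h_def o_def)
    have mult: "\<forall>\<^sub>F k in sequentially. \<forall>i i'. l (z k) $ i = l (z k) $ i' \<longleftrightarrow> l x $ i = l x $ i'"
      using sequentially_offset[OF mp[OF 3 x], of N] by (simp add: z_def y_def h_def)
    have nm: "A u \<in> normal_matrices" if "u \<in> U" for u
      using A that by (auto simp: sobolev_normal_def)
    show "eigen_derivative (A x) (A' x) (l x) (l' x)"
      unfolding eigen_derivative_def
    proof (intro allI conjI impI)
      fix i show "\<exists>v. v \<noteq> 0 \<and> A x *v v = l x $ i *s v"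
        using eigenvalue_parameterization_iff[OF param xU] by blast
      fix v assume v: "A x *v v = l x $ i *s v"
      show "hip (A' x *v v) v = l' x $ i * hip v v"
      proof (rule eigenvalue_derivative[OF nm[OF zU] nm[OF xU] _ _ _ qA ql mult v])
        show "\<exists>i'. c = l (z k) $ i'" if "v \<noteq> 0" "A (z k) *v v = c *s v" for k c v
          using eigenvalue_parameterization_iff[OF param zU] that by blast
        show "(\<lambda>k. h (k + N)) \<longlonglongrightarrow> 0" by (rule LIMSEQ_ignore_initial_segment[OF h(1)])
        show "h (k + N) \<noteq> 0" for k using h(2)[of "k + N"] by simp
      qed
    qed
  qed
  then show "AE x in lborel. x \<in> box c d \<longrightarrow>
      eigen_derivative (A x) (weak_pderiv U j A x) (l x) (weak_pderiv U j l x)"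
    by (simp add: A'_def l'_def)
qed

section \<open>Almost every coordinate line\<close>

lemma borel_measurable_vec_lambda_PiM [measurable]:
  "(\<lambda>f. \<chi> i. f i) \<in> (\<Pi>\<^sub>M i\<in>(UNIV::'m set). lborel) \<rightarrow>\<^sub>M (borel :: (real^'m) measure)"
proof (subst borel_measurable_euclidean_space, intro ballI)
  fix b :: "real^'m" assume "b \<in> Basis"
  then obtain i where "b = axis i 1" by (auto simp: Basis_vec_def)
  then show "(\<lambda>f. (\<chi> i. f i) \<bullet> b) \<in> borel_measurable (\<Pi>\<^sub>M i\<in>UNIV. lborel)"
    by (simp add: inner_axis)
qed

text \<open>Links Lebesgue measure on vectors to the product measures in
  \<open>almost_all_segments\<close>; values on boxes determine the measure.\<close>

lemma lborel_eq_distr_PiM_vec: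
  "(lborel :: (real^'m) measure) = distr (\<Pi>\<^sub>M i\<in>UNIV. lborel) borel (\<lambda>f. \<chi> i. f i)"
proof (rule lborel_eqI)
  interpret product_sigma_finite "\<lambda>_::'m. lborel :: real measure" by standard
  fix l u :: "real^'m" assume lu: "\<And>b. b \<in> Basis \<Longrightarrow> l \<bullet> b \<le> u \<bullet> b"
  have lu': "l $ i \<le> u $ i" for i using lu[of "axis i 1"] by (simp add: inner_axis axis_in_Basis_iff)
  have "emeasure (distr (\<Pi>\<^sub>M i\<in>UNIV. lborel) borel (\<lambda>f. \<chi> i. f i)) (box l u)
     = emeasure (\<Pi>\<^sub>M i\<in>UNIV. lborel) (\<Pi>\<^sub>E i\<in>UNIV. {l $ i<..<u $ i})"
    by (subst emeasure_distr) (auto simp: mem_box_cart space_PiM PiE_UNIV_domain Pi_iff intro!: arg_cong2[where f=emeasure])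
  also have "\<dots> = (\<Prod>i\<in>UNIV. emeasure lborel {l $ i<..<u $ i})"
    by (rule emeasure_PiM) auto
  also have "\<dots> = ennreal (\<Prod>i\<in>UNIV. u $ i - l $ i)"
    using lu' by (simp add: prod_ennreal)
  also have "(\<Prod>i\<in>UNIV. u $ i - l $ i) = (\<Prod>b\<in>Basis. (u - l) \<bullet> b)"
  proof -
    have B: "Basis = (\<lambda>i. axis i 1 :: real^'m) ` UNIV" by (auto simp: Basis_vec_def)
    have "inj (\<lambda>i. axis i 1 :: real^'m)" by (auto simp: inj_on_def axis_eq_axis)
    then show ?thesis unfolding B by (simp add: prod.reindex inner_axis)
  qed
  finally show "emeasure (distr (\<Pi>\<^sub>M i\<in>UNIV. lborel) borel (\<lambda>f. \<chi> i. f i)) (box l u)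
      = (\<Prod>b\<in>Basis. (u - l) \<bullet> b)" .
qed simp

text \<open>Tonelli's theorem with coordinate \<open>j\<close> integrated first.\<close>

lemma emeasure_lborel_coord_lines:
  fixes B :: "(real^'m) set"
  assumes B: "B \<in> sets borel"
  shows "emeasure lborel B = (\<integral>\<^sup>+ y. \<integral>\<^sup>+ t. indicator B (coord_line j y t) \<partial>lborel \<partial>(\<Pi>\<^sub>M i\<in>UNIV - {j}. lborel))"
proof -
  interpret product_sigma_finite "\<lambda>_::'m. lborel :: real measure" by standard
  have "emeasure lborel B = (\<integral>\<^sup>+ x. indicator B x \<partial>lborel)" using B by simp
  also have "\<dots> = (\<integral>\<^sup>+ f. indicator B (\<chi> i. f i) \<partial>(\<Pi>\<^sub>M i\<in>UNIV. lborel))"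
    using B by (subst lborel_eq_distr_PiM_vec, subst nn_integral_distr) auto
  also have "\<dots> = (\<integral>\<^sup>+ f. indicator B (\<chi> i. f i) \<partial>(\<Pi>\<^sub>M i\<in>insert j (UNIV - {j}). lborel))"
    by (simp add: insert_absorb)
  also have "\<dots> = (\<integral>\<^sup>+ y. \<integral>\<^sup>+ t. indicator B (\<chi> i. (y(j := t)) i) \<partial>lborel \<partial>(\<Pi>\<^sub>M i\<in>UNIV - {j}. lborel))"
    using B by (intro product_nn_integral_insert) (auto simp: insert_absorb)
  also have "(\<lambda>y t. (\<chi> i. (y(j := t)) i) :: real^'m) = coord_line j"
    by (auto simp: coord_line_def fun_eq_iff vec_eq_iff)
  then have "(\<integral>\<^sup>+ y. \<integral>\<^sup>+ t. indicator B (\<chi> i. (y(j := t)) i) \<partial>lborel \<partial>(\<Pi>\<^sub>M i\<in>UNIV - {j}. lborel))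
      = (\<integral>\<^sup>+ y. \<integral>\<^sup>+ t. indicator B (coord_line j y t) \<partial>lborel \<partial>(\<Pi>\<^sub>M i\<in>UNIV - {j}. lborel))"
    by (metis (no_types))
  finally show ?thesis .
qed

text \<open>Tonelli is applied to the Borel part \<open>B\<close> of \<open>N\<close>, which has the
  full measure of \<open>N\<close> and still misses almost all points of almost all lines.\<close>

lemma AE_if_AE_coord_lines:
  fixes N :: "(real^'m) set"
  assumes N: "N \<in> sets lebesgue"
    and lines: "AE y in (\<Pi>\<^sub>M i\<in>UNIV - {j}. lborel). AE t in lborel. coord_line j y t \<notin> N"
  shows "AE x in lborel. x \<notin> N"
proof -
  define B where "B = main_part lborel N"
  have B: "B \<in> sets borel" "B \<subseteq> N"
    using main_part_sets[OF N] main_part_null_part_Un[OF N] by (auto simp: B_def)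
  have "AE y in (\<Pi>\<^sub>M i\<in>UNIV - {j}. lborel). (\<integral>\<^sup>+ t. indicator B (coord_line j y t) \<partial>lborel) = 0"
    using lines
  proof eventually_elim
    case (elim y)
    then have "AE t in lborel. (indicator B (coord_line j y t) :: ennreal) = 0"
      by eventually_elim (use B(2) in \<open>auto simp: indicator_def\<close>)
    then have "(\<integral>\<^sup>+ t. indicator B (coord_line j y t) \<partial>lborel) = (\<integral>\<^sup>+ t. 0 \<partial>(lborel :: real measure))"
      by (rule nn_integral_cong_AE)
    then show ?case by simp
  qed
  then have "(\<integral>\<^sup>+ y. \<integral>\<^sup>+ t. indicator B (coord_line j y t) \<partial>lborel \<partial>(\<Pi>\<^sub>M i\<in>UNIV - {j}. lborel))
      = (\<integral>\<^sup>+ y. 0 \<partial>(\<Pi>\<^sub>M i\<in>UNIV - {j}. (lborel :: real measure)))"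
    by (rule nn_integral_cong_AE)
  then have "emeasure lborel B = 0"
    unfolding emeasure_lborel_coord_lines[OF B(1), of j] by simp
  then have "N \<in> null_sets lebesgue"
    using N by (simp add: null_sets_def B_def)
  then show ?thesis using AE_not_in AE_completion_iff by blast
qed

text \<open>Countable quantifiers only, so that the set of convergence is visibly
  measurable.\<close>

lemma LIMSEQ_iff_inverse_Suc:
  "X \<longlonglongrightarrow> (L::'a::metric_space) \<longleftrightarrow> (\<forall>k. \<exists>N. \<forall>n\<ge>N. dist (X n) L < inverse (real (Suc k)))"
  unfolding lim_sequentially
  by (meson inverse_positive_iff_positive less_trans of_nat_0_less_iff reals_Archimedean zero_less_Suc)

lemma continuous_on_coord_line: "continuous_on UNIV (coord_line j y)"
proof -
  have "continuous_on UNIV (\<lambda>t. if i = j then t else y i)" for i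
    by (cases "i = j") auto
  then show ?thesis unfolding coord_line_def[abs_def] by (intro continuous_on_vec_lambda)
qed

text \<open>On a good line the essential suprema give convergence at almost every point of each
  segment. Countably many segments cover the part of the line in \<open>U\<close>, and Tonelli
  collects the lines.\<close>

lemma Linf_converges_on_segments_AE:
  fixes fs :: "nat \<Rightarrow> real^'m \<Rightarrow> 'b::euclidean_space"
  assumes conv: "Linf_converges_on_segments U fs f" and U: "open U"
    and [measurable]: "\<And>n. fs n \<in> borel_measurable (lebesgue_on U)" "f \<in> borel_measurable (lebesgue_on U)"
  shows "AE x in lborel. x \<in> U \<longrightarrow> (\<lambda>n. fs n x) \<longlonglongrightarrow> f x"
proof -
  define N where "N = {x \<in> space (lebesgue_on U). \<not> (\<lambda>n. fs n x) \<longlonglongrightarrow> f x}"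
  have "N \<in> sets (lebesgue_on U)"
    unfolding N_def LIMSEQ_iff_inverse_Suc by measurable
  then have N: "N \<in> sets lebesgue" using U by (auto simp: sets_restrict_space_iff)
  have NU: "N = {x \<in> U. \<not> (\<lambda>n. fs n x) \<longlonglongrightarrow> f x}" by (auto simp: N_def)
  \<comment> \<open>An arbitrary direction: lines parallel to one axis already fill the
    space.\<close>
  define j :: 'm where "j = undefined"
  have "AE y in (\<Pi>\<^sub>M i\<in>UNIV - {j}. lborel). AE t in lborel. coord_line j y t \<notin> N"
    using conv unfolding Linf_converges_on_segments_def almost_all_segments_def
  proof (elim allE[of _ j] eventually_mono)
    fix y :: "'m \<Rightarrow> real"
    define c where "c = coord_line j y"
    assume y: "\<forall>a b. a < b \<and> coord_line j y ` {a..b} \<subseteq> U \<longrightarrow>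
       (\<lambda>n. esssup (lebesgue_on {a..b}) (\<lambda>t. ennreal (norm (fs n (coord_line j y t) - f (coord_line j y t)))))
         \<longlonglongrightarrow> 0"
    have seg: "AE t in lborel. t \<in> {a..b} \<longrightarrow> (\<lambda>n. fs n (c t)) \<longlonglongrightarrow> f (c t)" if "a < b" "c ` {a..b} \<subseteq> U" for a b
    proof -
      define e where "e n = esssup (lebesgue_on {a..b}) (\<lambda>t. ennreal (norm (fs n (c t) - f (c t))))" for n
      have e: "e \<longlonglongrightarrow> 0" using y that unfolding e_def c_def by blast
      have "AE t in lebesgue_on {a..b}. \<forall>n. ennreal (norm (fs n (c t) - f (c t))) \<le> e n"
        unfolding AE_all_countable e_def by (intro allI esssup_AE)
      then have "AE t in lebesgue. t \<in> {a..b} \<longrightarrow> (\<forall>n. ennreal (norm (fs n (c t) - f (c t))) \<le> e n)"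
        by (subst (asm) AE_restrict_space_iff) auto
      then have "AE t in lborel. t \<in> {a..b} \<longrightarrow> (\<forall>n. ennreal (norm (fs n (c t) - f (c t))) \<le> e n)"
        by (simp only: AE_completion_iff)
      then show ?thesis
      proof (eventually_elim, intro impI)
        fix t assume "t \<in> {a..b} \<longrightarrow> (\<forall>n. ennreal (norm (fs n (c t) - f (c t))) \<le> e n)" "t \<in> {a..b}"
        then have "\<And>n. ennreal (norm (fs n (c t) - f (c t))) \<le> e n" by blast
        then have "(\<lambda>n. ennreal (norm (fs n (c t) - f (c t)))) \<longlonglongrightarrow> 0"
          by (intro tendsto_sandwich[OF _ _ tendsto_const[of 0] e]) auto
        then have "(\<lambda>n. norm (fs n (c t) - f (c t))) \<longlonglongrightarrow> 0"
          by (intro tendsto_ennrealD[where x = 0]) auto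
        then show "(\<lambda>n. fs n (c t)) \<longlonglongrightarrow> f (c t)"
          by (simp add: tendsto_norm_zero_iff LIM_zero_iff)
      qed
    qed
    \<comment> \<open>The exceptional null set depends on the segment; rational endpoints leave
      countably many segments.\<close>
    have "AE t in lborel. \<forall>p::rat. \<forall>q::rat. of_rat p < (of_rat q :: real) \<longrightarrow> c ` {of_rat p..of_rat q} \<subseteq> U \<longrightarrow>
        t \<in> {of_rat p..of_rat q} \<longrightarrow> (\<lambda>n. fs n (c t)) \<longlonglongrightarrow> f (c t)"
      unfolding AE_all_countable
    proof (intro allI)
      fix p q :: rat
      show "AE t in lborel. of_rat p < (of_rat q :: real) \<longrightarrow> c ` {of_rat p..of_rat q} \<subseteq> U \<longrightarrow>
        t \<in> {of_rat p..of_rat q} \<longrightarrow> (\<lambda>n. fs n (c t)) \<longlonglongrightarrow> f (c t)"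
        using seg[of "of_rat p" "of_rat q"]
        by (cases "of_rat p < (of_rat q :: real) \<and> c ` {of_rat p..of_rat q} \<subseteq> U") auto
    qed
    then show "AE t in lborel. coord_line j y t \<notin> N"
    proof eventually_elim
      fix t assume t: "\<forall>p::rat. \<forall>q::rat. of_rat p < (of_rat q :: real) \<longrightarrow> c ` {of_rat p..of_rat q} \<subseteq> U \<longrightarrow>
        t \<in> {of_rat p..of_rat q} \<longrightarrow> (\<lambda>n. fs n (c t)) \<longlonglongrightarrow> f (c t)"
      have "(\<lambda>n. fs n (c t)) \<longlonglongrightarrow> f (c t)" if "c t \<in> U"
      proof -
        have "open (c -` U)"
          using continuous_on_coord_line U unfolding c_def by (intro open_vimage)
        then obtain d where d: "d > 0" "ball t d \<subseteq> c -` U" using \<open>c t \<in> U\<close> open_contains_ball by blast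
        obtain p where p: "t - d < of_rat p" "of_rat p < t" using of_rat_dense[of "t - d" t] d by auto
        obtain q where q: "t < of_rat q" "of_rat q < t + d" using of_rat_dense[of t "t + d"] d by auto
        have "{of_rat p..of_rat q} \<subseteq> ball t d" using p q by (auto simp: dist_real_def)
        with d(2) have "c ` {of_rat p..of_rat q} \<subseteq> U" by auto
        then show ?thesis using t p q by force
      qed
      then show "coord_line j y t \<notin> N" unfolding NU c_def by blast
    qed
  qed
  from AE_if_AE_coord_lines[OF N this] show ?thesis
    by eventually_elim (auto simp: NU)
qed

section \<open>Convergence in $L^q$\<close>

lemma AE_lebesgue_on_iff:
  assumes "open U"
  shows "(AE x in lebesgue_on U. P x) \<longleftrightarrow> (AE x in lborel. x \<in> U \<longrightarrow> P x)"
  using assms by (subst AE_restrict_space_iff) (auto simp: AE_completion_iff)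

lemma borel_measurable_lebesgue_on_AE:
  fixes f g :: "'a::euclidean_space \<Rightarrow> 'b::euclidean_space"
  assumes U: "open U" and f: "f \<in> borel_measurable (lebesgue_on U)"
    and eq: "AE x in lborel. x \<in> U \<longrightarrow> f x = g x"
  shows "g \<in> borel_measurable (lebesgue_on U)"
proof -
  have *: "U \<inter> space lebesgue \<in> sets lebesgue" using U by auto
  have "(\<lambda>x. indicator U x *\<^sub>R f x) \<in> borel_measurable lebesgue"
    using f unfolding borel_measurable_restrict_space_iff[OF *] .
  moreover have "AE x in lebesgue. indicator U x *\<^sub>R f x = indicator U x *\<^sub>R g x"
    using AE_completion[OF eq] by eventually_elim (auto simp: indicator_def)
  ultimately show ?thesis
    unfolding borel_measurable_restrict_space_iff[OF *] by (rule borel_measurable_AE)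
qed

text \<open>From a + b <= 2 max(a, b): the power of the maximum is one of the two summands.\<close>

lemma powr_add_le:
  fixes a b q :: real
  assumes "a \<ge> 0" "b \<ge> 0" "q \<ge> 0"
  shows "(a + b) powr q \<le> (2 * a) powr q + (2 * b) powr q"
proof -
  have "(a + b) powr q \<le> (2 * max a b) powr q"
    using assms by (intro powr_mono2) auto
  also have "\<dots> \<le> (2 * a) powr q + (2 * b) powr q"
    by (cases "a \<le> b") (auto simp: max_def)
  finally show ?thesis .
qed

lemma Lq_space_diff:
  assumes "q \<ge> 0" "f \<in> Lq_space q U" "g \<in> Lq_space q U"
  shows "(\<lambda>x. f x - g x) \<in> Lq_space q U"
proof -
  have [measurable]: "f \<in> borel_measurable (lebesgue_on U)" "g \<in> borel_measurable (lebesgue_on U)"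
    using assms by (auto simp: Lq_space_def)
  have "integrable (lebesgue_on U) (\<lambda>x. norm (f x - g x) powr q)"
  proof (rule Bochner_Integration.integrable_bound)
    show "integrable (lebesgue_on U) (\<lambda>x. 2 powr q * (norm (f x) powr q) + 2 powr q * (norm (g x) powr q))"
      using assms by (auto simp: Lq_space_def)
    show "AE x in lebesgue_on U. norm (norm (f x - g x) powr q)
        \<le> norm (2 powr q * (norm (f x) powr q) + 2 powr q * (norm (g x) powr q))"
    proof (intro AE_I2)
      fix x
      have "norm (f x - g x) powr q \<le> (norm (f x) + norm (g x)) powr q"
        using assms(1) by (intro powr_mono2 norm_triangle_ineq4) auto
      also have "\<dots> \<le> (2 * norm (f x)) powr q + (2 * norm (g x)) powr q"
        using assms(1) by (intro powr_add_le) auto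
      finally show "norm (norm (f x - g x) powr q)
        \<le> norm (2 powr q * (norm (f x) powr q) + 2 powr q * (norm (g x) powr q))"
        by (simp add: powr_mult)
    qed
  qed measurable
  then show ?thesis by (simp add: Lq_space_def)
qed

section \<open>Weak derivatives modulo null sets\<close>

lemma Lq_space_cong_AE:
  fixes f g :: "real^'m \<Rightarrow> 'b::euclidean_space"
  assumes U: "open U" and f: "f \<in> Lq_space q U" and eq: "AE x in lborel. x \<in> U \<longrightarrow> f x = g x"
  shows "g \<in> Lq_space q U" "Lq_norm q U f = Lq_norm q U g"
proof -
  have fm [measurable]: "f \<in> borel_measurable (lebesgue_on U)" using f by (simp add: Lq_space_def)
  have gm [measurable]: "g \<in> borel_measurable (lebesgue_on U)"
    using borel_measurable_lebesgue_on_AE[OF U fm eq] .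
  have AE: "AE x in lebesgue_on U. norm (f x) powr q = norm (g x) powr q"
    unfolding AE_lebesgue_on_iff[OF U] using eq by eventually_elim auto
  have "integrable (lebesgue_on U) (\<lambda>x. norm (g x) powr q)"
    using f by (intro integrable_cong_AE_imp[OF _ _ AE]) (auto simp: Lq_space_def)
  then show "g \<in> Lq_space q U" by (simp add: Lq_space_def)
  show "Lq_norm q U f = Lq_norm q U g"
    unfolding Lq_norm_def by (subst integral_cong_AE[OF _ _ AE]) auto
qed

text \<open>The representative chosen by \<open>weak_pderiv\<close> need not be the one supplied by
  \<open>sobolev_space\<close>; uniqueness identifies them almost everywhere.\<close>

lemma sobolev_weak_pderiv_Lq:
  assumes U: "open U" and f: "f \<in> sobolev_space q U"
  shows "weak_pderiv U j f \<in> Lq_space q U"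
proof -
  obtain g where "g \<in> Lq_space q U" "has_weak_pderiv U j f g"
    using f by (auto simp: sobolev_space_def)
  with sobolev_has_weak_pderiv[OF f] show ?thesis
    using Lq_space_cong_AE(1)[OF U] has_weak_pderiv_unique[OF U] by blast
qed

text \<open>Justifies splitting the Bochner integrals of a difference. Both weights are continuous
  and vanish off the compact support of \<phi>, on which \<open>f\<close> is integrable.\<close>

lemma test_function_integrable:
  fixes f :: "real^'m \<Rightarrow> 'b::euclidean_space"
  assumes U: "open U" and f: "locally_integrable_on f U" and \<phi>: "\<phi> \<in> test_functions U"
  shows "integrable (lebesgue_on U) (\<lambda>x. \<phi> x *\<^sub>R f x)"
    "integrable (lebesgue_on U) (\<lambda>x. partial_deriv j \<phi> x *\<^sub>R f x)"
proof -
  define K where "K = closure {x. \<phi> x \<noteq> 0}"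
  have K: "compact K" "K \<subseteq> U" using \<phi> by (auto simp: K_def test_functions_def)
  have int: "integrable (lebesgue_on U) (\<lambda>x. \<psi> x *\<^sub>R f x)"
    if cont: "continuous_on UNIV \<psi>" and z: "\<And>x. x \<notin> K \<Longrightarrow> \<psi> x = 0" for \<psi> :: "real^'m \<Rightarrow> real"
  proof -
    have fK: "integrable lebesgue (\<lambda>x. indicator K x *\<^sub>R f x)"
      using f K by (auto simp: locally_integrable_on_def set_integrable_def)
    have "compact (\<psi> ` K)" using cont K(1) by (meson compact_continuous_image continuous_on_subset subset_UNIV)
    then obtain B where B: "\<And>x. x \<in> K \<Longrightarrow> \<bar>\<psi> x\<bar> \<le> B"
      using compact_imp_bounded[of "\<psi> ` K"] unfolding bounded_iff by auto
    have "integrable lebesgue (\<lambda>x. \<psi> x *\<^sub>R (indicator K x *\<^sub>R f x))"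
    proof (rule Bochner_Integration.integrable_bound)
      show "integrable lebesgue (\<lambda>x. B *\<^sub>R (indicator K x *\<^sub>R f x))"
        by (intro integrable_scaleR_right fK)
      have "\<psi> \<in> borel_measurable lborel" using cont by (simp add: borel_measurable_continuous_onI)
      then show "(\<lambda>x. \<psi> x *\<^sub>R (indicator K x *\<^sub>R f x)) \<in> borel_measurable lebesgue"
        by (rule borel_measurable_scaleR[OF measurable_completion borel_measurable_integrable[OF fK]])
      show "AE x in lebesgue. norm (\<psi> x *\<^sub>R (indicator K x *\<^sub>R f x)) \<le> norm (B *\<^sub>R (indicator K x *\<^sub>R f x))"
      proof (intro AE_I2)
        fix x show "norm (\<psi> x *\<^sub>R (indicator K x *\<^sub>R f x)) \<le> norm (B *\<^sub>R (indicator K x *\<^sub>R f x))"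
          using B[of x] by (cases "x \<in> K") (auto intro!: mult_right_mono)
      qed
    qed
    moreover have "(\<lambda>x. \<psi> x *\<^sub>R (indicator K x *\<^sub>R f x)) = (\<lambda>x. indicator U x *\<^sub>R (\<psi> x *\<^sub>R f x))"
      using z K(2) by (auto simp: indicator_def fun_eq_iff)
    ultimately show ?thesis using U by (subst integrable_restrict_space) auto
  qed
  have C: "Ck k \<phi>" for k using \<phi> by (auto simp: test_functions_def)
  have K0: "\<phi> x = 0" if "x \<notin> K" for x using that closure_subset[of "{x. \<phi> x \<noteq> 0}"] by (auto simp: K_def)
  show "integrable (lebesgue_on U) (\<lambda>x. \<phi> x *\<^sub>R f x)"
    using C[of 0] K0 by (intro int) auto
  show "integrable (lebesgue_on U) (\<lambda>x. partial_deriv j \<phi> x *\<^sub>R f x)"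
  proof (rule int)
    show "continuous_on UNIV (partial_deriv j \<phi>)" using C[of "Suc 0"] by simp
    fix x assume x: "x \<notin> K"
    have "(\<phi> has_derivative (\<lambda>_. 0)) (at x)"
    proof (rule has_derivative_transform_within_open)
      show "open (- K)" using K(1) by (simp add: compact_imp_closed open_Compl)
      show "((\<lambda>_. 0) has_derivative (\<lambda>_. 0)) (at x)" by simp
    qed (use x K0 in auto)
    then show "partial_deriv j \<phi> x = 0"
      unfolding partial_deriv_def using frechet_derivative_at by metis
  qed
qed

lemma has_weak_pderiv_diff:
  assumes U: "open U" and f: "has_weak_pderiv U j f f'" and g: "has_weak_pderiv U j g g'"
  shows "has_weak_pderiv U j (\<lambda>x. f x - g x) (\<lambda>x. f' x - g' x)"
proof -
  have loc: "locally_integrable_on f U" "locally_integrable_on g U"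
      "locally_integrable_on f' U" "locally_integrable_on g' U"
    using f g by (auto simp: has_weak_pderiv_def)
  then have "locally_integrable_on (\<lambda>x. f x - g x) U" "locally_integrable_on (\<lambda>x. f' x - g' x) U"
    by (auto simp: locally_integrable_on_def)
  moreover have "(LINT x|lebesgue_on U. partial_deriv j \<phi> x *\<^sub>R (f x - g x)) =
        - (LINT x|lebesgue_on U. \<phi> x *\<^sub>R (f' x - g' x))" if \<phi>: "\<phi> \<in> test_functions U" for \<phi>
    using f g \<phi> test_function_integrable[OF U loc(1) \<phi>] test_function_integrable[OF U loc(2) \<phi>]
      test_function_integrable[OF U loc(3) \<phi>] test_function_integrable[OF U loc(4) \<phi>]
    by (simp add: scaleR_right_diff_distrib has_weak_pderiv_def)
  ultimately show ?thesis by (simp add: has_weak_pderiv_def)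
qed

text \<open>Being a choice, \<open>weak_pderiv\<close> respects differences only almost everywhere,
  which the norm does not see.\<close>

lemma Lq_norm_weak_pderiv_diff:
  assumes U: "open U" and q: "q \<ge> 0" and f: "f \<in> sobolev_space q U" and g: "g \<in> sobolev_space q U"
  shows "Lq_norm q U (weak_pderiv U j (\<lambda>x. f x - g x))
       = Lq_norm q U (\<lambda>x. weak_pderiv U j f x - weak_pderiv U j g x)"
proof -
  have d: "has_weak_pderiv U j (\<lambda>x. f x - g x) (\<lambda>x. weak_pderiv U j f x - weak_pderiv U j g x)"
    by (rule has_weak_pderiv_diff[OF U sobolev_has_weak_pderiv[OF f] sobolev_has_weak_pderiv[OF g]])
  then have "has_weak_pderiv U j (\<lambda>x. f x - g x) (weak_pderiv U j (\<lambda>x. f x - g x))"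
    unfolding weak_pderiv_def[of U j "\<lambda>x. f x - g x"]
    by (rule someI[of "has_weak_pderiv U j (\<lambda>x. f x - g x)"])
  then have eq: "AE x in lborel. x \<in> U \<longrightarrow>
      weak_pderiv U j f x - weak_pderiv U j g x = weak_pderiv U j (\<lambda>x. f x - g x) x"
    by (rule has_weak_pderiv_unique[OF U d])
  have "(\<lambda>x. weak_pderiv U j f x - weak_pderiv U j g x) \<in> Lq_space q U"
    by (intro Lq_space_diff q sobolev_weak_pderiv_Lq[OF U] f g)
  from Lq_space_cong_AE(2)[OF U this eq] show ?thesis by (rule sym)
qed

section \<open>Almost everywhere convergent subsequences and domination\<close>

lemma Lq_norm_tendsto_0_iff:
  assumes "q > 0"
  shows "(\<lambda>n. Lq_norm q U (f n)) \<longlonglongrightarrow> 0 \<longleftrightarrow> (\<lambda>n. LINT x|lebesgue_on U. norm (f n x) powr q) \<longlonglongrightarrow> 0"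
proof
  have nn: "0 \<le> (LINT x|lebesgue_on U. norm (f n x) powr q)" for n by simp
  {
    assume "(\<lambda>n. Lq_norm q U (f n)) \<longlonglongrightarrow> 0"
    then have "(\<lambda>n. Lq_norm q U (f n) powr q) \<longlonglongrightarrow> 0"
      using assms by (intro tendsto_zero_powrI[OF _ tendsto_const]) (auto simp: Lq_norm_def)
    then show "(\<lambda>n. LINT x|lebesgue_on U. norm (f n x) powr q) \<longlonglongrightarrow> 0"
      using assms nn by (simp add: Lq_norm_def powr_powr)
  }
  assume "(\<lambda>n. LINT x|lebesgue_on U. norm (f n x) powr q) \<longlonglongrightarrow> 0"
  then show "(\<lambda>n. Lq_norm q U (f n)) \<longlonglongrightarrow> 0"
    unfolding Lq_norm_def using assms nn by (intro tendsto_zero_powrI[OF _ tendsto_const]) auto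
qed

lemma Lq_tendsto_0_AE_subseq:
  assumes q: "q > 0" and f: "\<And>n. f n \<in> Lq_space q U"
    and lim: "(\<lambda>n. Lq_norm q U (f n)) \<longlonglongrightarrow> 0"
  obtains r where "strict_mono (r :: nat \<Rightarrow> nat)" "AE x in lebesgue_on U. (\<lambda>n. f (r n) x) \<longlonglongrightarrow> 0"
proof -
  have "(\<lambda>n. LINT x|lebesgue_on U. norm (f n x) powr q) \<longlonglongrightarrow> 0"
    using lim Lq_norm_tendsto_0_iff[OF q] by blast
  then obtain r where r: "strict_mono (r :: nat \<Rightarrow> nat)"
    "AE x in lebesgue_on U. (\<lambda>n. norm (f (r n) x) powr q) \<longlonglongrightarrow> 0"
    using tendsto_L1_AE_subseq[of "lebesgue_on U" "\<lambda>n x. norm (f n x) powr q"] f by (auto simp: Lq_space_def)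
  from r(2) have "AE x in lebesgue_on U. (\<lambda>n. f (r n) x) \<longlonglongrightarrow> 0"
  proof eventually_elim
    case (elim x)
    then have "(\<lambda>n. (norm (f (r n) x) powr q) powr (1 / q)) \<longlonglongrightarrow> 0"
      using q by (intro tendsto_zero_powrI[OF elim tendsto_const]) auto
    then show ?case using q by (simp add: powr_powr tendsto_norm_zero_iff)
  qed
  with r(1) that show thesis by blast
qed

text \<open>The majorant varies with \<open>n\<close>. The positive part of f_n - g_n is at most |h|
  and at most f_n, so dominated convergence applies to it, and what it misses of f_n is at most
  g_n.\<close>

lemma integral_tendsto_0_generalized_dominated:
  fixes f g :: "nat \<Rightarrow> 'a \<Rightarrow> real"
  assumes f: "\<And>n. integrable M (f n)" "\<And>n x. 0 \<le> f n x"
    and g: "\<And>n. integrable M (g n)" "\<And>n x. 0 \<le> g n x" "(\<lambda>n. \<integral>x. g n x \<partial>M) \<longlonglongrightarrow> 0"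
    and h: "integrable M h"
    and lim: "AE x in M. (\<lambda>n. f n x) \<longlonglongrightarrow> 0"
    and le: "\<And>n. AE x in M. f n x \<le> g n x + h x"
  shows "(\<lambda>n. \<integral>x. f n x \<partial>M) \<longlonglongrightarrow> 0"
proof -
  define v where "v n x = max 0 (f n x - g n x)" for n x
  have v: "integrable M (v n)" for n
    unfolding v_def using f(1) g(1) by (intro integrable_max) auto
  have "(\<lambda>n. \<integral>x. v n x \<partial>M) \<longlonglongrightarrow> (\<integral>x. 0 \<partial>M)"
  proof (rule integral_dominated_convergence[where w = "\<lambda>x. norm (h x)"])
    show "AE x in M. (\<lambda>n. v n x) \<longlonglongrightarrow> 0"
      using lim
    proof eventually_elim
      case (elim x)
      then show ?case
        by (rule Lim_null_comparison[rotated]) (use f(2)[of _ x] g(2)[of _ x] in \<open>auto simp: v_def\<close>)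
    qed
    show "AE x in M. norm (v n x) \<le> norm (h x)" for n
      using le[of n] by eventually_elim (auto simp: v_def)
  qed (use v h in auto)
  then have "(\<lambda>n. (\<integral>x. v n x \<partial>M) + (\<integral>x. g n x \<partial>M)) \<longlonglongrightarrow> 0 + 0"
    by (intro tendsto_add g) simp
  then have *: "(\<lambda>n. (\<integral>x. v n x \<partial>M) + (\<integral>x. g n x \<partial>M)) \<longlonglongrightarrow> 0" by simp
  have "(\<integral>x. f n x \<partial>M) \<le> (\<integral>x. v n x \<partial>M) + (\<integral>x. g n x \<partial>M)" for n
  proof -
    have "(\<integral>x. f n x \<partial>M) \<le> (\<integral>x. v n x + g n x \<partial>M)"
      using f(1) v g(1) by (intro integral_mono) (auto simp: v_def)
    then show ?thesis using v g(1) by simp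
  qed
  moreover have "0 \<le> (\<integral>x. f n x \<partial>M)" for n using f(2) by (intro Bochner_Integration.integral_nonneg)
  ultimately show ?thesis by (intro Lim_null_comparison[OF _ *]) auto
qed

lemma Lq_norm_nonneg: "0 \<le> Lq_norm q U f"
  by (simp add: Lq_norm_def)

lemma sobolev_norm_tendsto_0:
  assumes "(\<lambda>n. sobolev_norm q U (f n)) \<longlonglongrightarrow> 0"
  shows "(\<lambda>n. Lq_norm q U (f n)) \<longlonglongrightarrow> 0" "(\<lambda>n. Lq_norm q U (weak_pderiv U j (f n))) \<longlonglongrightarrow> 0"
proof -
  have "Lq_norm q U (f n) \<le> sobolev_norm q U (f n)" for n
    unfolding sobolev_norm_def by (simp add: sum_nonneg Lq_norm_nonneg)
  then show "(\<lambda>n. Lq_norm q U (f n)) \<longlonglongrightarrow> 0"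
    by (intro Lim_null_comparison[OF _ assms]) (auto simp: Lq_norm_nonneg)
  have "Lq_norm q U (weak_pderiv U j (f n)) \<le> (\<Sum>i\<in>UNIV. Lq_norm q U (weak_pderiv U i (f n)))" for n
    by (intro member_le_sum) (auto simp: Lq_norm_nonneg)
  then have "Lq_norm q U (weak_pderiv U j (f n)) \<le> sobolev_norm q U (f n)" for n
    unfolding sobolev_norm_def using Lq_norm_nonneg[of q U "f n"] by (metis add.commute add_increasing2)
  then show "(\<lambda>n. Lq_norm q U (weak_pderiv U j (f n))) \<longlonglongrightarrow> 0"
    by (intro Lim_null_comparison[OF _ assms]) (auto simp: Lq_norm_nonneg)
qed

theorem theorem1p13:
  fixes U :: "(real^'m) set" and q :: real
    and A :: "real^'m \<Rightarrow> complex^'d^'d" and As :: "nat \<Rightarrow> real^'m \<Rightarrow> complex^'d^'d"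
    and l :: "real^'m \<Rightarrow> complex^'d" and ls :: "nat \<Rightarrow> real^'m \<Rightarrow> complex^'d"
    and j :: 'm
  assumes "1 \<le> q"
    and "open U" and "bounded U"
    and "A \<in> sobolev_normal q U" and "\<And>n. As n \<in> sobolev_normal q U"
    and "(\<lambda>n. sobolev_norm q U (\<lambda>x. As n x - A x)) \<longlonglongrightarrow> 0"
    and "l \<in> sobolev_space q U" and "\<And>n. ls n \<in> sobolev_space q U"
    and "eigenvalue_parameterization U A l"
    and "\<And>n. eigenvalue_parameterization U (As n) (ls n)"
    and "Linf_converges_on_segments U ls l"
  shows "(\<lambda>n. Lq_norm q U (\<lambda>x. weak_pderiv U j (ls n) x - weak_pderiv U j l x)) \<longlonglongrightarrow> 0"
proof -
  note U = assms(2)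
  have q: "q > 0" "q \<ge> 0" using assms(1) by auto
  define M where "M = lebesgue_on U"
  define A' where "A' = weak_pderiv U j A"
  define As' where "As' n = weak_pderiv U j (As n)" for n
  define l' where "l' = weak_pderiv U j l"
  define ls' where "ls' n = weak_pderiv U j (ls n)" for n
  have sob: "A \<in> sobolev_space q U" "As n \<in> sobolev_space q U" for n
    using assms(4,5) by (auto simp: sobolev_normal_def)
  have Lq: "A' \<in> Lq_space q U" "As' n \<in> Lq_space q U" "l' \<in> Lq_space q U" "ls' n \<in> Lq_space q U" for n
    unfolding A'_def As'_def l'_def ls'_def
    by (intro sobolev_weak_pderiv_Lq[OF U] sob assms(7,8))+
  have LqA: "A \<in> Lq_space q U" "As n \<in> Lq_space q U" for n
    using sob by (auto simp: sobolev_space_def)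
  have lm: "l \<in> borel_measurable (lebesgue_on U)" "ls n \<in> borel_measurable (lebesgue_on U)" for n
    using assms(7,8) by (auto simp: sobolev_space_def Lq_space_def)
  have DLq: "(\<lambda>x. As n x - A x) \<in> Lq_space q U" "(\<lambda>x. As' n x - A' x) \<in> Lq_space q U"
      "(\<lambda>x. ls' n x - l' x) \<in> Lq_space q U" for n
    by (intro Lq_space_diff q Lq LqA)+
  have lim: "(\<lambda>n. Lq_norm q U (\<lambda>x. As n x - A x)) \<longlonglongrightarrow> 0" "(\<lambda>n. Lq_norm q U (\<lambda>x. As' n x - A' x)) \<longlonglongrightarrow> 0"
    using sobolev_norm_tendsto_0(1)[OF assms(6)] sobolev_norm_tendsto_0(2)[OF assms(6), of j]
    unfolding Lq_norm_weak_pderiv_diff[OF U q(2) sob(2) sob(1)] As'_def A'_def by auto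
  have eig: "AE x in M. eigen_derivative (A x) (A' x) (l x) (l' x)"
    unfolding M_def AE_lebesgue_on_iff[OF U] A'_def l'_def
    by (rule AE_eigen_derivative[OF U assms(4,7,9)])
  have eigs: "AE x in M. \<forall>n. eigen_derivative (As n x) (As' n x) (ls n x) (ls' n x)"
    unfolding M_def AE_all_countable AE_lebesgue_on_iff[OF U] As'_def ls'_def
    using AE_eigen_derivative[OF U assms(5,8,10)] by blast
  have conv: "AE x in M. (\<lambda>n. ls n x) \<longlonglongrightarrow> l x"
    unfolding M_def AE_lebesgue_on_iff[OF U]
    by (rule Linf_converges_on_segments_AE[OF assms(11) U lm(2,1)])
  define c where "c = real CARD('d) * real CARD('d)^2"
  have c: "c \<ge> 0" by (simp add: c_def)
  define f where "f n x = norm (ls' n x - l' x) powr q" for n x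
  \<comment> \<open>The estimate |ls' - l'| <= c |As' - A'| + 2 c |A'| and
    \<open>powr_add_le\<close> dictate the two majorants: \<open>g n\<close> tends to 0 in L^1, and
    \<open>h\<close> is integrable and free of \<open>n\<close>.\<close>
  define g where "g n x = (2 * c) powr q * norm (As' n x - A' x) powr q" for n x
  define h where "h x = (2 * (c * 2)) powr q * norm (A' x) powr q" for x
  have fgh: "integrable M (f n)" "integrable M (g n)" "integrable M h" for n
    using DLq(2,3)[of n] Lq(1) unfolding M_def f_def g_def h_def Lq_space_def by auto
  have gh0: "0 \<le> g n x" "0 \<le> f n x" for n x by (auto simp: f_def g_def)
  have glim: "(\<lambda>n. \<integral>x. g n x \<partial>M) \<longlonglongrightarrow> 0"
    using lim(2) unfolding Lq_norm_tendsto_0_iff[OF q(1)] g_def M_def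
    by (simp add: tendsto_mult_right_zero)
  have le: "AE x in M. f n x \<le> g n x + h x" for n
    using eig eigs
  proof eventually_elim
    case (elim x)
    have "norm (ls' n x - l' x) \<le> norm (ls' n x) + norm (l' x)" by (rule norm_triangle_ineq4)
    also have "\<dots> \<le> c * norm (As' n x) + c * norm (A' x)"
      unfolding c_def using elim by (intro add_mono eigen_derivative_norm_le) auto
    also have "\<dots> \<le> c * (norm (As' n x - A' x) + norm (A' x)) + c * norm (A' x)"
      using c norm_triangle_sub[of "As' n x" "A' x"] by (auto intro!: mult_left_mono)
    also have "\<dots> = c * norm (As' n x - A' x) + c * 2 * norm (A' x)" by (simp add: algebra_simps)
    finally have "f n x \<le> (c * norm (As' n x - A' x) + c * 2 * norm (A' x)) powr q"
      unfolding f_def using q by (intro powr_mono2) auto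
    also have "\<dots> \<le> (2 * (c * norm (As' n x - A' x))) powr q + (2 * (c * 2 * norm (A' x))) powr q"
      using q c by (intro powr_add_le) auto
    also have "\<dots> = g n x + h x"
      unfolding g_def h_def using c by (simp add: powr_mult mult.assoc)
    finally show ?case .
  qed
  have "(\<lambda>n. \<integral>x. f n x \<partial>M) \<longlonglongrightarrow> 0"
  \<comment> \<open>Convergence in L^q gives pointwise convergence of the matrices and their
    derivatives only along subsequences; the eigenvalues converge almost everywhere without
    extraction.\<close>
  proof (rule tendsto_sequentially_subseq)
    fix r :: "nat \<Rightarrow> nat" assume r: "strict_mono r"
    have lr: "(\<lambda>n. Lq_norm q U (\<lambda>x. As (r n) x - A x)) \<longlonglongrightarrow> 0"
      using LIMSEQ_subseq_LIMSEQ[OF lim(1) r] by (simp add: o_def)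
    obtain s where s: "strict_mono (s :: nat \<Rightarrow> nat)" "AE x in M. (\<lambda>n. As (r (s n)) x - A x) \<longlonglongrightarrow> 0"
      unfolding M_def using Lq_tendsto_0_AE_subseq[OF q(1) DLq(1) lr] by blast
    have rs: "strict_mono (\<lambda>n. r (s n))" using r s(1) by (simp add: strict_mono_def)
    have lrs: "(\<lambda>n. Lq_norm q U (\<lambda>x. As' (r (s n)) x - A' x)) \<longlonglongrightarrow> 0"
      using LIMSEQ_subseq_LIMSEQ[OF lim(2) rs] by (simp add: o_def)
    obtain t where t: "strict_mono (t :: nat \<Rightarrow> nat)" "AE x in M. (\<lambda>n. As' (r (s (t n))) x - A' x) \<longlonglongrightarrow> 0"
      unfolding M_def using Lq_tendsto_0_AE_subseq[OF q(1) DLq(2) lrs] by blast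
    have st: "strict_mono (\<lambda>n. s (t n))" and rst: "strict_mono (\<lambda>n. r (s (t n)))"
      using r s(1) t(1) by (simp_all add: strict_mono_def)
    have "(\<lambda>n. \<integral>x. f (r (s (t n))) x \<partial>M) \<longlonglongrightarrow> 0"
    proof (rule integral_tendsto_0_generalized_dominated[where g = "\<lambda>n. g (r (s (t n)))" and h = h])
      show "(\<lambda>n. \<integral>x. g (r (s (t n))) x \<partial>M) \<longlonglongrightarrow> 0"
        using LIMSEQ_subseq_LIMSEQ[OF glim rst] by (simp add: o_def)
      show "AE x in M. (\<lambda>n. f (r (s (t n))) x) \<longlonglongrightarrow> 0"
        using eig eigs conv s(2) t(2)
      proof eventually_elim
        case (elim x)
        have "(\<lambda>n. As (r (s n)) x) \<longlonglongrightarrow> A x" using elim(4) by (simp add: LIM_zero_iff)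
        then have As_lim: "(\<lambda>n. As (r (s (t n))) x) \<longlonglongrightarrow> A x"
          using LIMSEQ_subseq_LIMSEQ[OF _ t(1)] by (force simp: o_def)
        have "(\<lambda>n. ls' (r (s (t n))) x) \<longlonglongrightarrow> l' x"
        proof (rule eigen_derivative_tendsto)
          show "eigen_derivative (As (r (s (t n))) x) (As' (r (s (t n))) x) (ls (r (s (t n))) x) (ls' (r (s (t n))) x)" for n
            using elim(2) by blast
          show "eigen_derivative (A x) (A' x) (l x) (l' x)" by (rule elim(1))
          show "(\<lambda>n. As (r (s (t n))) x) \<longlonglongrightarrow> A x" by (rule As_lim)
          show "(\<lambda>n. As' (r (s (t n))) x) \<longlonglongrightarrow> A' x" using elim(5) by (simp add: LIM_zero_iff)
          show "(\<lambda>n. ls (r (s (t n))) x) \<longlonglongrightarrow> l x"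
            using LIMSEQ_subseq_LIMSEQ[OF elim(3) rst] by (simp add: o_def)
        qed
        then have "(\<lambda>n. norm (ls' (r (s (t n))) x - l' x)) \<longlonglongrightarrow> 0"
          by (simp add: LIM_zero_iff tendsto_norm_zero_iff)
        then show ?case
          unfolding f_def using q by (intro tendsto_zero_powrI[OF _ tendsto_const]) auto
      qed
    qed (use fgh gh0 le in auto)
    then show "\<exists>s. strict_mono s \<and> (\<lambda>n. \<integral>x. f (r (s n)) x \<partial>M) \<longlonglongrightarrow> 0"
      using st by blast
  qed
  then show ?thesis
    unfolding Lq_norm_tendsto_0_iff[OF q(1)] f_def M_def ls'_def l'_def .
qed

end
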